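(* Let $n\ge 2$, and for $P,Q\in\mathbb{S}^n\subset\mathbb{R}^{n+1}$ let $\|P-Q\|$ denote the extrinsic (Euclidean) distance in $\mathbb{R}^{n+1}$. The Green functions $G(P,Q)$ of the GJMS operators on $\mathbb{S}^n$ with respect to the round metric are as follows. (1) In critical dimension $n$, the Green function of $P_n$ is $G(P,Q)=-c_n\log\|P-Q\|+c$, where $$c_n=\frac{2}{(n-1)!\,|\mathbb{S}^n|}=\frac{1}{2^{n-1}\pi^{n/2}\Gamma(\frac n2)}\quad\text{and}\quad c\in\mathbb{R}.$$ (2) For a positive integer $k$ with $2k<n$, or with $2k>n$ and $n$ odd, the Green function of $P_{2k}$ is $G(P,Q)=c_{n,k}\|P-Q\|^{2k-n}$, where $$c_{n,k}=\frac{\Gamma(\frac n2-k)}{2^{2k}\pi^{n/2}\Gamma(k)}.$$ (3) For $\sigma\in(0,\frac n2)\cup(\frac n2,+\infty)$ with $\sigma\notin\frac n2+\mathbb{N}$, the Green function of $P_{2\sigma}$ is $G(P,Q)=c_{n,\sigma}\|P-Q\|^{2\sigma-n}$, where $$c_{n,\sigma}=\frac{\Gamma(\frac n2-\sigma)}{2^{2\sigma}\pi^{n/2}\Gamma(\sigma)}.$$ Here $\Gamma$ is the meromorphic Gamma function on $\mathbb{C}$, equal to $\int_0^\infty t^{z-1}e^{-t}\,dt$ for $z\in\mathbb{R}_+$.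
   Context: $\mathbb{S}^n\subset\mathbb{R}^{n+1}$ is the unit sphere with round metric $g_{\mathbb{S}^n}$, Laplace–Beltrami operator $\Delta_{\mathbb{S}^n}$ (nonpositive), volume element $dV_{\mathbb{S}^n}$ and total volume $|\mathbb{S}^n|$. GJMS operators on $\mathbb{S}^n$: - Critical dimension: $P_n=\prod_{j=0}^{(n-2)/2}\big(-\Delta_{\mathbb{S}^n}+j(n-1-j)\big)$ for $n$ even, and $P_n=\sqrt{-\Delta_{\mathbb{S}^n}+(\frac{n-1}{2})^2}\,\prod_{j=0}^{(n-3)/2}\big(-\Delta_{\mathbb{S}^n}+j(n-1-j)\big)$ for $n$ odd. Equivalently, $P_n$ acts on spherical harmonics of degree $l$ by multiplication by $\Gamma(l+n)/\Gamma(l)$ (equal to $0$ for $l=0$). - For a positive integer $k$ with $2k\ne n$: $P_{2k}=\prod_{i=1}^k\big(-\Delta_{\mathbb{S}^n}+(\frac n2+i-1)(\frac n2-i)\big)$. - For $\sigma>0$, $\sigma\notin\frac n2+\mathbb{N}$: $P_{2\sigma}$ is the (fractional) GJMS operator, acting on spherical harmonics of degree $l\ge0$ by multiplication by $\Gamma(l+\frac n2+\sigma)/\Gamma(l+\frac n2-\sigma)$. Green functions: in critical dimension, $G$ is a Green function of $P_n$ if for every $Q\in\mathbb{S}^n$, $P_nG(\cdot,Q)=\delta_Q-\frac1{|\mathbb{S}^n|}$ in the distribution sense, i.e. $u(Q)=\frac{1}{|\mathbb{S}^n|}\int_{\mathbb{S}^n}u\,dV_{\mathbb{S}^n}+\int_{\mathbb{S}^n}G(\cdot,Q)P_nu\,dV_{\mathbb{S}^n}$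 for all $u\in C^\infty(\mathbb{S}^n)$ (so it is determined only up to an additive constant). In the other cases $G$ is the Green function of $P_{2\gamma}$ ($\gamma=k$ or $\sigma$) if $P_{2\gamma}G(\cdot,Q)=\delta_Q$ in the distribution sense, i.e. $u(Q)=\int_{\mathbb{S}^n}G(\cdot,Q)P_{2\gamma}u\,dV_{\mathbb{S}^n}$ for all $u\in C^\infty(\mathbb{S}^n)$. *)

theory Defs
  imports "HOL-Analysis.Analysis"
begin

text \<open>
  The unit sphere is the set \<open>sphere 0 1\<close> of a Euclidean space of dimension \<open>n + 1\<close>. Functions on
  the sphere are represented by functions on the whole space, of which only the values on the
  sphere matter.
\<close>

text \<open>
  The Riemannian volume measure of the round metric. In polar coordinates
  \<open>dx = r ^ n dr dV\<close>, so the volume of \<open>A\<close> is \<open>n + 1\<close> times the Lebesgue measure of the solid cone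
  \<open>{r *\<^sub>R x | x \<in> A, 0 < r < 1}\<close>. Note that \<open>sgn x = x /\<^sub>R norm x\<close> is the radial projection.
\<close>
definition sphere_measure :: "'a::euclidean_space measure" where
  "sphere_measure = scale_measure (ennreal (real DIM('a)))
     (distr (restrict_space lborel (ball 0 1 - {0})) (restrict_space borel (sphere 0 1)) sgn)"

definition sphere_volume :: "'a::euclidean_space itself \<Rightarrow> real" where
  "sphere_volume _ = measure (sphere_measure :: 'a measure) (sphere 0 1)"

primrec Ck_on :: "nat \<Rightarrow> ('a::euclidean_space \<Rightarrow> real) \<Rightarrow> 'a set \<Rightarrow> bool" where
  "Ck_on 0 f U \<longleftrightarrow> continuous_on U f"
| "Ck_on (Suc k) f U \<longleftrightarrow> (\<forall>x\<in>U. f differentiable (at x)) \<and>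
     (\<forall>v. Ck_on k (\<lambda>x. frechet_derivative f (at x) v) U)"

definition smooth_on_sphere :: "('a::euclidean_space \<Rightarrow> real) \<Rightarrow> bool" where
  "smooth_on_sphere u \<longleftrightarrow>
     (\<exists>U F. open U \<and> sphere 0 1 \<subseteq> U \<and> (\<forall>k. Ck_on k F U) \<and> (\<forall>x\<in>sphere 0 1. u x = F x))"

text \<open>
  Gradient and divergence for the metric induced on the sphere. Since \<open>u \<circ> sgn\<close> is constant along
  rays, its Euclidean gradient at a point of the sphere is tangential and represents the
  differential of \<open>u\<close>. Likewise the trace of the derivative of \<open>X \<circ> sgn\<close> has no radial
  contribution and equals the sum of \<open>D\<^bsub>e\<^esub>X \<bullet> e\<close> over an orthonormal basis of the tangent space,
  which for a tangential field \<open>X\<close> is the trace of its Levi-Civita derivative (the tangential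
  part of \<open>D X\<close>).
\<close>
definition sphere_gradient :: "('a::euclidean_space \<Rightarrow> real) \<Rightarrow> 'a \<Rightarrow> 'a" where
  "sphere_gradient u x = (\<Sum>b\<in>Basis. frechet_derivative (\<lambda>y. u (sgn y)) (at x) b *\<^sub>R b)"

definition sphere_divergence :: "('a::euclidean_space \<Rightarrow> 'a) \<Rightarrow> 'a \<Rightarrow> real" where
  "sphere_divergence X x = (\<Sum>b\<in>Basis. frechet_derivative (\<lambda>y. X (sgn y)) (at x) b \<bullet> b)"

definition sphere_laplacian :: "('a::euclidean_space \<Rightarrow> real) \<Rightarrow> 'a \<Rightarrow> real" where
  "sphere_laplacian u = sphere_divergence (sphere_gradient u)"

definition euclidean_laplacian :: "('a::euclidean_space \<Rightarrow> real) \<Rightarrow> 'a \<Rightarrow> real" where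
  "euclidean_laplacian f x =
     (\<Sum>b\<in>Basis. frechet_derivative (\<lambda>y. frechet_derivative f (at y) b) (at x) b)"

text \<open>
  Spherical harmonics of degree \<open>l\<close>, given by the homogeneous harmonic polynomials on the ambient
  space of which they are the restrictions. A homogeneous polynomial is determined by its
  restriction to the sphere, so the orthogonal projection below is unique as a function on the
  whole space.
\<close>
definition spherical_harmonics :: "nat \<Rightarrow> ('a::euclidean_space \<Rightarrow> real) set" where
  "spherical_harmonics l = {Y. real_polynomial_function Y \<and>
     (\<forall>t x. Y (t *\<^sub>R x) = t ^ l * Y x) \<and> (\<forall>x. euclidean_laplacian Y x = 0)}"

definition harmonic_component :: "nat \<Rightarrow> ('a::euclidean_space \<Rightarrow> real) \<Rightarrow> 'a \<Rightarrow> real" where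
  "harmonic_component l u = (THE Y. Y \<in> spherical_harmonics l \<and>
     (\<forall>Z\<in>spherical_harmonics l.
        (\<integral>x. Y x * Z x \<partial>sphere_measure) = (\<integral>x. u x * Z x \<partial>sphere_measure)))"

text \<open>The operator acting on spherical harmonics of degree \<open>l\<close> as multiplication by \<open>m l\<close>.\<close>
definition harmonic_multiplier ::
    "(nat \<Rightarrow> real) \<Rightarrow> ('a::euclidean_space \<Rightarrow> real) \<Rightarrow> 'a \<Rightarrow> real" where
  "harmonic_multiplier m u x = (\<Sum>l. m l * harmonic_component l u x)"

definition shifted_laplacian :: "real \<Rightarrow> ('a::euclidean_space \<Rightarrow> real) \<Rightarrow> 'a \<Rightarrow> real" where
  "shifted_laplacian c u x = - sphere_laplacian u x + c * u x"

text \<open>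
  In the operators below \<open>n\<close> is the dimension of the sphere. The square root of
  \<open>- \<Delta> + ((n - 1) / 2)\<^sup>2\<close> is taken in the functional calculus of \<open>- \<Delta>\<close>, whose eigenvalue on
  spherical harmonics of degree \<open>l\<close> is \<open>l * (l + n - 1)\<close>. The range \<open>[0..<n div 2]\<close> ends with
  \<open>(n - 2) / 2\<close> for even \<open>n\<close> and with \<open>(n - 3) / 2\<close> for odd \<open>n\<close>.
\<close>
definition sqrt_shifted_laplacian :: "nat \<Rightarrow> ('a::euclidean_space \<Rightarrow> real) \<Rightarrow> 'a \<Rightarrow> real" where
  "sqrt_shifted_laplacian n =
     harmonic_multiplier (\<lambda>l. sqrt (real l * (real l + real n - 1) + ((real n - 1) / 2)\<^sup>2))"

definition gjms_critical :: "nat \<Rightarrow> ('a::euclidean_space \<Rightarrow> real) \<Rightarrow> 'a \<Rightarrow> real" where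
  "gjms_critical n u =
     (let v = foldr (\<lambda>j. shifted_laplacian (real j * (real n - 1 - real j))) [0..<n div 2] u
      in if even n then v else sqrt_shifted_laplacian n v)"

definition gjms_integer :: "nat \<Rightarrow> nat \<Rightarrow> ('a::euclidean_space \<Rightarrow> real) \<Rightarrow> 'a \<Rightarrow> real" where
  "gjms_integer n k =
     foldr (\<lambda>i. shifted_laplacian ((real n / 2 + real i - 1) * (real n / 2 - real i))) [1..<Suc k]"

definition gjms_fractional :: "nat \<Rightarrow> real \<Rightarrow> ('a::euclidean_space \<Rightarrow> real) \<Rightarrow> 'a \<Rightarrow> real" where
  "gjms_fractional n \<sigma> = harmonic_multiplier
     (\<lambda>l. Gamma (real l + real n / 2 + \<sigma>) / Gamma (real l + real n / 2 - \<sigma>))"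

text \<open>
  Integrability of \<open>G(\<cdot>, Q)\<close> makes it a distribution; the product is required to be integrable
  because the Bochner integral of a non-integrable function is \<open>0\<close>. Values of \<open>G\<close> on the diagonal
  are irrelevant.
\<close>
definition green_function ::
    "(('a::euclidean_space \<Rightarrow> real) \<Rightarrow> 'a \<Rightarrow> real) \<Rightarrow> ('a \<Rightarrow> 'a \<Rightarrow> real) \<Rightarrow> bool" where
  "green_function L G \<longleftrightarrow> (\<forall>Q\<in>sphere 0 1.
     integrable sphere_measure (\<lambda>P. G P Q) \<and>
     (\<forall>u. smooth_on_sphere u \<longrightarrow>
        integrable sphere_measure (\<lambda>P. G P Q * L u P) \<and>
        u Q = (\<integral>P. G P Q * L u P \<partial>sphere_measure)))"

definition critical_green_function ::
    "(('a::euclidean_space \<Rightarrow> real) \<Rightarrow> 'a \<Rightarrow> real) \<Rightarrow> ('a \<Rightarrow> 'a \<Rightarrow> real) \<Rightarrow> bool" where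
  "critical_green_function L G \<longleftrightarrow> (\<forall>Q\<in>sphere 0 1.
     integrable sphere_measure (\<lambda>P. G P Q) \<and>
     (\<forall>u. smooth_on_sphere u \<longrightarrow>
        integrable sphere_measure (\<lambda>P. G P Q * L u P) \<and>
        u Q = 1 / sphere_volume TYPE('a) * (\<integral>P. u P \<partial>sphere_measure)
              + (\<integral>P. G P Q * L u P \<partial>sphere_measure)))"

text \<open>
  \<open>K\<close> is the Green function of \<open>L\<close>, unique up to null sets. In the critical case it is unique only
  up to an additive constant, and as the defining equation treats each pole \<open>Q\<close> separately, this
  constant may depend on \<open>Q\<close>.
\<close>
definition is_the_green_function ::
    "(('a::euclidean_space \<Rightarrow> real) \<Rightarrow> 'a \<Rightarrow> real) \<Rightarrow> ('a \<Rightarrow> 'a \<Rightarrow> real) \<Rightarrow> bool" where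
  "is_the_green_function L K \<longleftrightarrow> green_function L K \<and>
     (\<forall>G. green_function L G \<longrightarrow>
        (\<forall>Q\<in>sphere 0 1. AE P in sphere_measure. G P Q = K P Q))"

definition is_the_critical_green_function ::
    "(('a::euclidean_space \<Rightarrow> real) \<Rightarrow> 'a \<Rightarrow> real) \<Rightarrow> ('a \<Rightarrow> 'a \<Rightarrow> real) \<Rightarrow> bool" where
  "is_the_critical_green_function L K \<longleftrightarrow>
     (\<forall>c. critical_green_function L (\<lambda>P Q. K P Q + c)) \<and>
     (\<forall>G. critical_green_function L G \<longrightarrow>
        (\<forall>Q\<in>sphere 0 1. \<exists>c. AE P in sphere_measure. G P Q = K P Q + c))"

end

theory Submission
  imports Defs
begin

text \<open>
  Write \<open>w = (norm (P - Q))\<^sup>2\<close>. Invariance of the volume under plane rotations gives a divergence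
  theorem on the sphere for ambient vector fields. For a harmonic \<open>Y\<close> of degree \<open>l\<close> with gradient
  \<open>\<nabla>Y\<close>, apply it to \<open>\<phi> w *\<^sub>R (l * Y P *\<^sub>R (P - Q) - w / 2 *\<^sub>R \<nabla>Y P)\<close> and let \<open>\<phi> w\<close> tend to
  \<open>w powr s\<close>: the integral of \<open>w powr s * Y\<close> becomes a multiple of the integral of \<open>w powr s\<close> times
  the derivative of \<open>Y\<close> in direction \<open>Q\<close>, a harmonic of degree \<open>l - 1\<close>. By induction on \<open>l\<close> the
  kernel \<open>w powr s\<close> acts on harmonics of degree \<open>l\<close> as the integral of \<open>w powr s\<close> times a quotient of
  Pochhammer symbols. That integral satisfies a recursion in \<open>s\<close>, the case \<open>l = 0\<close>, and is log-convex,
  so the Bohr-Mollerup theorem evaluates it. The logarithm is the derivative of \<open>w powr s\<close> at \<open>s = 0\<close>.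

  The kernel \<open>w powr (1/2)\<close> bounds the maximum of a harmonic by its mean absolute value, with a constant
  that grows polynomially in the degree. Hence the harmonics of each degree form a finite-dimensional
  space, and the series of harmonic components of a smooth function converges rapidly; on it the
  kernel inverts the GJMS operator term by term. The Green function is unique because polynomials
  on the sphere are sums of harmonics.
\<close>

text \<open>Apart from its total mass and elementary facts on null and open sets, invariance under
  orthogonal maps is the only property of the cone measure that is used. Every integral identity
  below is an instance of the resulting divergence theorem. In particular the integral of
  \<open>w powr s\<close>, classically a Beta integral over latitudes, is pinned down by its
  functional equation alone.

  The exponent \<open>s = \<sigma> - n / 2\<close> explains the exceptional values of \<sigma>. If
  \<open>s\<close> is a natural number, the kernel is a polynomial, it annihilates all harmonics of
  degree above \<open>s\<close>, and it cannot invert anything. The critical case is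
  \<open>s = 0\<close>: the kernel is constant, and the logarithm is the first-order term that
  remains visible to harmonics of positive degree.

  The harmonic component is a definite description, so the projection onto each degree has to be
  shown to exist before the fractional and odd critical operators mean anything. This is why a
  pointwise bound and finite dimension come before any expansion. The bound must in addition be
  polynomial in the degree, since only polynomial losses can be repaid by powers of the
  Laplacian.\<close>

section \<open>The volume measure of the sphere\<close>

text \<open>The image measure is translation invariant. For two such measures Fubini's theorem gives
  \<open>\<nu> A * \<lambda> B = \<nu> B * \<lambda> A\<close>, so they agree as soon as they agree on the ball.\<close>

lemma distr_lborel_orthogonal:
  fixes R :: "'a::euclidean_space \<Rightarrow> 'a"
  assumes R: "orthogonal_transformation R"
  shows "distr lborel borel R = lborel"
proof -
  define \<nu> where "\<nu> = distr lborel borel R"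
  define R' where "R' = inv R"
  have lin: "linear R" using R by (simp add: orthogonal_transformation_linear)
  have bij: "bij R" using R by (rule orthogonal_transformation_bij)
  have R': "orthogonal_transformation R'" unfolding R'_def using R by (rule orthogonal_transformation_inv)
  have lin': "linear R'" using R' by (simp add: orthogonal_transformation_linear)
  have RR': "R (R' x) = x" for x using bij by (simp add: R'_def bij_is_surj surj_f_inv_f)
  have R'R: "R' (R x) = x" for x using bij by (simp add: R'_def bij_is_inj)
  have [measurable]: "R \<in> borel \<rightarrow>\<^sub>M borel" "R' \<in> borel \<rightarrow>\<^sub>M borel"
    using lin lin' by (auto intro!: borel_measurable_continuous_onI linear_continuous_on linear_conv_bounded_linear[THEN iffD1])
  have [measurable_cong, simp]: "sets \<nu> = sets borel" by (simp add: \<nu>_def)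
  have [simp]: "space \<nu> = UNIV" by (simp add: \<nu>_def)
  \<comment> \<open>Fubini's theorem below needs this. The preimages under \<open>R'\<close> of an
    exhausting sequence have under \<open>\<nu>\<close> the Lebesgue measure of the original
    sets.\<close>
  interpret nu: sigma_finite_measure \<nu>
  proof (rule sigma_finite_measure.intro)
    obtain A :: "nat \<Rightarrow> 'a set" where A: "range A \<subseteq> sets lborel" "(\<Union>i. A i) = space lborel"
        "\<And>i. emeasure lborel (A i) \<noteq> \<infinity>"
      using lborel.sigma_finite by blast
    have "emeasure \<nu> (R' -` A i) = emeasure lborel (A i)" for i
      unfolding \<nu>_def using A(1) by (subst emeasure_distr)
        (auto simp: R'R vimage_def intro!: measurable_sets_borel[of R', unfolded vimage_def])
    then show "\<exists>B. countable B \<and> B \<subseteq> sets \<nu> \<and> \<Union> B = space \<nu> \<and> (\<forall>a\<in>B. emeasure \<nu> a \<noteq> \<infinity>)"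
      using A measurable_sets_borel[of R' borel]
      by (intro exI[of _ "range (\<lambda>i. R' -` A i)"]) (auto simp: image_subset_iff vimage_UN[symmetric])
  qed
  have trans: "distr \<nu> borel (\<lambda>x. x + y) = \<nu>" for y
  proof -
    have "distr \<nu> borel (\<lambda>x. x + y) = distr lborel borel (\<lambda>x. R x + y)"
      unfolding \<nu>_def by (subst distr_distr) (auto simp: comp_def)
    also have "(\<lambda>x. R x + y) = (\<lambda>x. R (R' y + x))"
      using lin RR' by (auto simp: linear_add add.commute)
    also have "distr lborel borel (\<lambda>x. R (R' y + x)) = distr (distr lborel borel ((+) (R' y))) borel R"
      by (subst distr_distr) (auto simp: comp_def)
    also have "\<dots> = \<nu>" by (simp add: lborel_distr_plus \<nu>_def)
    finally show ?thesis .
  qed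
  interpret pair_sigma_finite \<nu> lborel ..
  have refl: "distr lborel borel (\<lambda>y. x - y) = lborel" for x :: 'a
    using lborel_affine[of "-1" x] by (simp add: density_1)
  have trans_nn: "(\<integral>\<^sup>+x. f (x + y) \<partial>\<nu>) = (\<integral>\<^sup>+x. f x \<partial>\<nu>)"
    if [measurable]: "f \<in> borel_measurable borel" for f :: "'a \<Rightarrow> ennreal" and y
    by (subst (2) trans[of y, symmetric], subst nn_integral_distr) auto
  have trans_lb: "(\<integral>\<^sup>+x. f (x + y) \<partial>lborel) = (\<integral>\<^sup>+x. f x \<partial>lborel)"
    if [measurable]: "f \<in> borel_measurable borel" for f :: "'a \<Rightarrow> ennreal" and y
    by (subst (2) lborel_distr_plus[of y, symmetric], subst nn_integral_distr) (auto simp: add.commute)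
  have refl_lb: "(\<integral>\<^sup>+y. f (x - y) \<partial>lborel) = (\<integral>\<^sup>+x. f x \<partial>lborel)"
    if [measurable]: "f \<in> borel_measurable borel" for f :: "'a \<Rightarrow> ennreal" and x
    by (subst (2) refl[of x, symmetric], subst nn_integral_distr) auto
  have swap: "emeasure \<nu> A * emeasure lborel B = emeasure \<nu> B * emeasure lborel A"
    if [measurable]: "A \<in> sets borel" "B \<in> sets borel" for A B :: "'a set"
  proof -
    have "emeasure \<nu> A * emeasure lborel B = (\<integral>\<^sup>+x. indicator A x * (\<integral>\<^sup>+y. indicator B y \<partial>lborel) \<partial>\<nu>)"
      by (simp add: nn_integral_multc)
    also have "\<dots> = (\<integral>\<^sup>+x. indicator A x * (\<integral>\<^sup>+y. indicator B (y + x) \<partial>lborel) \<partial>\<nu>)"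
      by (subst trans_lb) auto
    also have "\<dots> = (\<integral>\<^sup>+x. \<integral>\<^sup>+y. indicator A x * indicator B (y + x) \<partial>lborel \<partial>\<nu>)"
      by (subst nn_integral_cmult) auto
    also have "\<dots> = (\<integral>\<^sup>+y. \<integral>\<^sup>+x. indicator A x * indicator B (y + x) \<partial>\<nu> \<partial>lborel)"
      by (rule Fubini'[symmetric]) auto
    also have "\<dots> = (\<integral>\<^sup>+y. \<integral>\<^sup>+x. indicator A (x - y) * indicator B x \<partial>\<nu> \<partial>lborel)"
    proof (rule nn_integral_cong)
      fix y :: 'a
      show "(\<integral>\<^sup>+x. indicator A x * indicator B (y + x) \<partial>\<nu>) = (\<integral>\<^sup>+x. indicator A (x - y) * indicator B x \<partial>\<nu>)"
        by (subst trans_nn[of "\<lambda>x. indicator A (x - y) * indicator B x" y, symmetric]) (auto simp: add.commute)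
    qed
    also have "\<dots> = (\<integral>\<^sup>+x. \<integral>\<^sup>+y. indicator A (x - y) * indicator B x \<partial>lborel \<partial>\<nu>)"
      by (rule Fubini') auto
    also have "\<dots> = (\<integral>\<^sup>+x. indicator B x * (\<integral>\<^sup>+y. indicator A (x - y) \<partial>lborel) \<partial>\<nu>)"
      by (subst nn_integral_cmult[symmetric]) (auto simp: mult.commute)
    also have "\<dots> = (\<integral>\<^sup>+x. indicator B x * (\<integral>\<^sup>+y. indicator A y \<partial>lborel) \<partial>\<nu>)"
      by (subst refl_lb) auto
    also have "\<dots> = emeasure \<nu> B * emeasure lborel A"
      by (simp add: nn_integral_multc)
    finally show ?thesis .
  qed
  have ball: "emeasure \<nu> (ball 0 1) = emeasure lborel (ball 0 1 :: 'a set)"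
  proof -
    have "R -` ball 0 1 = (ball 0 1 :: 'a set)"
      using R by (auto simp: orthogonal_transformation_norm)
    then show ?thesis unfolding \<nu>_def by (subst emeasure_distr) auto
  qed
  have fin: "emeasure lborel (ball 0 1 :: 'a set) \<noteq> \<infinity>" "emeasure lborel (ball 0 1 :: 'a set) \<noteq> 0"
    by (simp_all add: emeasure_ball order_less_imp_not_eq2[OF unit_ball_vol_pos])
  have "\<nu> = lborel"
  proof (rule measure_eqI)
    fix A assume A: "A \<in> sets \<nu>"
    have "emeasure \<nu> A * emeasure lborel (ball 0 1 :: 'a set) = emeasure lborel A * emeasure lborel (ball 0 1 :: 'a set)"
      using swap[of A "ball 0 1"] A ball by (simp add: mult.commute)
    then show "emeasure \<nu> A = emeasure lborel A"
      using fin by (simp add: ennreal_mult_cancel_left mult.commute[of _ "emeasure lborel (ball 0 1)"])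
  qed simp
  then show ?thesis by (simp add: \<nu>_def)
qed

lemma space_sphere_measure [simp]: "space (sphere_measure :: 'a::euclidean_space measure) = sphere 0 1"
  by (simp add: sphere_measure_def space_scale_measure space_restrict_space)

lemma sets_sphere_measure [simp, measurable_cong]:
  "sets (sphere_measure :: 'a::euclidean_space measure) = sets (restrict_space borel (sphere 0 1))"
  by (simp add: sphere_measure_def)

lemma emeasure_sphere_measure:
  fixes A :: "'a::euclidean_space set"
  assumes "A \<in> sets sphere_measure"
  shows "emeasure sphere_measure A = DIM('a) * emeasure lborel {x \<in> ball 0 1 - {0}. sgn x \<in> A}"
proof -
  have A: "A \<subseteq> sphere 0 1" "A \<in> sets borel"
    using assms by (auto simp: sets_restrict_space_iff)
  have [measurable]: "(sgn :: 'a \<Rightarrow> 'a) \<in> borel_measurable borel"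
    unfolding sgn_div_norm[abs_def] by measurable
  have sgn: "(sgn :: 'a \<Rightarrow> 'a) \<in> restrict_space lborel (ball 0 1 - {0}) \<rightarrow>\<^sub>M restrict_space borel (sphere 0 1)"
    by (rule measurable_restrict_space3) (auto simp: norm_sgn)
  have eq: "sgn -` A \<inter> (ball 0 1 - {0}) = {x \<in> ball 0 1 - {0}. sgn x \<in> A}"
    by auto
  have "emeasure (restrict_space lborel (ball 0 1 - {0})) {x \<in> ball 0 1 - {0}. sgn x \<in> A}
      = emeasure lborel {x \<in> ball 0 1 - {0}. sgn x \<in> A}"
    by (rule emeasure_restrict_space) auto
  then show ?thesis
    unfolding sphere_measure_def using assms
    by (simp add: emeasure_distr[OF sgn] space_restrict_space eq ennreal_of_nat_eq_real_of_nat del: Diff_iff)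
qed

lemma emeasure_sphere_measure_space:
  "emeasure sphere_measure (sphere 0 1 :: 'a::euclidean_space set) = DIM('a) * unit_ball_vol DIM('a)"
proof -
  have "{x \<in> ball 0 1 - {0}. sgn x \<in> sphere 0 1} = ball 0 1 - {0 :: 'a}"
    by (auto simp: norm_sgn)
  moreover have "emeasure lborel (ball 0 1 - {0 :: 'a}) = emeasure lborel (ball 0 1 :: 'a set)"
    by (rule emeasure_Diff_null_set) auto
  ultimately show ?thesis
    by (subst emeasure_sphere_measure)
      (auto simp: emeasure_ball sets_restrict_space_iff ennreal_mult ennreal_of_nat_eq_real_of_nat)
qed

lemma sphere_volume_eq: "sphere_volume TYPE('a::euclidean_space) = DIM('a) * unit_ball_vol DIM('a)"
  by (simp add: sphere_volume_def measure_def emeasure_sphere_measure_space)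

lemma sphere_volume_pos: "sphere_volume TYPE('a::euclidean_space) > 0"
  by (simp add: sphere_volume_eq)

lemma finite_measure_sphere_measure: "finite_measure (sphere_measure :: 'a::euclidean_space measure)"
  by (rule finite_measureI) (simp add: emeasure_sphere_measure_space)

lemma measure_sphere_measure_space:
  "measure sphere_measure (sphere 0 1 :: 'a::euclidean_space set) = sphere_volume TYPE('a)"
  by (simp add: sphere_volume_def)

text \<open>An orthogonal map commutes with radial projection and preserves the punctured ball, so
  the cone over the preimage of \<open>A\<close> is the preimage of the cone over \<open>A\<close>.
  This reduces the claim to Lebesgue measure.\<close>

lemma distr_sphere_measure_orthogonal:
  fixes R :: "'a::euclidean_space \<Rightarrow> 'a"
  assumes R: "orthogonal_transformation R"
  shows "distr sphere_measure sphere_measure R = sphere_measure"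
proof -
  have lin: "linear R" using R by (simp add: orthogonal_transformation_linear)
  have [measurable]: "R \<in> borel \<rightarrow>\<^sub>M borel"
    using lin by (auto intro!: borel_measurable_continuous_onI linear_continuous_on linear_conv_bounded_linear[THEN iffD1])
  have Rm: "R \<in> sphere_measure \<rightarrow>\<^sub>M sphere_measure"
    unfolding measurable_cong_sets[OF sets_sphere_measure sets_sphere_measure]
    by (rule measurable_restrict_space3) (auto simp: orthogonal_transformation_norm[OF R])
  have norm: "norm (R x) = norm x" for x
    using R by (simp add: orthogonal_transformation_norm)
  have sgn: "sgn (R x) = R (sgn x)" for x
    using lin by (simp add: sgn_div_norm norm linear_scale)
  have R0: "R x = 0 \<longleftrightarrow> x = 0" for x by (metis norm norm_eq_zero)
  show ?thesis
  proof (rule measure_eqI)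
    fix A :: "'a set" assume "A \<in> sets (distr sphere_measure sphere_measure R)"
    then have A: "A \<in> sets sphere_measure" by simp
    then have A': "A \<subseteq> sphere 0 1" "A \<in> sets borel"
      by (auto simp: sets_restrict_space_iff)
    have [measurable]: "(sgn :: 'a \<Rightarrow> 'a) \<in> borel_measurable borel"
      unfolding sgn_div_norm[abs_def] by measurable
    let ?B = "{x \<in> ball 0 1 - {0}. sgn x \<in> A}"
    have B: "?B \<in> sets borel"
      using A'(2) by measurable
    have "emeasure (distr sphere_measure sphere_measure R) A
        = emeasure sphere_measure (R -` A \<inter> space sphere_measure)"
      using A by (simp add: emeasure_distr Rm)
    also have "\<dots> = DIM('a) * emeasure lborel {x \<in> ball 0 1 - {0}. sgn x \<in> R -` A \<inter> sphere 0 1}"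
      using measurable_sets[OF Rm A] by (subst emeasure_sphere_measure) auto
    also have "{x \<in> ball 0 1 - {0}. sgn x \<in> R -` A \<inter> sphere 0 1} = R -` ?B"
      by (auto simp: norm norm_sgn sgn R0)
    also have "emeasure lborel (R -` ?B) = emeasure (distr lborel borel R) ?B"
      using B by (subst emeasure_distr) auto
    also have "\<dots> = emeasure lborel ?B"
      by (simp add: distr_lborel_orthogonal R)
    finally show "emeasure (distr sphere_measure sphere_measure R) A = emeasure sphere_measure A"
      using A by (simp add: emeasure_sphere_measure)
  qed simp
qed

section \<open>Integration of continuous functions over the sphere\<close>

lemma measurable_continuous_on_sphere:
  fixes f :: "'a::euclidean_space \<Rightarrow> 'b::topological_space"
  assumes "continuous_on (sphere 0 1) f"
  shows "f \<in> borel_measurable sphere_measure"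
  using borel_measurable_continuous_on_restrict[OF assms]
  by (simp cong: measurable_cong_sets)

lemma bounded_continuous_on_sphere:
  fixes f :: "'a::euclidean_space \<Rightarrow> real"
  assumes "continuous_on (sphere 0 1) f"
  obtains B where "B > 0" "\<And>x. x \<in> sphere 0 1 \<Longrightarrow> \<bar>f x\<bar> \<le> B"
proof -
  have "bounded (f ` sphere 0 1)"
    using assms by (intro compact_imp_bounded compact_continuous_image) auto
  then show ?thesis
    using that unfolding bounded_pos by auto
qed

lemma integrable_mult_continuous_sphere:
  fixes f g :: "'a::euclidean_space \<Rightarrow> real"
  assumes g: "integrable sphere_measure g" and f: "continuous_on (sphere 0 1) f"
  shows "integrable sphere_measure (\<lambda>x. g x * f x)"
proof -
  obtain B where B: "B > 0" "\<And>x. x \<in> sphere 0 1 \<Longrightarrow> \<bar>f x\<bar> \<le> B"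
    using bounded_continuous_on_sphere[OF f] by blast
  have [measurable]: "f \<in> borel_measurable sphere_measure" "g \<in> borel_measurable sphere_measure"
    using f g by (auto intro: measurable_continuous_on_sphere)
  show ?thesis
  proof (rule Bochner_Integration.integrable_bound)
    show "integrable sphere_measure (\<lambda>x. g x * B)" using g by simp
    show "AE x in sphere_measure. norm (g x * f x) \<le> norm (g x * B)"
      using B by (intro AE_I2) (auto simp: abs_mult intro!: mult_left_mono)
  qed simp
qed

lemma integrable_sphere_const [simp]:
  "integrable (sphere_measure :: 'a::euclidean_space measure) (\<lambda>x. c :: real)"
  by (rule finite_measure.integrable_const[OF finite_measure_sphere_measure])

lemma integrable_continuous_on_sphere:
  fixes f :: "'a::euclidean_space \<Rightarrow> real"
  assumes "continuous_on (sphere 0 1) f"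
  shows "integrable sphere_measure f"
  using integrable_mult_continuous_sphere[OF integrable_sphere_const[of 1] assms] by simp

lemma integral_sphere_const [simp]:
  "(\<integral>x. c \<partial>(sphere_measure :: 'a::euclidean_space measure)) = c * sphere_volume TYPE('a)"
  by (simp add: measure_sphere_measure_space)

text \<open>The cone over \<open>{f \<noteq> 0}\<close> is open, and a nonempty open set has
  positive Lebesgue measure; \<open>a /\<^sub>R 2\<close> is a point of the cone over
  \<open>a\<close>. This upgrades almost everywhere statements to pointwise ones.\<close>

lemma continuous_AE_sphere_zero:
  fixes f :: "'a::euclidean_space \<Rightarrow> real"
  assumes f: "continuous_on (sphere 0 1) f" and ae: "AE x in sphere_measure. f x = 0"
    and a: "a \<in> sphere 0 1"
  shows "f a = 0"
proof (rule ccontr)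
  assume "f a \<noteq> 0"
  have [measurable]: "f \<in> borel_measurable sphere_measure"
    using f by (rule measurable_continuous_on_sphere)
  let ?A = "{x \<in> sphere 0 1. f x \<noteq> 0}"
  let ?B = "{x \<in> ball 0 1 - {0}. sgn x \<in> ?A}"
  have A: "?A \<in> sets sphere_measure"
  proof -
    have "?A = f -` (-{0}) \<inter> space sphere_measure" by auto
    also have "\<dots> \<in> sets sphere_measure" by measurable
    finally show ?thesis .
  qed
  have "emeasure sphere_measure ?A = 0"
    using AE_iff_measurable[OF A, of "\<lambda>x. f x = 0"] ae by simp
  then have "emeasure lborel ?B = 0"
    using A by (simp add: emeasure_sphere_measure del: mem_Collect_eq)
  moreover have "open ?B"
  proof -
    have "continuous_on (ball 0 1 - {0}) (\<lambda>x. f (sgn x))"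
      by (rule continuous_on_compose2[OF f]) (auto intro!: continuous_on_sgn continuous_intros simp: norm_sgn split: if_splits)
    then have "open ((\<lambda>x. f (sgn x)) -` (-{0}) \<inter> (ball 0 1 - {0}))"
      by (subst (asm) continuous_on_open_vimage) auto
    also have "(\<lambda>x. f (sgn x)) -` (-{0}) \<inter> (ball 0 1 - {0}) = ?B"
      by (auto simp: norm_sgn)
    finally show ?thesis .
  qed
  moreover have "a /\<^sub>R 2 \<in> ?B"
    using a \<open>f a \<noteq> 0\<close> by (auto simp: sgn_div_norm)
  moreover have "?B \<in> sets borel" using \<open>open ?B\<close> by (rule borel_open)
  ultimately show False
    using open_not_negligible[of ?B] null_sets_completionI[of ?B lborel]
    by (auto simp only: negligible_iff_null_sets null_sets_def sets_lborel)
qed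

text \<open>The rotations \<open>R t\<close> of the plane of \<open>i\<close> and \<open>j\<close>
  preserve the integral of \<open>f\<close>, so the difference quotients of \<open>f (R t x)\<close>
  at \<open>t = 0\<close> integrate to zero. They converge to the integrand, and dominated
  convergence applies because the mean value theorem bounds each quotient by the maximum of the
  continuous function \<open>h\<close>.\<close>

lemma integral_rotation_derivative:
  fixes f :: "'a::euclidean_space \<Rightarrow> real"
  assumes f': "\<And>x. x \<in> sphere 0 1 \<Longrightarrow> (f has_derivative f' x) (at x)"
    and cont: "\<And>v. v \<in> Basis \<Longrightarrow> continuous_on (sphere 0 1) (\<lambda>x. f' x v)"
    and ij: "i \<in> Basis" "j \<in> Basis"
  shows "(\<integral>x. (x \<bullet> i) * f' x j - (x \<bullet> j) * f' x i \<partial>sphere_measure) = 0"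
proof (cases "i = j")
  case False
  define h where "h x = (x \<bullet> i) * f' x j - (x \<bullet> j) * f' x i" for x
  define R where "R t x = x + ((cos t - 1) * (x \<bullet> i) - sin t * (x \<bullet> j)) *\<^sub>R i
      + ((cos t - 1) * (x \<bullet> j) + sin t * (x \<bullet> i)) *\<^sub>R j" for t :: real and x :: 'a
  have [simp]: "i \<bullet> i = 1" "j \<bullet> j = 1" "i \<bullet> j = 0" "j \<bullet> i = 0"
    using ij False by (auto simp: inner_Basis)
  have Ri: "R t x \<bullet> i = cos t * (x \<bullet> i) - sin t * (x \<bullet> j)"
    and Rj: "R t x \<bullet> j = cos t * (x \<bullet> j) + sin t * (x \<bullet> i)" for t x
    by (auto simp: R_def inner_add_left algebra_simps)
  have R: "orthogonal_transformation (R t)" for t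
    unfolding orthogonal_transformation
  proof safe
    show "linear (R t)"
      by (rule linearI) (auto simp: R_def inner_add_left algebra_simps)
    fix x :: 'a
    define p where "p = (cos t - 1) * (x \<bullet> i) - sin t * (x \<bullet> j)"
    define q where "q = (cos t - 1) * (x \<bullet> j) + sin t * (x \<bullet> i)"
    have sc: "sin t * sin t = 1 - cos t * cos t"
      using sin_cos_squared_add[of t] by (simp add: power2_eq_square)
    have "R t x \<bullet> R t x = x \<bullet> x + (2 * p * (x \<bullet> i) + 2 * q * (x \<bullet> j) + p * p + q * q)"
      unfolding R_def p_def[symmetric] q_def[symmetric]
      by (simp add: inner_add_left inner_add_right inner_commute algebra_simps)
    also have "2 * p * (x \<bullet> i) + 2 * q * (x \<bullet> j) + p * p + q * q
      = ((x \<bullet> i) * (x \<bullet> i) + (x \<bullet> j) * (x \<bullet> j)) * (2 * (cos t - 1) + (cos t - 1) * (cos t - 1) + sin t * sin t)"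
      unfolding p_def q_def by algebra
    also have "2 * (cos t - 1) + (cos t - 1) * (cos t - 1) + sin t * sin t = 0"
      unfolding sc by (simp add: algebra_simps)
    finally show "norm (R t x) = norm x"
      by (simp add: norm_eq_sqrt_inner add.assoc)
  qed
  have Rsph: "R t x \<in> sphere 0 1" if "x \<in> sphere 0 1" for t x
    using that R[of t] by (simp add: orthogonal_transformation_norm)
  \<comment> \<open>The derivative along an orbit is \<open>h\<close> at the moved point for every
    \<open>t\<close>, not only at 0; the mean value bound on the quotients relies on this.\<close>
  have g': "((\<lambda>t. f (R t x)) has_real_derivative h (R t x)) (at t)" if x: "x \<in> sphere 0 1" for x t
  proof -
    let ?v = "(R t x \<bullet> i) *\<^sub>R j - (R t x \<bullet> j) *\<^sub>R i"
    have "((\<lambda>t. R t x) has_derivative (\<lambda>y. y *\<^sub>R ?v)) (at t)"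
      unfolding Ri Rj unfolding R_def
      by (auto intro!: derivative_eq_intros simp: algebra_simps)
    from diff_chain_at[OF this f'[OF Rsph[OF x]]]
    have "((\<lambda>t. f (R t x)) has_derivative (\<lambda>y. f' (R t x) (y *\<^sub>R ?v))) (at t)"
      by (simp add: comp_def)
    moreover have "linear (f' (R t x))"
      using f'[OF Rsph[OF x]] by (rule has_derivative_linear)
    then have "f' (R t x) (y *\<^sub>R ?v) = h (R t x) * y" for y
      unfolding h_def by (simp add: linear_scale linear_diff algebra_simps)
    ultimately show ?thesis
      by (simp add: has_field_derivative_def)
  qed
  have cf: "continuous_on (sphere 0 1) f"
    using f' by (intro continuous_at_imp_continuous_on ballI has_derivative_continuous)
  have ch: "continuous_on (sphere 0 1) h"
    unfolding h_def by (intro continuous_intros cont ij)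
  obtain B where B: "B > 0" "\<And>x. x \<in> sphere 0 1 \<Longrightarrow> \<bar>h x\<bar> \<le> B"
    using bounded_continuous_on_sphere[OF ch] by blast
  define s where "s k x = real (Suc k) * (f (R (1 / real (Suc k)) x) - f x)" for k x
  have Rm: "R t \<in> sphere_measure \<rightarrow>\<^sub>M sphere_measure" for t
  proof -
    have "R t \<in> borel \<rightarrow>\<^sub>M borel"
      using orthogonal_transformation_linear[OF R]
      by (auto intro!: borel_measurable_continuous_onI linear_continuous_on linear_conv_bounded_linear[THEN iffD1])
    then show ?thesis
      unfolding measurable_cong_sets[OF sets_sphere_measure sets_sphere_measure]
      by (intro measurable_restrict_space3) (use Rsph in auto)
  qed
  have fm: "f \<in> borel_measurable sphere_measure" using cf by (rule measurable_continuous_on_sphere)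
  have fi: "integrable sphere_measure f" using cf by (rule integrable_continuous_on_sphere)
  have fRi: "integrable sphere_measure (\<lambda>x. f (R t x))" for t
    using fi Rm by (subst (asm) distr_sphere_measure_orthogonal[OF R, symmetric])
      (rule integrable_distr)
  have fR: "(\<integral>x. f (R t x) \<partial>sphere_measure) = (\<integral>x. f x \<partial>sphere_measure)" for t
    by (subst (2) distr_sphere_measure_orthogonal[OF R, symmetric, of t])
      (simp add: integral_distr[OF Rm fm])
  have s0: "(\<integral>x. s k x \<partial>sphere_measure) = 0" for k
    unfolding s_def using fi fRi by (simp add: fR)
  have "(\<lambda>k. \<integral>x. s k x \<partial>sphere_measure) \<longlonglongrightarrow> (\<integral>x. h x \<partial>sphere_measure)"
  proof (rule integral_dominated_convergence)
    show "h \<in> borel_measurable sphere_measure" using ch by (rule measurable_continuous_on_sphere)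
    show "s k \<in> borel_measurable sphere_measure" for k
      unfolding s_def using borel_measurable_integrable[OF fRi] fm by measurable
    show "integrable sphere_measure (\<lambda>x :: 'a. B)" by simp
    show "AE x in sphere_measure. (\<lambda>k. s k x) \<longlonglongrightarrow> h x"
    proof (rule AE_I2)
      fix x :: 'a assume "x \<in> space sphere_measure"
      then have x: "x \<in> sphere 0 1" by simp
      have R0: "R 0 x = x" by (simp add: R_def)
      have "((\<lambda>t. (f (R t x) - f x) / t) \<longlongrightarrow> h x) (at 0)"
        using g'[OF x, of 0] by (simp add: has_field_derivative_iff R0)
      moreover have "filterlim (\<lambda>k. 1 / real (Suc k)) (at 0) sequentially"
        using lim_1_over_n[THEN LIMSEQ_Suc] by (auto simp: filterlim_at)
      ultimately have "(\<lambda>k. (f (R (1 / real (Suc k)) x) - f x) / (1 / real (Suc k))) \<longlonglongrightarrow> h x"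
        by (rule filterlim_compose)
      then show "(\<lambda>k. s k x) \<longlonglongrightarrow> h x" by (simp add: s_def mult.commute)
    qed
    show "AE x in sphere_measure. norm (s k x) \<le> B" for k
    proof (rule AE_I2)
      fix x :: 'a assume "x \<in> space sphere_measure"
      then have x: "x \<in> sphere 0 1" by simp
      have R0: "R 0 x = x" by (simp add: R_def)
      obtain z where z: "f (R (1 / real (Suc k)) x) - f (R 0 x) = (1 / real (Suc k) - 0) * h (R z x)"
        using MVT2[of 0 "1 / real (Suc k)" "\<lambda>t. f (R t x)" "\<lambda>t. h (R t x)"] g'[OF x] by auto
      then have "s k x = h (R z x)" by (simp add: s_def R0)
      then show "norm (s k x) \<le> B" using B(2)[OF Rsph[OF x]] by simp
    qed
  qed
  then show ?thesis
    by (simp add: s0 h_def LIMSEQ_const_iff)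
qed simp

text \<open>The integrand is the divergence on the sphere of the tangential part of \<open>X\<close>. It is a sum of
  rotation derivatives of the functions \<open>(x \<bullet> i) * (X x \<bullet> j)\<close>.\<close>

theorem sphere_divergence_theorem:
  fixes X :: "'a::euclidean_space \<Rightarrow> 'a"
  assumes X': "\<And>x. x \<in> sphere 0 1 \<Longrightarrow> (X has_derivative X' x) (at x)"
    and cont: "\<And>v. v \<in> Basis \<Longrightarrow> continuous_on (sphere 0 1) (\<lambda>x. X' x v)"
  shows "(\<integral>x. (\<Sum>b\<in>Basis. X' x b \<bullet> b) - X' x x \<bullet> x - (real DIM('a) - 1) * (X x \<bullet> x) \<partial>sphere_measure) = 0"
proof -
  define f' where "f' i j x v = (v \<bullet> i) * (X x \<bullet> j) + (x \<bullet> i) * (X' x v \<bullet> j)" for i j x v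
  have cX: "continuous_on (sphere 0 1) X"
    using X' by (intro continuous_at_imp_continuous_on ballI has_derivative_continuous)
  have d: "((\<lambda>x. (x \<bullet> i) * (X x \<bullet> j)) has_derivative f' i j x) (at x)" if "x \<in> sphere 0 1" for i j x
    unfolding f'_def by (auto intro!: derivative_eq_intros X'[OF that])
  have c: "continuous_on (sphere 0 1) (\<lambda>x. f' i j x v)" if "v \<in> Basis" for i j v
    unfolding f'_def by (intro continuous_intros cX cont that)
  let ?g = "\<lambda>i j x. (x \<bullet> i) * f' i j x j - (x \<bullet> j) * f' i j x i"
  have int: "integrable sphere_measure (?g i j)" if "i \<in> Basis" "j \<in> Basis" for i j
    by (intro integrable_continuous_on_sphere continuous_intros c that)
  have "(\<integral>x. (\<Sum>i\<in>Basis. \<Sum>j\<in>Basis. ?g i j x) \<partial>sphere_measure)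
      = (\<Sum>i\<in>Basis. \<Sum>j\<in>Basis. \<integral>x. ?g i j x \<partial>sphere_measure)"
    by (subst Bochner_Integration.integral_sum;
        (intro sum.cong refl Bochner_Integration.integral_sum Bochner_Integration.integrable_sum int)?)
  also have "\<dots> = 0"
    by (intro sum.neutral ballI) (rule integral_rotation_derivative[OF d c])
  also have "(\<integral>x. (\<Sum>i\<in>Basis. \<Sum>j\<in>Basis. ?g i j x) \<partial>sphere_measure)
    = (\<integral>x. (\<Sum>b\<in>Basis. X' x b \<bullet> b) - X' x x \<bullet> x - (real DIM('a) - 1) * (X x \<bullet> x) \<partial>sphere_measure)"
  proof (rule Bochner_Integration.integral_cong[OF refl])
    fix x :: 'a assume "x \<in> space sphere_measure"
    then have x: "x \<in> sphere 0 1" by simp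
    have lin: "linear (X' x)" using X'[OF x] by (rule has_derivative_linear)
    have xx: "(\<Sum>i\<in>Basis. (x \<bullet> i) * (x \<bullet> i)) = 1"
      using x by (subst euclidean_inner[symmetric]) (simp add: dot_square_norm)
    \<comment> \<open>Four double sums arise: the radial component of \<open>X\<close>, its multiple
      by the dimension, the trace of \<open>X' x\<close>, and the radial derivative of the radial
      part. The unit length of \<open>x\<close> enters only in the trace.\<close>
    have "(\<Sum>i\<in>Basis. \<Sum>j\<in>Basis. ?g i j x) = (\<Sum>i\<in>Basis. \<Sum>j\<in>Basis.
        ((x \<bullet> i) * (X x \<bullet> j) * (j \<bullet> i) - (x \<bullet> j) * (X x \<bullet> j)) +
        ((x \<bullet> i) * (x \<bullet> i) * (X' x j \<bullet> j)
          - X' x ((x \<bullet> i) *\<^sub>R i) \<bullet> ((x \<bullet> j) *\<^sub>R j)))"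
      by (intro sum.cong refl) (simp add: f'_def linear_scale[OF lin] algebra_simps)
    also have "\<dots> = (\<Sum>i\<in>Basis. \<Sum>j\<in>Basis. (x \<bullet> i) * (X x \<bullet> j) * (j \<bullet> i))
       - (\<Sum>i\<in>(Basis::'a set). \<Sum>j\<in>Basis. (x \<bullet> j) * (X x \<bullet> j))
       + ((\<Sum>i\<in>Basis. \<Sum>j\<in>Basis. (x \<bullet> i) * (x \<bullet> i) * (X' x j \<bullet> j))
       - (\<Sum>i\<in>Basis. \<Sum>j\<in>Basis. X' x ((x \<bullet> i) *\<^sub>R i) \<bullet> ((x \<bullet> j) *\<^sub>R j)))"
      by (simp add: sum.distrib sum_subtractf)
    also have "(\<Sum>i\<in>Basis. \<Sum>j\<in>Basis. (x \<bullet> i) * (X x \<bullet> j) * (j \<bullet> i)) = X x \<bullet> x"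
    proof -
      have "(\<Sum>i\<in>Basis. \<Sum>j\<in>Basis. (x \<bullet> i) * (X x \<bullet> j) * (j \<bullet> i)) = (\<Sum>i\<in>Basis. (x \<bullet> i) * (X x \<bullet> i))"
        by (intro sum.cong refl) (simp add: inner_Basis if_distrib[where f="\<lambda>y. _ * y"] sum.delta' cong: if_cong)
      then show ?thesis by (simp add: euclidean_inner[of "X x" x] mult.commute)
    qed
    also have "(\<Sum>i\<in>(Basis::'a set). \<Sum>j\<in>Basis. (x \<bullet> j) * (X x \<bullet> j)) = real DIM('a) * (X x \<bullet> x)"
      by (simp add: euclidean_inner[of "X x" x] mult.commute)
    also have "(\<Sum>i\<in>Basis. \<Sum>j\<in>Basis. (x \<bullet> i) * (x \<bullet> i) * (X' x j \<bullet> j)) = (\<Sum>j\<in>Basis. X' x j \<bullet> j)"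
      by (subst sum_distrib_left[symmetric], subst sum_distrib_right[symmetric]) (simp add: xx)
    also have "(\<Sum>i\<in>Basis. \<Sum>j\<in>Basis. X' x ((x \<bullet> i) *\<^sub>R i) \<bullet> ((x \<bullet> j) *\<^sub>R j)) = X' x x \<bullet> x"
      unfolding inner_sum_right[symmetric] inner_sum_left[symmetric] linear_sum[OF lin, symmetric] euclidean_representation ..
    finally show "(\<Sum>i\<in>Basis. \<Sum>j\<in>Basis. ?g i j x) =
        (\<Sum>b\<in>Basis. X' x b \<bullet> b) - X' x x \<bullet> x - (real DIM('a) - 1) * (X x \<bullet> x)"
      by (simp add: algebra_simps)
  qed
  finally show ?thesis .
qed

section \<open>Polynomials, homogeneous functions and Green's formula\<close>

lemmas real_polynomial_function_linear = real_polynomial_function.intros(1)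
  and real_polynomial_function_const = real_polynomial_function.intros(2)
  and real_polynomial_function_add = real_polynomial_function.intros(3)
  and real_polynomial_function_mult = real_polynomial_function.intros(4)

lemma frechet_derivative_eq: "(f has_derivative f') (at x) \<Longrightarrow> frechet_derivative f (at x) = f'"
  by (rule frechet_derivative_at[symmetric])

lemma real_polynomial_function_has_derivative:
  fixes p :: "'a::euclidean_space \<Rightarrow> real"
  assumes "real_polynomial_function p"
  shows "(p has_derivative frechet_derivative p (at x)) (at x)"
  using differentiable_at_real_polynomial_function[OF assms] by (simp add: frechet_derivative_works)

lemma real_polynomial_function_dir_deriv:
  fixes p :: "'a::euclidean_space \<Rightarrow> real"
  assumes "real_polynomial_function p"
  shows "real_polynomial_function (\<lambda>x. frechet_derivative p (at x) v)"
  using assms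
proof (induction p)
  case (linear f)
  then have "frechet_derivative f (at x) = f" for x
    by (intro frechet_derivative_eq bounded_linear_imp_has_derivative)
  then show ?case by (simp add: real_polynomial_function_const)
next
  case (const c)
  then show ?case by (simp add: real_polynomial_function_const)
next
  case (add f g)
  have "frechet_derivative (\<lambda>x. f x + g x) (at x) v
      = frechet_derivative f (at x) v + frechet_derivative g (at x) v" for x
    by (subst frechet_derivative_eq[OF has_derivative_add[OF add.hyps[THEN real_polynomial_function_has_derivative]]]) simp
  then show ?case using add by (simp add: real_polynomial_function_add)
next
  case (mult f g)
  have "frechet_derivative (\<lambda>x. f x * g x) (at x) v
      = f x * frechet_derivative g (at x) v + frechet_derivative f (at x) v * g x" for x
    by (subst frechet_derivative_eq[OF has_derivative_mult[OF mult.hyps[THEN real_polynomial_function_has_derivative]]]) simp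
  then show ?case using mult by (simp add: real_polynomial_function_add real_polynomial_function_mult)
qed

lemma continuous_on_real_polynomial_function:
  "real_polynomial_function p \<Longrightarrow> continuous_on A p"
  by (simp add: continuous_on_polymonial_function real_polynomial_function_eq)

context
  fixes p q :: "'a::euclidean_space \<Rightarrow> real"
  assumes p: "real_polynomial_function p" and q: "real_polynomial_function q"
begin

lemma dir_deriv_add_poly:
  "frechet_derivative (\<lambda>x. p x + q x) (at x) v = frechet_derivative p (at x) v + frechet_derivative q (at x) v"
  by (subst frechet_derivative_eq[OF has_derivative_add[OF p[THEN real_polynomial_function_has_derivative]
    q[THEN real_polynomial_function_has_derivative]]]) simp

lemma dir_deriv_mult_poly:
  "frechet_derivative (\<lambda>x. p x * q x) (at x) v = p x * frechet_derivative q (at x) v + frechet_derivative p (at x) v * q x"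
  by (subst frechet_derivative_eq[OF has_derivative_mult[OF p[THEN real_polynomial_function_has_derivative]
    q[THEN real_polynomial_function_has_derivative]]]) simp

end

text \<open>Structural induction on polynomials gives the symmetry of second derivatives directly;
  the product rule is the only case with content.\<close>

lemma dir_deriv_commute_poly:
  fixes p :: "'a::euclidean_space \<Rightarrow> real"
  assumes "real_polynomial_function p"
  shows "frechet_derivative (\<lambda>x. frechet_derivative p (at x) v) (at x) w
       = frechet_derivative (\<lambda>x. frechet_derivative p (at x) w) (at x) v"
  using assms
proof (induction p arbitrary: x)
  case (linear f)
  then have "frechet_derivative f (at x) = f" for x
    by (intro frechet_derivative_eq bounded_linear_imp_has_derivative)
  then show ?case by simp
next
  case (mult f g)
  note pd = real_polynomial_function_dir_deriv
  show ?case
    using mult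
    by (simp add: dir_deriv_mult_poly dir_deriv_add_poly pd real_polynomial_function_mult)
next
  case (add f g)
  then show ?case by (simp add: dir_deriv_add_poly real_polynomial_function_dir_deriv)
qed simp

lemma euclidean_laplacian_add:
  assumes "real_polynomial_function p" "real_polynomial_function q"
  shows "euclidean_laplacian (\<lambda>x. p x + q x) x = euclidean_laplacian p x + euclidean_laplacian q x"
  using assms unfolding euclidean_laplacian_def
  by (simp add: dir_deriv_add_poly real_polynomial_function_dir_deriv sum.distrib)

lemma euclidean_laplacian_mult:
  assumes "real_polynomial_function p" "real_polynomial_function q"
  shows "euclidean_laplacian (\<lambda>x. p x * q x) x = p x * euclidean_laplacian q x + q x * euclidean_laplacian p x
    + 2 * (\<Sum>b\<in>Basis. frechet_derivative p (at x) b * frechet_derivative q (at x) b)"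
  using assms unfolding euclidean_laplacian_def
  by (simp add: dir_deriv_add_poly dir_deriv_mult_poly real_polynomial_function_dir_deriv real_polynomial_function_mult
       sum.distrib sum_distrib_left algebra_simps)

lemma dir_deriv_const [simp]: "frechet_derivative (\<lambda>x. c) (at x) v = 0"
  by simp

lemma euclidean_laplacian_const [simp]: "euclidean_laplacian (\<lambda>x. c) x = 0"
  by (simp add: euclidean_laplacian_def)

lemma euclidean_laplacian_cmult:
  assumes "real_polynomial_function p"
  shows "euclidean_laplacian (\<lambda>x. c * p x) x = c * euclidean_laplacian p x"
  by (subst euclidean_laplacian_mult) (auto intro: assms real_polynomial_function_const)

text \<open>Serves to show that directional derivatives of harmonic polynomials are harmonic; it
  rests on the symmetry of second derivatives.\<close>

lemma euclidean_laplacian_dir_deriv: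
  fixes p :: "'a::euclidean_space \<Rightarrow> real"
  assumes p: "real_polynomial_function p"
  shows "euclidean_laplacian (\<lambda>x. frechet_derivative p (at x) v) x
       = frechet_derivative (euclidean_laplacian p) (at x) v"
proof -
  note pd = real_polynomial_function_dir_deriv
  have "frechet_derivative (euclidean_laplacian p) (at x) v =
     (\<Sum>b\<in>Basis. frechet_derivative (\<lambda>x. frechet_derivative (\<lambda>y. frechet_derivative p (at y) b) (at x) b) (at x) v)"
    unfolding euclidean_laplacian_def[abs_def]
    by (subst frechet_derivative_eq[OF has_derivative_sum])
       (auto intro!: real_polynomial_function_has_derivative pd p)
  also have "\<dots> = euclidean_laplacian (\<lambda>x. frechet_derivative p (at x) v) x"
    unfolding euclidean_laplacian_def
    by (intro sum.cong refl, subst dir_deriv_commute_poly[OF pd[OF p]])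
       (simp add: dir_deriv_commute_poly[OF p, of v])
  finally show ?thesis ..
qed

lemma real_polynomial_function_inner_right: "real_polynomial_function (\<lambda>x. c \<bullet> x)"
  by (rule real_polynomial_function_linear) (rule bounded_linear_inner_right)

lemma frechet_derivative_inner_const: "frechet_derivative (\<lambda>x. c \<bullet> x) (at x) v = c \<bullet> v"
  by (subst frechet_derivative_eq[OF bounded_linear_imp_has_derivative[OF bounded_linear_inner_right]]) simp

lemma frechet_derivative_inner_self: "frechet_derivative (\<lambda>x. x \<bullet> x) (at x) v = 2 * (x \<bullet> v)"
  by (subst frechet_derivative_eq[OF has_derivative_inner[OF has_derivative_ident has_derivative_ident]])
     (simp add: inner_commute)

lemma real_polynomial_function_inner_self: "real_polynomial_function (\<lambda>x :: 'a::euclidean_space. x \<bullet> x)"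
proof (subst euclidean_inner, intro real_polynomial_function_sum real_polynomial_function_mult)
  show "real_polynomial_function (\<lambda>x. x \<bullet> b)" for b :: 'a
    by (rule real_polynomial_function_linear) (rule bounded_linear_inner_left)
  then show "real_polynomial_function (\<lambda>x. x \<bullet> b)" for b :: 'a .
qed simp

text \<open>The degree is real and the origin is left out so that one notion covers harmonics, of
  degree \<open>l\<close>, the radially constant extension \<open>u (sgn y)\<close>, of degree 0,
  and the derivatives of the latter, of degree -1.\<close>

definition homogeneous :: "real \<Rightarrow> ('a::euclidean_space \<Rightarrow> real) \<Rightarrow> bool" where
  "homogeneous a f \<longleftrightarrow> (\<forall>t>0. \<forall>x. x \<noteq> 0 \<longrightarrow> f (t *\<^sub>R x) = t powr a * f x)"

text \<open>Euler's identity: both sides are the derivative of \<open>f (t *\<^sub>R x)\<close> in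
  \<open>t\<close> at \<open>t = 1\<close>.\<close>

lemma homogeneous_euler:
  assumes hom: "homogeneous a f" and d: "f differentiable (at x)" and x: "x \<noteq> 0"
  shows "frechet_derivative f (at x) x = a * f x"
proof -
  have 1: "((\<lambda>t. f (t *\<^sub>R x)) has_real_derivative frechet_derivative f (at x) x) (at 1)"
  proof -
    have "((\<lambda>t. t *\<^sub>R x) has_derivative (\<lambda>h. h *\<^sub>R x)) (at 1)"
      by (auto intro!: derivative_eq_intros)
    from diff_chain_at[OF this, of f "frechet_derivative f (at x)"] d
    have "((\<lambda>t. f (t *\<^sub>R x)) has_derivative (\<lambda>h. frechet_derivative f (at x) (h *\<^sub>R x))) (at 1)"
      by (simp add: comp_def frechet_derivative_works)
    moreover have "linear (frechet_derivative f (at x))"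
      using d by (rule linear_frechet_derivative)
    ultimately show ?thesis
      by (simp add: has_field_derivative_def linear_scale mult_commute_abs)
  qed
  have "((\<lambda>t. t powr a * f x) has_real_derivative a * f x) (at 1)"
    by (auto intro!: derivative_eq_intros)
  then have "((\<lambda>t. f (t *\<^sub>R x)) has_real_derivative a * f x) (at 1)"
    by (rule has_field_derivative_transform_within_open[of _ _ _ "{0<..}"])
       (use hom x in \<open>auto simp: homogeneous_def\<close>)
  with 1 show ?thesis by (rule DERIV_unique)
qed

text \<open>Differentiate \<open>f (t *\<^sub>R y) = c * f y\<close> in \<open>y\<close>. The factor
  \<open>c\<close> is arbitrary and \<open>t\<close> may be negative, so this serves real powers for
  homogeneous functions as well as natural powers for harmonics.\<close>

lemma dir_deriv_scaling:
  assumes eq: "\<And>x. x \<noteq> 0 \<Longrightarrow> f (t *\<^sub>R x) = c * f x" and d: "\<And>x. x \<noteq> 0 \<Longrightarrow> f differentiable (at x)"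
    and x: "x \<noteq> 0" and t: "t \<noteq> 0"
  shows "t * frechet_derivative f (at (t *\<^sub>R x)) v = c * frechet_derivative f (at x) v"
proof -
  have fd: "(f has_derivative frechet_derivative f (at y)) (at y)" if "y \<noteq> 0" for y
    using d[OF that] by (simp add: frechet_derivative_works)
  have tx: "t *\<^sub>R x \<noteq> 0" using x t by simp
  have "((*\<^sub>R) t has_derivative (*\<^sub>R) t) (at x)"
    by (auto intro!: derivative_eq_intros)
  from diff_chain_at[OF this fd[OF tx]]
  have "((\<lambda>y. f (t *\<^sub>R y)) has_derivative (\<lambda>v. frechet_derivative f (at (t *\<^sub>R x)) (t *\<^sub>R v))) (at x)"
    by (simp add: comp_def)
  moreover have "((\<lambda>y. c * f y) has_derivative (\<lambda>v. c * frechet_derivative f (at x) v)) (at x)"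
    by (auto intro!: derivative_eq_intros fd x)
  then have "((\<lambda>y. f (t *\<^sub>R y)) has_derivative (\<lambda>v. c * frechet_derivative f (at x) v)) (at x)"
    by (rule has_derivative_transform_within_open[of _ _ _ _ "-{0}"]) (use x eq in auto)
  ultimately have "(\<lambda>v. frechet_derivative f (at (t *\<^sub>R x)) (t *\<^sub>R v)) = (\<lambda>v. c * frechet_derivative f (at x) v)"
    by (rule has_derivative_unique)
  then have "frechet_derivative f (at (t *\<^sub>R x)) (t *\<^sub>R v) = c * frechet_derivative f (at x) v"
    by meson
  then show ?thesis
    using linear_frechet_derivative[OF d[OF tx]] by (simp add: linear_scale)
qed

lemma homogeneous_dir_deriv:
  assumes hom: "homogeneous a f" and d: "\<And>x. x \<noteq> 0 \<Longrightarrow> f differentiable (at x)"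
  shows "homogeneous (a - 1) (\<lambda>x. frechet_derivative f (at x) v)"
  unfolding homogeneous_def
proof safe
  fix t :: real and x :: 'a assume t: "t > 0" and x: "x \<noteq> 0"
  have "t * frechet_derivative f (at (t *\<^sub>R x)) v = t powr a * frechet_derivative f (at x) v"
    using hom t x d by (intro dir_deriv_scaling) (auto simp: homogeneous_def)
  then show "frechet_derivative f (at (t *\<^sub>R x)) v = t powr (a - 1) * frechet_derivative f (at x) v"
    using t by (simp add: powr_diff field_simps)
qed

section \<open>Gradients, Hessians and Green's formula\<close>

definition gradient :: "('a::euclidean_space \<Rightarrow> real) \<Rightarrow> 'a \<Rightarrow> 'a" where
  "gradient f x = (\<Sum>b\<in>Basis. frechet_derivative f (at x) b *\<^sub>R b)"

lemma gradient_inner: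
  assumes "f differentiable (at x)"
  shows "gradient f x \<bullet> v = frechet_derivative f (at x) v"
proof -
  have lin: "linear (frechet_derivative f (at x))"
    using assms by (rule linear_frechet_derivative)
  have "frechet_derivative f (at x) v = frechet_derivative f (at x) (\<Sum>b\<in>Basis. (v \<bullet> b) *\<^sub>R b)"
    by (simp add: euclidean_representation)
  also have "\<dots> = (\<Sum>b\<in>Basis. (v \<bullet> b) * frechet_derivative f (at x) b)"
    by (simp add: linear_sum[OF lin] linear_scale[OF lin])
  finally show ?thesis
    by (simp add: gradient_def inner_sum_left inner_commute[of v] mult.commute)
qed

text \<open>Regularity is asked for only away from the origin, where \<open>u (sgn y)\<close> is in
  general not even continuous, and continuity of second derivatives only on the sphere, as in the
  divergence theorem.\<close>

definition twice_differentiable :: "('a::euclidean_space \<Rightarrow> real) \<Rightarrow> bool" where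
  "twice_differentiable f \<longleftrightarrow> (\<forall>x. x \<noteq> 0 \<longrightarrow> f differentiable (at x) \<and>
     (\<forall>v. (\<lambda>y. frechet_derivative f (at y) v) differentiable (at x))) \<and>
     (\<forall>v w. continuous_on (sphere 0 1) (\<lambda>x. frechet_derivative (\<lambda>y. frechet_derivative f (at y) v) (at x) w))"

text \<open>The Hessian of \<open>f\<close> at \<open>x\<close> applied to \<open>v\<close>, as a
  vector.\<close>

definition gradient_derivative :: "('a::euclidean_space \<Rightarrow> real) \<Rightarrow> 'a \<Rightarrow> 'a \<Rightarrow> 'a" where
  "gradient_derivative f x v = (\<Sum>b\<in>Basis. frechet_derivative (\<lambda>y. frechet_derivative f (at y) b) (at x) v *\<^sub>R b)"

lemma twice_differentiable_poly:
  "real_polynomial_function f \<Longrightarrow> twice_differentiable f"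
  unfolding twice_differentiable_def
  by (auto intro: differentiable_at_real_polynomial_function real_polynomial_function_dir_deriv continuous_on_real_polynomial_function)

context
  fixes f :: "'a::euclidean_space \<Rightarrow> real"
  assumes f: "twice_differentiable f"
begin

lemma gradient_has_derivative:
  assumes "x \<noteq> 0"
  shows "(gradient f has_derivative gradient_derivative f x) (at x)"
  using f assms unfolding gradient_def[abs_def] gradient_derivative_def[abs_def] twice_differentiable_def
  by (auto intro!: derivative_eq_intros simp: frechet_derivative_works)

lemma continuous_on_gradient_derivative: "continuous_on (sphere 0 1) (\<lambda>x. gradient_derivative f x v)"
  using f unfolding gradient_derivative_def twice_differentiable_def by (auto intro!: continuous_intros)

lemma trace_gradient_derivative: "(\<Sum>b\<in>Basis. gradient_derivative f x b \<bullet> b) = euclidean_laplacian f x"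
  unfolding gradient_derivative_def euclidean_laplacian_def by (intro sum.cong refl) (simp add: inner_sum_left_Basis)

lemma continuous_on_gradient: "continuous_on (sphere 0 1) (gradient f)"
  by (intro continuous_at_imp_continuous_on ballI has_derivative_continuous[OF gradient_has_derivative]) auto

lemma continuous_on_twice_differentiable: "continuous_on (sphere 0 1) f"
  using f unfolding twice_differentiable_def
  by (intro continuous_at_imp_continuous_on ballI differentiable_imp_continuous_within)
    (metis norm_zero mem_sphere_0 zero_neq_one)

lemma continuous_on_euclidean_laplacian: "continuous_on (sphere 0 1) (euclidean_laplacian f)"
  using f unfolding euclidean_laplacian_def[abs_def] twice_differentiable_def by (auto intro!: continuous_intros)

lemma twice_differentiable_differentiable: "x \<noteq> 0 \<Longrightarrow> f differentiable (at x)"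
  using f by (auto simp: twice_differentiable_def)

lemma twice_differentiable_has_derivative:
  "x \<noteq> 0 \<Longrightarrow> (f has_derivative (\<lambda>v. gradient f x \<bullet> v)) (at x)"
  using twice_differentiable_differentiable[of x] by (simp add: gradient_inner frechet_derivative_works)

lemma gradient_euler:
  assumes "homogeneous a f" "x \<noteq> 0"
  shows "gradient f x \<bullet> x = a * f x"
  using assms by (simp add: gradient_inner homogeneous_euler twice_differentiable_differentiable)

lemma gradient_derivative_euler:
  assumes hom: "homogeneous a f" and x: "x \<noteq> 0"
  shows "gradient_derivative f x x = (a - 1) *\<^sub>R gradient f x"
proof -
  have "frechet_derivative (\<lambda>y. frechet_derivative f (at y) b) (at x) x = (a - 1) * frechet_derivative f (at x) b" for b
    using f x by (intro homogeneous_euler homogeneous_dir_deriv hom) (auto simp: twice_differentiable_def)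
  then show ?thesis
    by (simp add: gradient_derivative_def gradient_def scaleR_sum_right)
qed

end

text \<open>The field \<open>X\<close>, which is \<open>f\<close> times the gradient of
  \<open>g\<close> minus \<open>g\<close> times the gradient of \<open>f\<close>, is homogeneous of
  degree \<open>a + b - 1\<close>, and its radial component on the sphere is
  \<open>(b - a) * f * g\<close>. The radial terms of the divergence theorem therefore add up to
  this component times \<open>(a + b - 1) + (DIM('a) - 1)\<close>. Two harmonic functions give
  orthogonality; a harmonic one and one of degree 0 give the self-adjointness of the
  Laplacian.\<close>

lemma sphere_green:
  fixes f g :: "'a::euclidean_space \<Rightarrow> real"
  assumes f: "twice_differentiable f" and hf: "homogeneous a f"
    and g: "twice_differentiable g" and hg: "homogeneous b g"
  shows "(\<integral>x. f x * euclidean_laplacian g x \<partial>sphere_measure) - (\<integral>x. g x * euclidean_laplacian f x \<partial>sphere_measure)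
     = (b - a) * (a + b + real DIM('a) - 2) * (\<integral>x. f x * g x \<partial>sphere_measure)"
proof -
  define X where "X x = f x *\<^sub>R gradient g x - g x *\<^sub>R gradient f x" for x
  define X' where "X' x v = ((gradient f x \<bullet> v) *\<^sub>R gradient g x + f x *\<^sub>R gradient_derivative g x v)
     - ((gradient g x \<bullet> v) *\<^sub>R gradient f x + g x *\<^sub>R gradient_derivative f x v)" for x v
  have d: "(X has_derivative X' x) (at x)" if "x \<in> sphere 0 1" for x
  proof -
    have "x \<noteq> 0" using that by auto
    then show ?thesis
      unfolding X_def[abs_def] X'_def[abs_def]
      by (auto intro!: derivative_eq_intros twice_differentiable_has_derivative gradient_has_derivative f g simp: algebra_simps)
  qed
  have c: "continuous_on (sphere 0 1) (\<lambda>x. X' x v)" for v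
    unfolding X'_def by (intro continuous_intros continuous_on_gradient continuous_on_gradient_derivative
      continuous_on_twice_differentiable f g)
  have "(\<integral>x. (\<Sum>b\<in>Basis. X' x b \<bullet> b) - X' x x \<bullet> x - (real DIM('a) - 1) * (X x \<bullet> x) \<partial>sphere_measure) = 0"
    by (rule sphere_divergence_theorem[OF d c])
  also have "(\<integral>x. (\<Sum>b\<in>Basis. X' x b \<bullet> b) - X' x x \<bullet> x - (real DIM('a) - 1) * (X x \<bullet> x) \<partial>sphere_measure)
    = (\<integral>x. (f x * euclidean_laplacian g x - g x * euclidean_laplacian f x)
         - (b - a) * (a + b + real DIM('a) - 2) * (f x * g x) \<partial>sphere_measure)"
  proof (rule Bochner_Integration.integral_cong[OF refl])
    fix x :: 'a assume "x \<in> space sphere_measure"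
    then have x: "x \<noteq> 0" by auto
    have comm: "(\<Sum>b\<in>Basis. (gradient g x \<bullet> b) * (gradient f x \<bullet> b))
        = (\<Sum>b\<in>Basis. (gradient f x \<bullet> b) * (gradient g x \<bullet> b))"
      by (rule sum.cong[OF refl], rule mult.commute)
    have "(\<Sum>b\<in>Basis. X' x b \<bullet> b) = (\<Sum>b\<in>Basis. (gradient f x \<bullet> b) * (gradient g x \<bullet> b))
       + f x * (\<Sum>b\<in>Basis. gradient_derivative g x b \<bullet> b) - ((\<Sum>b\<in>Basis. (gradient g x \<bullet> b) * (gradient f x \<bullet> b))
       + g x * (\<Sum>b\<in>Basis. gradient_derivative f x b \<bullet> b))"
      unfolding X'_def by (simp add: inner_diff_left inner_add_left sum.distrib sum_subtractf sum_distrib_left comm)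
    then have tr: "(\<Sum>b\<in>Basis. X' x b \<bullet> b) = f x * euclidean_laplacian g x - g x * euclidean_laplacian f x"
      by (simp add: trace_gradient_derivative f g comm)
    have Xx: "X x \<bullet> x = (b - a) * (f x * g x)"
      unfolding X_def by (simp add: inner_diff_left gradient_euler[OF f hf x] gradient_euler[OF g hg x] algebra_simps)
    have "X' x x = (a + b - 1) *\<^sub>R X x"
      unfolding X'_def X_def
      by (simp add: gradient_euler[OF f hf x] gradient_euler[OF g hg x]
          gradient_derivative_euler[OF f hf x] gradient_derivative_euler[OF g hg x] algebra_simps)
    then have "X' x x \<bullet> x = (a + b - 1) * ((b - a) * (f x * g x))"
      by (simp add: Xx)
    then show "(\<Sum>b\<in>Basis. X' x b \<bullet> b) - X' x x \<bullet> x - (real DIM('a) - 1) * (X x \<bullet> x)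
       = (f x * euclidean_laplacian g x - g x * euclidean_laplacian f x)
         - (b - a) * (a + b + real DIM('a) - 2) * (f x * g x)"
      unfolding tr Xx by (simp add: algebra_simps)
  qed
  also have "\<dots> = (\<integral>x. f x * euclidean_laplacian g x \<partial>sphere_measure) - (\<integral>x. g x * euclidean_laplacian f x \<partial>sphere_measure)
      - (b - a) * (a + b + real DIM('a) - 2) * (\<integral>x. f x * g x \<partial>sphere_measure)"
  proof -
    have i: "integrable sphere_measure (\<lambda>x. f x * euclidean_laplacian g x)"
        "integrable sphere_measure (\<lambda>x. g x * euclidean_laplacian f x)"
        "integrable sphere_measure (\<lambda>x. f x * g x)"
      by (intro integrable_continuous_on_sphere continuous_on_mult continuous_on_twice_differentiable
         continuous_on_euclidean_laplacian f g)+
    show ?thesis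
      unfolding Bochner_Integration.integral_diff[OF Bochner_Integration.integrable_diff[OF i(1,2)] integrable_mult_right[OF i(3)]]
        Bochner_Integration.integral_diff[OF i(1,2)] integral_mult_right_zero ..
  qed
  finally show ?thesis by simp
qed

section \<open>Spherical harmonics\<close>

lemma spherical_harmonics_poly: "Y \<in> spherical_harmonics l \<Longrightarrow> real_polynomial_function Y"
  and spherical_harmonics_hom: "Y \<in> spherical_harmonics l \<Longrightarrow> Y (t *\<^sub>R x) = t ^ l * Y x"
  and spherical_harmonics_laplacian: "Y \<in> spherical_harmonics l \<Longrightarrow> euclidean_laplacian Y x = 0"
  by (auto simp: spherical_harmonics_def)

lemma spherical_harmonics_homogeneous: "Y \<in> spherical_harmonics l \<Longrightarrow> homogeneous (real l) Y"
  by (auto simp: homogeneous_def spherical_harmonics_hom powr_realpow)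

lemma spherical_harmonics_continuous: "Y \<in> spherical_harmonics l \<Longrightarrow> continuous_on A Y"
  by (rule continuous_on_real_polynomial_function[OF spherical_harmonics_poly])

lemma spherical_harmonics_const: "(\<lambda>x :: 'a::euclidean_space. c) \<in> spherical_harmonics 0"
  by (auto simp: spherical_harmonics_def intro: real_polynomial_function_const)

lemma spherical_harmonics_zero: "(\<lambda>x :: 'a::euclidean_space. 0) \<in> spherical_harmonics l"
  by (auto simp: spherical_harmonics_def intro: real_polynomial_function_const)

lemma spherical_harmonics_add:
  "Y \<in> spherical_harmonics l \<Longrightarrow> Z \<in> spherical_harmonics l \<Longrightarrow> (\<lambda>x. Y x + Z x) \<in> spherical_harmonics l"
  by (auto simp: spherical_harmonics_def euclidean_laplacian_add algebra_simps intro: real_polynomial_function_add)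

lemma spherical_harmonics_cmult:
  "Y \<in> spherical_harmonics l \<Longrightarrow> (\<lambda>x. c * Y x) \<in> spherical_harmonics l"
  by (auto simp: spherical_harmonics_def euclidean_laplacian_cmult intro: real_polynomial_function_mult real_polynomial_function_const)

lemma spherical_harmonics_sum:
  assumes "\<And>i. i \<in> I \<Longrightarrow> Y i \<in> spherical_harmonics l"
  shows "(\<lambda>x. \<Sum>i\<in>I. Y i x) \<in> spherical_harmonics l"
  using assms
  by (induction I rule: infinite_finite_induct) (auto intro: spherical_harmonics_zero spherical_harmonics_add)

lemma spherical_harmonics_diff:
  assumes "Y \<in> spherical_harmonics l" "Z \<in> spherical_harmonics l"
  shows "(\<lambda>x. Y x - Z x) \<in> spherical_harmonics l"
  using spherical_harmonics_add[OF assms(1) spherical_harmonics_cmult[OF assms(2), of "-1"]] by simp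

lemma spherical_harmonics_0_const:
  assumes "Y \<in> spherical_harmonics 0"
  shows "Y x = Y 0"
  using spherical_harmonics_hom[OF assms, of 0 x] by simp

lemma spherical_harmonics_dir_deriv_0:
  assumes "Y \<in> spherical_harmonics 0"
  shows "frechet_derivative Y (at x) v = 0"
proof -
  have "Y = (\<lambda>x. Y 0)" using spherical_harmonics_0_const[OF assms] by auto
  then show ?thesis by (metis dir_deriv_const)
qed

text \<open>In degree 0 the derivative vanishes and so is a harmonic of every degree, in particular
  of the truncated degree \<open>0 - 1 = 0\<close>. In higher degrees the scaling law comes from
  differentiating that of \<open>Y\<close>.\<close>

lemma spherical_harmonics_dir_deriv:
  assumes Y: "Y \<in> spherical_harmonics l"
  shows "(\<lambda>x. frechet_derivative Y (at x) v) \<in> spherical_harmonics (l - 1)"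
proof (cases l)
  case 0
  then show ?thesis using spherical_harmonics_dir_deriv_0[of Y] Y by (simp add: spherical_harmonics_zero)
next
  case (Suc k)
  let ?D = "\<lambda>x. frechet_derivative Y (at x) v"
  have p: "real_polynomial_function ?D"
    by (rule real_polynomial_function_dir_deriv[OF spherical_harmonics_poly[OF Y]])
  have D: "?D (t *\<^sub>R x) = t ^ k * ?D x" if "t \<noteq> 0" for t x
  proof -
    have *: "?D (t *\<^sub>R x) = t ^ k * ?D x" if "x \<noteq> 0" for x
      using dir_deriv_scaling[of Y t "t ^ l" x v] \<open>t \<noteq> 0\<close> that Y
      by (simp add: Suc spherical_harmonics_hom differentiable_at_real_polynomial_function spherical_harmonics_poly)
    \<comment> \<open>Differentiation gives the scaling law only for \<open>x \<noteq> 0\<close>;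
      continuity along shrinking multiples of a basis vector extends it to the origin.\<close>
    obtain b :: 'a where b: "b \<in> Basis" using nonempty_Basis by blast
    then have b0: "b \<noteq> 0" by auto
    have conv: "(\<lambda>j. inverse (real (Suc j)) *\<^sub>R b) \<longlonglongrightarrow> 0"
      by (rule tendsto_eq_intros LIMSEQ_inverse_real_of_nat refl | simp)+
    have cont: "isCont ?D y" for y
      using continuous_on_real_polynomial_function[OF p, of UNIV] by (simp add: continuous_on_eq_continuous_at)
    have "(\<lambda>j. ?D (t *\<^sub>R (inverse (real (Suc j)) *\<^sub>R b)) - t ^ k * ?D (inverse (real (Suc j)) *\<^sub>R b))
       \<longlonglongrightarrow> ?D (t *\<^sub>R 0) - t ^ k * ?D 0"
      by (intro tendsto_intros isCont_tendsto_compose[OF cont] conv)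
    moreover have "?D (t *\<^sub>R (inverse (real (Suc j)) *\<^sub>R b)) - t ^ k * ?D (inverse (real (Suc j)) *\<^sub>R b) = 0" for j
      using *[of "inverse (real (Suc j)) *\<^sub>R b"] b0 by simp
    ultimately have "?D (t *\<^sub>R 0) = t ^ k * ?D 0"
      by (simp add: LIMSEQ_const_iff)
    with * show ?thesis by (cases "x = 0") auto
  qed
  \<comment> \<open>The definition of harmonics also covers \<open>t = 0\<close>, where
    \<open>0 ^ k\<close> is 1 for \<open>k = 0\<close>; this time the limit is taken in
    \<open>t\<close>.\<close>
  have D0: "?D (0 *\<^sub>R x) = 0 ^ k * ?D x" for x
  proof -
    have cont: "isCont ?D y" for y
      using continuous_on_real_polynomial_function[OF p, of UNIV] by (simp add: continuous_on_eq_continuous_at)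
    have "(\<lambda>j. ?D (inverse (real (Suc j)) *\<^sub>R x) - inverse (real (Suc j)) ^ k * ?D x) \<longlonglongrightarrow> ?D (0 *\<^sub>R x) - 0 ^ k * ?D x"
      by (intro tendsto_intros isCont_tendsto_compose[OF cont] LIMSEQ_inverse_real_of_nat)
    moreover have "?D (inverse (real (Suc j)) *\<^sub>R x) - inverse (real (Suc j)) ^ k * ?D x = 0" for j
      using D[of "inverse (real (Suc j))"] by simp
    ultimately show ?thesis
      by (simp add: LIMSEQ_const_iff)
  qed
  have "euclidean_laplacian Y = (\<lambda>x. 0)" using spherical_harmonics_laplacian[OF Y] by auto
  then have "euclidean_laplacian ?D x = 0" for x
    using euclidean_laplacian_dir_deriv[OF spherical_harmonics_poly[OF Y], of v x] by simp
  with p D D0 show ?thesis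
    unfolding spherical_harmonics_def Suc by (auto, metis D0 scaleR_zero_left)
qed

text \<open>For two harmonic functions Green's formula leaves only the factor
  \<open>(l - k) * (k + l + DIM('a) - 2)\<close>. Distinct degrees have
  \<open>k + l \<ge> 1\<close>, so from dimension 2 on it is nonzero.\<close>

lemma spherical_harmonics_orthogonal:
  fixes Y Z :: "'a::euclidean_space \<Rightarrow> real"
  assumes Y: "Y \<in> spherical_harmonics k" and Z: "Z \<in> spherical_harmonics l" and "k \<noteq> l" and "DIM('a) \<ge> 2"
  shows "(\<integral>x. Y x * Z x \<partial>sphere_measure) = 0"
proof -
  note pY = spherical_harmonics_poly[OF Y] and pZ = spherical_harmonics_poly[OF Z]
  have "(real l - real k) * (real k + real l + real DIM('a) - 2) * (\<integral>x. Y x * Z x \<partial>sphere_measure) = 0"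
    using sphere_green[OF twice_differentiable_poly[OF pY] spherical_harmonics_homogeneous[OF Y]
      twice_differentiable_poly[OF pZ] spherical_harmonics_homogeneous[OF Z]]
    by (simp add: spherical_harmonics_laplacian[OF Y] spherical_harmonics_laplacian[OF Z])
  moreover have "real k + real l + real DIM('a) - 2 > 0"
    using assms(3,4) by linarith
  ultimately show ?thesis using assms(3) by auto
qed

lemma euclidean_laplacian_inner_self: "euclidean_laplacian (\<lambda>x. x \<bullet> x) (x :: 'a::euclidean_space) = 2 * real DIM('a)"
proof -
  have "frechet_derivative (\<lambda>y. 2 * (y \<bullet> b)) (at x) b = 2" if "b \<in> Basis" for b :: 'a
    using frechet_derivative_inner_const[of "2 *\<^sub>R b" x b] that by (simp add: inner_commute)
  then show ?thesis by (simp add: euclidean_laplacian_def frechet_derivative_inner_self)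
qed

lemma frechet_derivative_euclidean:
  assumes "f differentiable (at x)"
  shows "(\<Sum>b\<in>Basis. (c \<bullet> b) * frechet_derivative f (at x) b) = frechet_derivative f (at x) c"
  using gradient_inner[OF assms, of c] by (simp add: gradient_def inner_sum_left inner_commute[of c] mult.commute)

text \<open>On the sphere \<open>x \<bullet> x = 1\<close>, so a linear form times a harmonic is a sum of two harmonics there.\<close>
lemma spherical_harmonics_inner_mult:
  fixes Y :: "'a::euclidean_space \<Rightarrow> real"
  assumes Y: "Y \<in> spherical_harmonics l" and dim: "DIM('a) \<ge> 3"
  shows "(\<lambda>x. (c \<bullet> x) * Y x - 1 / (2 * real l + real DIM('a) - 2) * ((x \<bullet> x) * frechet_derivative Y (at x) c))
     \<in> spherical_harmonics (Suc l)"
proof -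
  define W where "W x = frechet_derivative Y (at x) c" for x
  \<comment> \<open>The coefficient \<open>1 / d\<close> is forced: the Laplacian of
    \<open>(c \<bullet> x) * Y x\<close> is \<open>2 * W x\<close>, and that of
    \<open>(x \<bullet> x) * W x\<close> is \<open>2 * d * W x\<close>.\<close>
  define d where "d = 2 * real l + real DIM('a) - 2"
  have d: "d > 0" using dim by (simp add: d_def)
  have W: "W \<in> spherical_harmonics (l - 1)"
    unfolding W_def[abs_def] by (rule spherical_harmonics_dir_deriv[OF Y])
  \<comment> \<open>For \<open>l = 0\<close> the truncated \<open>l - 1\<close> is 0 where -1 would
    be meant. That \<open>W\<close> vanishes then saves both Euler's identity and the homogeneity
    below.\<close>
  have W0: "W x = 0" if "l = 0" for x
    using spherical_harmonics_dir_deriv_0[of Y x c] Y that by (simp add: W_def)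
  note pY = spherical_harmonics_poly[OF Y] and pW = spherical_harmonics_poly[OF W]
  note polys = pY pW real_polynomial_function_inner_right real_polynomial_function_inner_self
    real_polynomial_function_mult real_polynomial_function_add real_polynomial_function_const
  have euler: "frechet_derivative W (at x) x = (real l - 1) * W x" for x
  proof (cases "l = 0 \<or> x = 0")
    case True
    then show ?thesis
    proof
      assume "l = 0"
      then have "W = (\<lambda>x. 0)" using W0 by auto
      then show ?thesis by simp
    next
      assume x: "x = 0"
      have "frechet_derivative W (at x) 0 = 0"
        using linear_0[OF linear_frechet_derivative[OF differentiable_at_real_polynomial_function[OF pW]]] by simp
      moreover have "(real l - 1) * W 0 = 0"
        using spherical_harmonics_hom[OF W, of 0 0] W0 by (cases "l = 0 \<or> l = 1") (auto simp: power_0_left split: if_splits)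
      ultimately show ?thesis using x by simp
    qed
  next
    case False
    then show ?thesis
      using homogeneous_euler[OF spherical_harmonics_homogeneous[OF W] differentiable_at_real_polynomial_function[OF pW]]
      by (simp add: of_nat_diff)
  qed
  have "euclidean_laplacian (\<lambda>x. (c \<bullet> x) * Y x + (- 1 / d) * ((x \<bullet> x) * W x)) x = 0" for x
  proof -
    have 1: "euclidean_laplacian (\<lambda>x. (c \<bullet> x) * Y x) x = 2 * W x"
    proof -
      have "euclidean_laplacian (\<lambda>x. c \<bullet> x) x = 0"
        by (simp add: euclidean_laplacian_def frechet_derivative_inner_const)
      then show ?thesis
        using frechet_derivative_euclidean[OF differentiable_at_real_polynomial_function[OF pY], where c = c and x = x]
        by (simp add: euclidean_laplacian_mult polys spherical_harmonics_laplacian[OF Y] frechet_derivative_inner_const W_def)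
    qed
    have 2: "euclidean_laplacian (\<lambda>x. (x \<bullet> x) * W x) x = 2 * d * W x"
    proof -
      have "(\<Sum>b\<in>Basis. 2 * (x \<bullet> b) * frechet_derivative W (at x) b) = 2 * ((real l - 1) * W x)"
        using frechet_derivative_euclidean[OF differentiable_at_real_polynomial_function[OF pW], where c = x and x = x]
        by (simp add: euler mult.assoc sum_distrib_left[symmetric])
      then show ?thesis
        by (simp add: euclidean_laplacian_mult polys spherical_harmonics_laplacian[OF W] euclidean_laplacian_inner_self
           frechet_derivative_inner_self d_def algebra_simps)
    qed
    show ?thesis
      using d by (subst euclidean_laplacian_add; (subst euclidean_laplacian_cmult)?; (intro polys)?) (simp add: 1 2)
  qed
  moreover have "(c \<bullet> (t *\<^sub>R x)) * Y (t *\<^sub>R x) + (- 1 / d) * (((t *\<^sub>R x) \<bullet> (t *\<^sub>R x)) * W (t *\<^sub>R x))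
      = t ^ Suc l * ((c \<bullet> x) * Y x + (- 1 / d) * ((x \<bullet> x) * W x))" for t x
    using W0 by (cases l) (auto simp: spherical_harmonics_hom[OF Y] spherical_harmonics_hom[OF W] algebra_simps)
  ultimately have "(\<lambda>x. (c \<bullet> x) * Y x + (- 1 / d) * ((x \<bullet> x) * W x)) \<in> spherical_harmonics (Suc l)"
    unfolding spherical_harmonics_def by (auto intro!: polys simp del: power_Suc)
  then show ?thesis by (simp add: W_def d_def)
qed

section \<open>Completeness of the spherical harmonics\<close>

definition orthogonal_to_harmonics :: "('a::euclidean_space \<Rightarrow> real) \<Rightarrow> bool" where
  "orthogonal_to_harmonics f \<longleftrightarrow> integrable sphere_measure f \<and>
     (\<forall>l. \<forall>Y\<in>spherical_harmonics l. (\<integral>x. f x * Y x \<partial>sphere_measure) = 0)"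

text \<open>Only a linear factor has content: on the sphere it turns a harmonic into a sum of two
  harmonics. As \<open>f\<close> is arbitrary in the induction, products are absorbed one factor at
  a time, and no decomposition of a polynomial into harmonics has to be constructed.\<close>

lemma orthogonal_to_harmonics_mult_poly:
  fixes f p :: "'a::euclidean_space \<Rightarrow> real"
  assumes "real_polynomial_function p" and dim: "DIM('a) \<ge> 3" and "orthogonal_to_harmonics f"
  shows "orthogonal_to_harmonics (\<lambda>x. f x * p x)"
  using assms(1,3)
proof (induction p arbitrary: f)
  case (linear h)
  then have f: "integrable sphere_measure f"
    and ort: "\<And>l Y. Y \<in> spherical_harmonics l \<Longrightarrow> (\<integral>x. f x * Y x \<partial>sphere_measure) = 0"
    by (auto simp: orthogonal_to_harmonics_def)
  have lin: "linear h" using linear by (simp add: bounded_linear.linear)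
  define c where "c = (\<Sum>b\<in>Basis. h b *\<^sub>R b)"
  have h: "h x = c \<bullet> x" for x
  proof -
    have "h x = h (\<Sum>b\<in>Basis. (x \<bullet> b) *\<^sub>R b)" by (simp add: euclidean_representation)
    also have "\<dots> = (\<Sum>b\<in>Basis. (x \<bullet> b) * h b)" by (simp add: linear_sum[OF lin] linear_scale[OF lin])
    finally show ?thesis by (simp add: c_def inner_sum_left inner_commute[of x] mult.commute)
  qed
  have int: "integrable sphere_measure (\<lambda>x. f x * g x)" if "continuous_on (sphere 0 1) g" for g
    by (rule integrable_mult_continuous_sphere[OF f that])
  show ?case
    unfolding orthogonal_to_harmonics_def
  proof (intro conjI allI ballI)
    show "integrable sphere_measure (\<lambda>x. f x * h x)"
      unfolding h by (intro int continuous_intros)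
    fix l and Y :: "'a \<Rightarrow> real" assume Y: "Y \<in> spherical_harmonics l"
    let ?k = "1 / (2 * real l + real DIM('a) - 2)"
    let ?W = "\<lambda>x. frechet_derivative Y (at x) c"
    let ?Z = "\<lambda>x. (c \<bullet> x) * Y x - ?k * ((x \<bullet> x) * ?W x)"
    have Z: "?Z \<in> spherical_harmonics (Suc l)" by (rule spherical_harmonics_inner_mult[OF Y dim])
    have W: "?W \<in> spherical_harmonics (l - 1)" by (rule spherical_harmonics_dir_deriv[OF Y])
    have "(\<integral>x. f x * h x * Y x \<partial>sphere_measure) = (\<integral>x. f x * ?Z x + ?k * (f x * ?W x) \<partial>sphere_measure)"
      by (rule Bochner_Integration.integral_cong) (auto simp: h dot_square_norm algebra_simps)
    also have "\<dots> = (\<integral>x. f x * ?Z x \<partial>sphere_measure) + ?k * (\<integral>x. f x * ?W x \<partial>sphere_measure)"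
      using int[OF spherical_harmonics_continuous[OF Z]] int[OF spherical_harmonics_continuous[OF W]]
      by (subst Bochner_Integration.integral_add[OF _ integrable_mult_right])
         (simp_all only: integral_mult_right_zero)
    also have "\<dots> = 0" using ort[OF Z] ort[OF W] by simp
    finally show "(\<integral>x. f x * h x * Y x \<partial>sphere_measure) = 0" .
  qed
next
  case (const c)
  have "(\<integral>x. f x * c * Y x \<partial>sphere_measure) = c * (\<integral>x. f x * Y x \<partial>sphere_measure)" for Y :: "'a \<Rightarrow> real"
    by (subst integral_mult_right_zero[symmetric]) (simp add: algebra_simps)
  with const show ?case by (simp add: orthogonal_to_harmonics_def)
next
  case (add p q)
  from add.IH[OF add.prems] have p: "orthogonal_to_harmonics (\<lambda>x. f x * p x)"
    and q: "orthogonal_to_harmonics (\<lambda>x. f x * q x)" by auto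
  have "(\<integral>x. f x * p x * Y x + f x * q x * Y x \<partial>sphere_measure) = 0" if Y: "Y \<in> spherical_harmonics l" for l Y
    using p q Y
    by (subst Bochner_Integration.integral_add)
      (auto simp: orthogonal_to_harmonics_def intro!: integrable_mult_continuous_sphere spherical_harmonics_continuous[OF Y])
  then show ?case using p q by (auto simp: orthogonal_to_harmonics_def distrib_left distrib_right)
next
  case (mult p q)
  from mult.IH(2)[OF mult.IH(1)[OF mult.prems]] show ?case by (simp add: mult.assoc)
qed

text \<open>As \<open>f\<close> is merely integrable, it cannot be paired with itself. Instead the
  vanishing of the integral of \<open>f * g\<close> spreads from polynomials to continuous
  \<open>g\<close> by uniform approximation, to indicators of closed sets by cut-offs, and to Borel
  sets because the closed sets are a generator stable under intersection.\<close>

theorem orthogonal_to_harmonics_AE_zero: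
  fixes f :: "'a::euclidean_space \<Rightarrow> real"
  assumes ort: "orthogonal_to_harmonics f" and dim: "DIM('a) \<ge> 3"
  shows "AE x in sphere_measure. f x = 0"
proof -
  have f: "integrable sphere_measure f" using ort by (simp add: orthogonal_to_harmonics_def)
  then have fm [measurable]: "f \<in> borel_measurable sphere_measure" by simp
  have int: "integrable sphere_measure (\<lambda>x. f x * g x)" if "continuous_on (sphere 0 1) g" for g
    by (rule integrable_mult_continuous_sphere[OF f that])
  have poly: "(\<integral>x. f x * p x \<partial>sphere_measure) = 0" if "real_polynomial_function p" for p
    using orthogonal_to_harmonics_mult_poly[OF that dim ort] spherical_harmonics_const[of 1]
    by (fastforce simp: orthogonal_to_harmonics_def)
  have cont: "(\<integral>x. f x * g x \<partial>sphere_measure) = 0" if g: "continuous_on (sphere 0 1) g" for g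
  proof -
    have bound: "\<bar>\<integral>x. f x * g x \<partial>sphere_measure\<bar> \<le> e * (\<integral>x. \<bar>f x\<bar> \<partial>sphere_measure)" if e: "e > 0" for e
    proof -
      obtain p where p: "real_polynomial_function p" "\<And>x. x \<in> sphere 0 1 \<Longrightarrow> \<bar>g x - p x\<bar> < e"
        using Stone_Weierstrass_real_polynomial_function[OF compact_sphere g e] by blast
      have "(\<integral>x. f x * g x \<partial>sphere_measure) = (\<integral>x. f x * (g x - p x) \<partial>sphere_measure)"
        using poly[OF p(1)] int[OF g] int[OF continuous_on_real_polynomial_function[OF p(1)]]
        by (simp add: right_diff_distrib)
      also have "\<bar>\<dots>\<bar> \<le> (\<integral>x. e * \<bar>f x\<bar> \<partial>sphere_measure)"
      proof (rule integral_abs_bound[THEN order_trans], rule integral_mono_AE)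
        show "AE x in sphere_measure. \<bar>f x * (g x - p x)\<bar> \<le> e * \<bar>f x\<bar>"
        proof (rule AE_I2)
          fix x :: 'a assume "x \<in> space sphere_measure"
          then have "\<bar>g x - p x\<bar> \<le> e" using p(2)[of x] by simp
          from mult_left_mono[OF this abs_ge_zero[of "f x"]]
          show "\<bar>f x * (g x - p x)\<bar> \<le> e * \<bar>f x\<bar>"
            by (simp add: abs_mult mult.commute)
        qed
      qed (use f int[OF continuous_on_diff[OF g continuous_on_real_polynomial_function[OF p(1)]]] in auto)
      finally show ?thesis by simp
    qed
    have "\<bar>\<integral>x. f x * g x \<partial>sphere_measure\<bar> \<le> 0"
    proof (rule field_le_epsilon)
      fix e :: real assume e: "e > 0"
      define I where "I = (\<integral>x. \<bar>f x\<bar> \<partial>sphere_measure)"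
      have I: "I \<ge> 0" by (simp add: I_def)
      have "\<bar>\<integral>x. f x * g x \<partial>sphere_measure\<bar> \<le> e / (I + 1) * I"
        using e I unfolding I_def by (intro bound divide_pos_pos) linarith+
      also have "\<dots> \<le> e" using e I by (simp add: field_simps)
      finally show "\<bar>\<integral>x. f x * g x \<partial>sphere_measure\<bar> \<le> 0 + e" by simp
    qed
    then show ?thesis by simp
  qed
  have indm: "(indicator A :: 'a \<Rightarrow> real) \<in> borel_measurable sphere_measure" if "A \<in> sets borel" for A
    using that by (simp add: measurable_cong_sets[OF sets_sphere_measure refl] measurable_restrict_space1)
  have closed: "(\<integral>x. f x * indicator A x \<partial>sphere_measure) = 0" if A: "closed A" for A
  proof (cases "A = {}")
    case False
    \<comment> \<open>Continuous cut-offs, equal to 1 on \<open>A\<close> and, for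
      \<open>k > 0\<close>, to 0 beyond distance \<open>1 / k\<close> from it.\<close>
    define g where "g k x = max 0 (1 - real k * infdist x A)" for k x
    have gc: "continuous_on (sphere 0 1) (g k)" for k
      unfolding g_def by (intro continuous_intros)
    have "(\<lambda>k. \<integral>x. f x * g k x \<partial>sphere_measure) \<longlonglongrightarrow> (\<integral>x. f x * indicator A x \<partial>sphere_measure)"
    proof (rule integral_dominated_convergence)
      show "integrable sphere_measure (\<lambda>x. \<bar>f x\<bar>)" using f by simp
      note [measurable] = indm[OF borel_closed[OF A]]
      show "(\<lambda>x. f x * indicator A x) \<in> borel_measurable sphere_measure" by measurable
      show "(\<lambda>x. f x * g k x) \<in> borel_measurable sphere_measure" for k
        using int[OF gc] by simp
      show "AE x in sphere_measure. norm (f x * g k x) \<le> \<bar>f x\<bar>" for k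
        by (intro AE_I2) (auto simp: g_def abs_mult infdist_nonneg intro!: mult_left_le)
      show "AE x in sphere_measure. (\<lambda>k. f x * g k x) \<longlonglongrightarrow> f x * indicator A x"
      proof (intro AE_I2 tendsto_mult tendsto_const)
        fix x
        show "(\<lambda>k. g k x) \<longlonglongrightarrow> indicator A x"
        proof (cases "x \<in> A")
          case True
          then show ?thesis by (simp add: g_def)
        next
          case x: False
          then have pos: "infdist x A > 0"
            using A False by (metis in_closed_iff_infdist_zero infdist_nonneg less_eq_real_def)
          obtain K :: nat where "1 / infdist x A < K" using reals_Archimedean2 by blast
          then have K: "1 < real K * infdist x A" using pos by (simp add: field_simps)
          have "g k x = 0" if "k \<ge> K" for k
          proof -
            have "real K * infdist x A \<le> real k * infdist x A"
              using that pos by (intro mult_right_mono) auto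
            with K show ?thesis by (simp add: g_def)
          qed
          then have "eventually (\<lambda>k. g k x = 0) sequentially"
            by (auto simp: eventually_sequentially)
          then show ?thesis using x by (simp add: tendsto_eventually)
        qed
      qed
    qed
    then show ?thesis using cont[OF gc] by (simp add: LIMSEQ_const_iff)
  qed simp
  have indi: "integrable sphere_measure (\<lambda>x. f x * indicator A x)" if "A \<in> sets borel" for A
  proof (rule Bochner_Integration.integrable_bound[OF f])
    show "(\<lambda>x. f x * indicator A x) \<in> borel_measurable sphere_measure"
      using indm[OF that] by measurable
    show "AE x in sphere_measure. norm (f x * indicator A x) \<le> norm (f x)"
      by (intro AE_I2) (auto simp: indicator_def)
  qed
  have borel: "(\<integral>x. f x * indicator A x \<partial>sphere_measure) = 0" if "A \<in> sets borel" for A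
  proof -
    have A: "A \<in> sigma_sets UNIV (Collect closed)"
      using that by (simp add: borel_eq_closed)
    have "Int_stable (Collect closed :: 'a set set)" by (auto simp: Int_stable_def)
    moreover have "Collect closed \<subseteq> Pow (UNIV :: 'a set)" by simp
    ultimately show ?thesis using A
    proof (induction A rule: sigma_sets_induct_disjoint)
      case (basic A)
      then show ?case using closed by auto
    next
      case empty
      then show ?case by simp
    next
      case (compl A)
      have A: "A \<in> sets borel" using compl(1) by (simp add: borel_eq_closed)
      have "(\<integral>x. f x * indicator (UNIV - A) x \<partial>sphere_measure)
          = (\<integral>x. f x * 1 - f x * indicator A x \<partial>sphere_measure)"
        by (rule Bochner_Integration.integral_cong) (auto simp: indicator_def)
      also have "\<dots> = 0"
        using cont[of "\<lambda>x. 1"] compl(2) indi[OF A] f by simp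
      finally show ?case .
    next
      case (union A)
      have A: "A i \<in> sets borel" for i using union(2) by (auto simp: borel_eq_closed)
      have "(\<lambda>k. \<integral>x. f x * indicator (\<Union>i<k. A i) x \<partial>sphere_measure)
          \<longlonglongrightarrow> (\<integral>x. f x * indicator (\<Union>i. A i) x \<partial>sphere_measure)"
      proof (rule integral_dominated_convergence)
        show "integrable sphere_measure (\<lambda>x. \<bar>f x\<bar>)" using f by simp
        show "AE x in sphere_measure. (\<lambda>k. f x * indicator (\<Union>i<k. A i) x) \<longlonglongrightarrow> f x * indicator (\<Union>i. A i) x"
          by (intro AE_I2 tendsto_mult tendsto_const LIMSEQ_indicator_UN)
        show "AE x in sphere_measure. norm (f x * indicator (\<Union>i<k. A i) x) \<le> \<bar>f x\<bar>" for k
          by (intro AE_I2) (auto simp: indicator_def)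
        show "(\<lambda>x. f x * indicator (\<Union>i. A i) x) \<in> borel_measurable sphere_measure"
          by (rule borel_measurable_integrable[OF indi]) (use A in auto)
        show "(\<lambda>x. f x * indicator (\<Union>i<k. A i) x) \<in> borel_measurable sphere_measure" for k
          by (rule borel_measurable_integrable[OF indi]) (use A in auto)
      qed
      moreover have "(\<integral>x. f x * indicator (\<Union>i<k. A i) x \<partial>sphere_measure) = 0" for k
      proof -
        have eq: "f x * indicator (\<Union>i<k. A i) x = (\<Sum>i<k. f x * indicator (A i) x)" for x
          using union(1) by (subst indicator_UN_disjoint)
            (auto simp: sum_distrib_left disjoint_family_on_def)
        show ?thesis
          unfolding eq by (subst Bochner_Integration.integral_sum[OF indi[OF A]]) (simp only: union(3) sum.neutral_const)
      qed
      ultimately show ?case by (simp add: LIMSEQ_const_iff)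
    qed
  qed
  show ?thesis
  proof (rule sigma_finite_measure.density_zero[OF finite_measure.axioms(1)[OF finite_measure_sphere_measure] f])
    fix A assume "A \<in> sets (sphere_measure :: 'a measure)"
    then have "A \<in> sets borel" by (auto simp: sets_restrict_space_iff)
    from borel[OF this] show "set_lebesgue_integral sphere_measure A f = 0"
      by (simp add: set_lebesgue_integral_def mult.commute)
  qed
qed

section \<open>Smooth functions\<close>

lemma Ck_on_cong:
  fixes f g :: "'a::euclidean_space \<Rightarrow> real"
  assumes "open U" "\<And>x. x \<in> U \<Longrightarrow> f x = g x" "Ck_on k f U"
  shows "Ck_on k g U"
  using assms(2,3)
proof (induction k arbitrary: f g)
  case 0
  then show ?case by (simp cong: continuous_on_cong)
next
  case (Suc k)
  have d: "(g has_derivative frechet_derivative f (at x)) (at x)" if "x \<in> U" for x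
  proof (rule has_derivative_transform_within_open[OF _ \<open>open U\<close> that])
    show "(f has_derivative frechet_derivative f (at x)) (at x)"
      using Suc.prems(2) that by (simp add: frechet_derivative_works)
  qed (rule Suc.prems(1))
  have fe: "frechet_derivative g (at x) = frechet_derivative f (at x)" if "x \<in> U" for x
    by (rule frechet_derivative_eq[OF d[OF that]])
  have "Ck_on k (\<lambda>x. frechet_derivative g (at x) v) U" for v
  proof (rule Suc.IH)
    show "Ck_on k (\<lambda>x. frechet_derivative f (at x) v) U" using Suc.prems(2) by simp
  qed (simp add: fe)
  moreover have "g differentiable (at x)" if "x \<in> U" for x
    using d[OF that] by (rule differentiableI)
  ultimately show ?case by simp
qed

text \<open>Admits any explicit formula \<open>f'\<close> for the derivative on \<open>U\<close>, so
  that later proofs need not mention \<open>frechet_derivative\<close>.\<close>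

lemma Ck_on_SucI:
  fixes f :: "'a::euclidean_space \<Rightarrow> real"
  assumes "open U" and d: "\<And>x. x \<in> U \<Longrightarrow> (f has_derivative f' x) (at x)"
    and c: "\<And>v. Ck_on k (\<lambda>x. f' x v) U"
  shows "Ck_on (Suc k) f U"
  unfolding Ck_on.simps
proof (intro conjI ballI allI)
  fix x assume "x \<in> U"
  then show "f differentiable (at x)" using d by (blast intro: differentiableI)
next
  fix v
  show "Ck_on k (\<lambda>x. frechet_derivative f (at x) v) U"
  proof (rule Ck_on_cong[OF assms(1) _ c])
    fix x assume "x \<in> U"
    show "f' x v = frechet_derivative f (at x) v"
      by (simp add: frechet_derivative_eq[OF d[OF \<open>x \<in> U\<close>]])
  qed
qed

lemma Ck_on_SucD:
  assumes "Ck_on (Suc k) f U"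
  shows "x \<in> U \<Longrightarrow> (f has_derivative frechet_derivative f (at x)) (at x)"
    and "Ck_on k (\<lambda>x. frechet_derivative f (at x) v) U"
  using assms by (simp_all add: frechet_derivative_works)

lemma Ck_on_Suc_imp: "Ck_on (Suc k) f U \<Longrightarrow> Ck_on k f U"
proof (induction k arbitrary: f)
  case 0
  then show ?case
    by (auto intro!: continuous_at_imp_continuous_on differentiable_imp_continuous_within)
next
  case (Suc k)
  then show ?case by (metis Ck_on.simps(2))
qed

lemma Ck_on_const: "Ck_on k (\<lambda>x. c) U"
proof (induction k arbitrary: c)
  case (Suc k)
  then show ?case using dir_deriv_const by simp
qed simp

lemma Ck_on_add:
  fixes f g :: "'a::euclidean_space \<Rightarrow> real"
  assumes "open U" "Ck_on k f U" "Ck_on k g U"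
  shows "Ck_on k (\<lambda>x. f x + g x) U"
  using assms(2,3)
proof (induction k arbitrary: f g)
  case 0
  then show ?case by (simp add: continuous_on_add)
next
  case (Suc k)
  show ?case
    by (rule Ck_on_SucI[OF assms(1) has_derivative_add[OF Ck_on_SucD(1)[OF Suc.prems(1)] Ck_on_SucD(1)[OF Suc.prems(2)]]
        Suc.IH[OF Ck_on_SucD(2)[OF Suc.prems(1)] Ck_on_SucD(2)[OF Suc.prems(2)]]])
qed

lemma Ck_on_mult:
  fixes f g :: "'a::euclidean_space \<Rightarrow> real"
  assumes "open U" "Ck_on k f U" "Ck_on k g U"
  shows "Ck_on k (\<lambda>x. f x * g x) U"
  using assms(2,3)
proof (induction k arbitrary: f g)
  case 0
  then show ?case by (simp add: continuous_on_mult)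
next
  case (Suc k)
  show ?case
    by (rule Ck_on_SucI[OF assms(1) has_derivative_mult[OF Ck_on_SucD(1)[OF Suc.prems(1)] Ck_on_SucD(1)[OF Suc.prems(2)]]
        Ck_on_add[OF assms(1) Suc.IH[OF Ck_on_Suc_imp[OF Suc.prems(1)] Ck_on_SucD(2)[OF Suc.prems(2)]]
           Suc.IH[OF Ck_on_SucD(2)[OF Suc.prems(1)] Ck_on_Suc_imp[OF Suc.prems(2)]]]])
qed

lemma Ck_on_sum:
  fixes f :: "'i \<Rightarrow> 'a::euclidean_space \<Rightarrow> real"
  assumes "open U" "\<And>i. i \<in> I \<Longrightarrow> Ck_on k (f i) U"
  shows "Ck_on k (\<lambda>x. \<Sum>i\<in>I. f i x) U"
  using assms(2)
  by (induction I rule: infinite_finite_induct) (auto intro: Ck_on_const Ck_on_add assms(1))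

lemma Ck_on_poly:
  fixes p :: "'a::euclidean_space \<Rightarrow> real"
  shows "real_polynomial_function p \<Longrightarrow> Ck_on k p U"
  by (induction k arbitrary: p)
    (auto intro: continuous_on_real_polynomial_function differentiable_at_real_polynomial_function real_polynomial_function_dir_deriv)

text \<open>The induction lowers the order of \<open>F\<close> only, hence the components of
  \<open>g\<close> are assumed to be of every order. The chain rule is expanded in coordinates
  because \<open>Ck_on\<close> speaks of real-valued functions.\<close>

lemma Ck_on_compose:
  fixes F :: "'b::euclidean_space \<Rightarrow> real" and g :: "'a::euclidean_space \<Rightarrow> 'b"
  assumes V: "open V" and gU: "\<And>x. x \<in> V \<Longrightarrow> g x \<in> U"
    and g: "\<And>k b. b \<in> Basis \<Longrightarrow> Ck_on k (\<lambda>x. g x \<bullet> b) V"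
    and "Ck_on k F U"
  shows "Ck_on k (\<lambda>x. F (g x)) V"
  using assms(4)
proof (induction k arbitrary: F)
  case 0
  have "continuous_on V g"
    using g[of _ 0] by (subst continuous_on_componentwise) auto
  then show ?case
    using 0 gU by (auto intro: continuous_on_compose2)
next
  case (Suc k)
  have gd: "(g has_derivative (\<lambda>v. \<Sum>b\<in>Basis. frechet_derivative (\<lambda>x. g x \<bullet> b) (at x) v *\<^sub>R b)) (at x)" if "x \<in> V" for x
  proof -
    have "((\<lambda>x. \<Sum>b\<in>Basis. (g x \<bullet> b) *\<^sub>R b) has_derivative (\<lambda>v. \<Sum>b\<in>Basis. frechet_derivative (\<lambda>x. g x \<bullet> b) (at x) v *\<^sub>R b)) (at x)"
      using g[of _ 1] that by (intro has_derivative_sum has_derivative_scaleR_left) (auto simp: frechet_derivative_works)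
    then show ?thesis by (simp add: euclidean_representation)
  qed
  have d: "((\<lambda>x. F (g x)) has_derivative (\<lambda>v. \<Sum>b\<in>Basis. frechet_derivative (\<lambda>x. g x \<bullet> b) (at x) v * frechet_derivative F (at (g x)) b)) (at x)"
    if x: "x \<in> V" for x
  proof -
    have Fd: "F differentiable (at (g x))" using Suc.prems gU[OF x] by simp
    then have lin: "linear (frechet_derivative F (at (g x)))" by (rule linear_frechet_derivative)
    show ?thesis
      using diff_chain_at[OF gd[OF x], of F "frechet_derivative F (at (g x))"] Fd
      by (simp add: comp_def frechet_derivative_works linear_sum[OF lin] linear_scale[OF lin])
  qed
  show ?case
  proof (rule Ck_on_SucI[OF V d Ck_on_sum[OF V Ck_on_mult[OF V]]])
    show "Ck_on k (\<lambda>x. frechet_derivative (\<lambda>x. g x \<bullet> b) (at x) v) V" if "b \<in> Basis" for b v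
      using g[OF that] by (rule Ck_on_SucD(2))
    show "Ck_on k (\<lambda>x. frechet_derivative F (at (g x)) b) V" for b
      using Suc.prems by (intro Suc.IH Ck_on_SucD(2))
  qed
qed

text \<open>The derivative in direction \<open>v\<close> is \<open>- (v \<bullet> x)\<close> times
  the cube of the same function, so the induction closes on products.\<close>

lemma Ck_on_inverse_norm: "Ck_on k (\<lambda>x::'a::euclidean_space. inverse (norm x)) (-{0})"
proof (induction k)
  case 0
  show ?case by (auto intro!: continuous_intros)
next
  case (Suc k)
  have d: "((\<lambda>x::'a. inverse (norm x)) has_derivative
      (\<lambda>v. (- 1 * (v \<bullet> x)) * (inverse (norm x) * (inverse (norm x) * inverse (norm x))))) (at x)" if "x \<in> -{0}" for x
    using that by (auto intro!: derivative_eq_intros has_derivative_norm simp: sgn_div_norm field_simps)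
  show ?case
    by (rule Ck_on_SucI[OF _ d Ck_on_mult[OF _ Ck_on_poly Ck_on_mult[OF _ Suc Ck_on_mult[OF _ Suc Suc]]]])
       (auto intro!: real_polynomial_function_mult real_polynomial_function_const real_polynomial_function_inner_right)
qed

lemma Ck_on_sgn_inner: "Ck_on k (\<lambda>x::'a::euclidean_space. sgn x \<bullet> b) (-{0})"
  by (rule Ck_on_cong[OF _ _ Ck_on_mult[OF _ Ck_on_inverse_norm Ck_on_poly[of "\<lambda>x. b \<bullet> x"]]])
    (auto simp: sgn_div_norm inner_commute real_polynomial_function_inner_right)

text \<open>Passes from the unspecified local extension in the definition of smoothness to the
  radially constant one, through which gradient and Laplacian are defined.\<close>

lemma smooth_on_sphere_Ck_on:
  fixes u :: "'a::euclidean_space \<Rightarrow> real"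
  assumes "smooth_on_sphere u"
  shows "Ck_on k (\<lambda>y. u (sgn y)) (-{0})"
proof -
  obtain U F where U: "open U" "sphere 0 1 \<subseteq> U" "\<And>k. Ck_on k F U" "\<And>x. x \<in> sphere 0 1 \<Longrightarrow> u x = F x"
    using assms unfolding smooth_on_sphere_def by blast
  have sph: "sgn x \<in> sphere 0 1" if "x \<in> -{0}" for x :: 'a
    using that by (simp add: norm_sgn)
  show ?thesis
    by (rule Ck_on_cong[OF _ _ Ck_on_compose[of "-{0}" sgn U k F]])
      (use U sph in \<open>auto intro: Ck_on_sgn_inner\<close>)
qed

section \<open>The Laplacian on smooth functions\<close>

lemma smooth_on_sphere_twice_differentiable:
  assumes "smooth_on_sphere u"
  shows "twice_differentiable (\<lambda>y. u (sgn y))"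
  using smooth_on_sphere_Ck_on[OF assms, of 2]
    continuous_on_subset[of "-{0}" _ "sphere 0 1"]
  by (force simp: twice_differentiable_def numeral_2_eq_2)

lemma homogeneous_sgn: "homogeneous 0 (\<lambda>y. u (sgn y))"
  by (auto simp: homogeneous_def sgn_scaleR)

lemma sgn_sphere: "(x :: 'a::euclidean_space) \<in> sphere 0 1 \<Longrightarrow> sgn x = x"
  by (simp add: sgn_div_norm)

lemma smooth_on_sphere_continuous:
  assumes "smooth_on_sphere u"
  shows "continuous_on (sphere 0 1) u"
  by (rule continuous_on_eq[OF continuous_on_twice_differentiable[OF smooth_on_sphere_twice_differentiable[OF assms]]])
    (simp only: sgn_sphere)

text \<open>The definition differentiates the gradient composed with \<open>sgn\<close>. The
  gradient of \<open>u (sgn y)\<close> is homogeneous of degree -1, so this composition is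
  \<open>norm y\<close> times the gradient. The extra term from the norm has as its trace the radial
  component of the gradient, which is 0 by Euler's identity.\<close>

lemma sphere_laplacian_eq:
  assumes u: "smooth_on_sphere u" and x: "x \<in> sphere 0 1"
  shows "sphere_laplacian u x = euclidean_laplacian (\<lambda>y. u (sgn y)) x"
proof -
  let ?F = "\<lambda>y. u (sgn y)"
  note F = smooth_on_sphere_twice_differentiable[OF u]
  have x0: "x \<noteq> 0" using x by auto
  have nx: "norm x = 1" using x by simp
  have grad: "sphere_gradient u y = gradient ?F y" for y
    by (simp add: sphere_gradient_def gradient_def)
  have scale: "norm y *\<^sub>R gradient ?F y = gradient ?F (sgn y)" if "y \<in> -{0}" for y
  proof -
    have y: "y \<noteq> 0" using that by simp
    have "homogeneous (0 - 1) (\<lambda>y. frechet_derivative ?F (at y) v)" for v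
      by (rule homogeneous_dir_deriv[OF homogeneous_sgn twice_differentiable_differentiable[OF F]])
    then have "frechet_derivative ?F (at (inverse (norm y) *\<^sub>R y)) v = inverse (norm y) powr (-1) * frechet_derivative ?F (at y) v" for v
      using y unfolding homogeneous_def by simp
    then have "frechet_derivative ?F (at (sgn y)) v = norm y * frechet_derivative ?F (at y) v" for v
      using y by (simp add: sgn_div_norm powr_minus)
    then show ?thesis by (simp add: gradient_def scaleR_sum_right)
  qed
  have "((\<lambda>y. norm y *\<^sub>R gradient ?F y) has_derivative (\<lambda>v. (v \<bullet> x) *\<^sub>R gradient ?F x + gradient_derivative ?F x v)) (at x)"
    using x0 by (auto intro!: derivative_eq_intros has_derivative_norm gradient_has_derivative[OF F] simp: sgn_sphere[OF x] nx)
  then have d: "((\<lambda>y. gradient ?F (sgn y)) has_derivative (\<lambda>v. (v \<bullet> x) *\<^sub>R gradient ?F x + gradient_derivative ?F x v)) (at x)"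
    by (rule has_derivative_transform_within_open[of _ _ _ _ "-{0}"]) (use x0 scale in auto)
  have "sphere_laplacian u x = (\<Sum>b\<in>Basis. (x \<bullet> b) * (gradient ?F x \<bullet> b) + gradient_derivative ?F x b \<bullet> b)"
    unfolding sphere_laplacian_def sphere_divergence_def grad
    by (subst frechet_derivative_eq[OF d]) (simp add: inner_add_left inner_commute[of x])
  also have "\<dots> = gradient ?F x \<bullet> x + euclidean_laplacian ?F x"
    by (simp add: sum.distrib trace_gradient_derivative[OF F] euclidean_inner[of _ x] mult.commute)
  also have "gradient ?F x \<bullet> x = 0"
    using gradient_euler[OF F homogeneous_sgn x0] by simp
  finally show ?thesis by simp
qed

lemma smooth_on_sphere_poly: "real_polynomial_function p \<Longrightarrow> smooth_on_sphere p"
  unfolding smooth_on_sphere_def by (intro exI[of _ UNIV] exI[of _ p]) (auto intro: Ck_on_poly)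

lemma smooth_on_sphere_shifted_laplacian:
  assumes u: "smooth_on_sphere u"
  shows "smooth_on_sphere (shifted_laplacian c u)"
proof -
  let ?F = "\<lambda>y. u (sgn y)"
  note F = smooth_on_sphere_Ck_on[OF u]
  have "Ck_on k (\<lambda>x. frechet_derivative (\<lambda>y. frechet_derivative ?F (at y) v) (at x) w) (-{0})" for k v w
    using F[of "Suc (Suc k)"] by simp
  then have "Ck_on k (\<lambda>x. (-1) * euclidean_laplacian ?F x + c * ?F x) (-{0})" for k
    unfolding euclidean_laplacian_def by (intro Ck_on_add Ck_on_mult Ck_on_sum Ck_on_const F) auto
  moreover have "shifted_laplacian c u x = (-1) * euclidean_laplacian ?F x + c * ?F x" if "x \<in> sphere 0 1" for x
    using that by (simp add: shifted_laplacian_def sphere_laplacian_eq[OF u] sgn_sphere)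
  ultimately show ?thesis
    unfolding smooth_on_sphere_def by (intro exI[of _ "-{0}"] exI[of _ "\<lambda>x. (-1) * euclidean_laplacian ?F x + c * ?F x"]) auto
qed

text \<open>Green's formula between \<open>Y\<close>, of degree \<open>l\<close>, and the radially
  constant extension of \<open>u\<close>, of degree 0; the eigenvalue is the factor produced by the
  two degrees.\<close>

lemma shifted_laplacian_self_adjoint:
  fixes u :: "'a::euclidean_space \<Rightarrow> real"
  assumes u: "smooth_on_sphere u" and Y: "Y \<in> spherical_harmonics l"
  shows "(\<integral>x. shifted_laplacian c u x * Y x \<partial>sphere_measure)
     = (real l * (real l + real DIM('a) - 2) + c) * (\<integral>x. u x * Y x \<partial>sphere_measure)"
proof -
  let ?F = "\<lambda>y. u (sgn y)"
  note F = smooth_on_sphere_twice_differentiable[OF u]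
  note pY = twice_differentiable_poly[OF spherical_harmonics_poly[OF Y]]
  have 1: "(\<integral>x. Y x * euclidean_laplacian ?F x \<partial>sphere_measure)
     = - real l * (real l + real DIM('a) - 2) * (\<integral>x. Y x * ?F x \<partial>sphere_measure)"
    using sphere_green[OF pY spherical_harmonics_homogeneous[OF Y] F homogeneous_sgn]
    by (simp add: spherical_harmonics_laplacian[OF Y])
  have 2: "(\<integral>x. Y x * ?F x \<partial>sphere_measure) = (\<integral>x. u x * Y x \<partial>sphere_measure)"
    by (rule Bochner_Integration.integral_cong) (auto simp: sgn_sphere)
  have i: "integrable sphere_measure (\<lambda>x. Y x * euclidean_laplacian ?F x)"
    "integrable sphere_measure (\<lambda>x. u x * Y x)"
    by (intro integrable_continuous_on_sphere continuous_on_mult spherical_harmonics_continuous[OF Y]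
      continuous_on_euclidean_laplacian F smooth_on_sphere_continuous u)+
  have "(\<integral>x. shifted_laplacian c u x * Y x \<partial>sphere_measure)
    = (\<integral>x. c * (u x * Y x) - Y x * euclidean_laplacian ?F x \<partial>sphere_measure)"
    by (rule Bochner_Integration.integral_cong) (auto simp: shifted_laplacian_def sphere_laplacian_eq[OF u] algebra_simps)
  also have "\<dots> = c * (\<integral>x. u x * Y x \<partial>sphere_measure) - (\<integral>x. Y x * euclidean_laplacian ?F x \<partial>sphere_measure)"
    unfolding Bochner_Integration.integral_diff[OF integrable_mult_right[OF i(2)] i(1)] integral_mult_right_zero ..
  also have "\<dots> = (real l * (real l + real DIM('a) - 2) + c) * (\<integral>x. u x * Y x \<partial>sphere_measure)"
    unfolding 1 2 by (simp add: algebra_simps)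
  finally show ?thesis .
qed

section \<open>Zonal kernels\<close>

definition sqdist :: "'a::euclidean_space \<Rightarrow> 'a \<Rightarrow> real" where
  "sqdist Q x = (norm (x - Q))\<^sup>2"

lemma sqdist_nonneg [simp]: "0 \<le> sqdist Q x"
  by (simp add: sqdist_def)

lemma sqdist_eq_0 [simp]: "sqdist Q x = 0 \<longleftrightarrow> x = Q"
  by (simp add: sqdist_def)

lemma sqdist_inner: "sqdist Q x = (x - Q) \<bullet> (x - Q)"
  by (simp add: sqdist_def power2_norm_eq_inner)

lemma sqdist_le_4:
  assumes "Q \<in> sphere 0 1" "x \<in> sphere 0 1"
  shows "sqdist Q x \<le> 4"
proof -
  have "norm (x - Q) \<le> 1 + 1" using norm_triangle_ineq4[of x Q] assms by simp
  then have "(norm (x - Q))\<^sup>2 \<le> (1 + 1)\<^sup>2" by (intro power_mono) auto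
  then show ?thesis by (simp add: sqdist_def)
qed

lemma continuous_on_sqdist [continuous_intros]: "continuous_on A (sqdist Q)"
  unfolding sqdist_def[abs_def] by (intro continuous_intros)

lemma sqdist_powr: "norm (x - Q) powr (2 * s) = sqdist Q x powr s"
  by (simp add: sqdist_def powr_powr[symmetric] powr_numeral)

lemma sqdist_sphere:
  assumes "Q \<in> sphere 0 1" "x \<in> sphere 0 1"
  shows "x \<bullet> x = 1" "Q \<bullet> x = 1 - sqdist Q x / 2" "(x - Q) \<bullet> x = sqdist Q x / 2"
proof -
  have 1: "x \<bullet> x = 1" "Q \<bullet> Q = 1" using assms by (simp_all add: dot_square_norm)
  then show "x \<bullet> x = 1" "Q \<bullet> x = 1 - sqdist Q x / 2" "(x - Q) \<bullet> x = sqdist Q x / 2"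
    by (simp_all add: sqdist_inner inner_diff_left inner_diff_right inner_commute field_simps)
qed

lemma sqdist_has_derivative: "(sqdist Q has_derivative (\<lambda>v. 2 * ((x - Q) \<bullet> v))) (at x)"
  unfolding sqdist_inner[abs_def] by (auto intro!: derivative_eq_intros simp: inner_commute)

lemma sum_inner_Basis: "(\<Sum>b\<in>Basis. (a \<bullet> b) * (c \<bullet> b)) = a \<bullet> c"
  by (rule euclidean_inner[symmetric])

section \<open>Divergence identities for smooth zonal kernels\<close>

context
  fixes Q :: "'a::euclidean_space" and \<phi> \<phi>' :: "real \<Rightarrow> real"
  assumes Q: "Q \<in> sphere 0 1"
    and phi: "\<And>t. t \<ge> 0 \<Longrightarrow> (\<phi> has_real_derivative \<phi>' t) (at t)"
    and phi': "continuous_on {0..} \<phi>'"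
begin

lemma zonal_has_derivative:
  "((\<lambda>x. \<phi> (sqdist Q x)) has_derivative (\<lambda>v. \<phi>' (sqdist Q x) * (2 * ((x - Q) \<bullet> v)))) (at x)"
  using diff_chain_at[OF sqdist_has_derivative[of Q x] phi[of "sqdist Q x", unfolded has_field_derivative_def]]
  by (simp add: comp_def)

lemma zonal_continuous_on: "continuous_on A (\<lambda>x. \<phi> (sqdist Q x))"
  by (intro continuous_at_imp_continuous_on ballI has_derivative_continuous[OF zonal_has_derivative])

lemma zonal_deriv_continuous_on: "continuous_on A (\<lambda>x. \<phi>' (sqdist Q x))"
  by (rule continuous_on_compose2[OF phi']) (auto intro: continuous_intros)

text \<open>The divergence theorem for \<open>\<phi> (sqdist Q x) *\<^sub>R (x - Q)\<close>. With a
  shifted power for \<open>\<phi>\<close> it yields both the integrability of the singular powers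
  and the recursion for their integrals.\<close>

lemma zonal_divergence_const:
  "(\<integral>x. \<phi>' (sqdist Q x) * (2 * sqdist Q x - (sqdist Q x)\<^sup>2 / 2)
      + \<phi> (sqdist Q x) * (real DIM('a) - 1) * (1 - sqdist Q x / 2) \<partial>sphere_measure) = 0"
proof -
  define X where "X x = \<phi> (sqdist Q x) *\<^sub>R (x - Q)" for x
  define X' where "X' x v = (\<phi>' (sqdist Q x) * (2 * ((x - Q) \<bullet> v))) *\<^sub>R (x - Q) + \<phi> (sqdist Q x) *\<^sub>R v" for x v
  have d: "(X has_derivative X' x) (at x)" for x
    unfolding X_def[abs_def] X'_def[abs_def]
    by (auto intro!: derivative_eq_intros zonal_has_derivative)
  have c: "continuous_on (sphere 0 1) (\<lambda>x. X' x v)" for v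
    unfolding X'_def by (intro continuous_intros zonal_continuous_on zonal_deriv_continuous_on)
  have "(\<integral>x. (\<Sum>b\<in>Basis. X' x b \<bullet> b) - X' x x \<bullet> x - (real DIM('a) - 1) * (X x \<bullet> x) \<partial>sphere_measure) = 0"
    by (rule sphere_divergence_theorem[OF d c])
  also have "(\<integral>x. (\<Sum>b\<in>Basis. X' x b \<bullet> b) - X' x x \<bullet> x - (real DIM('a) - 1) * (X x \<bullet> x) \<partial>sphere_measure)
    = (\<integral>x. \<phi>' (sqdist Q x) * (2 * sqdist Q x - (sqdist Q x)\<^sup>2 / 2)
      + \<phi> (sqdist Q x) * (real DIM('a) - 1) * (1 - sqdist Q x / 2) \<partial>sphere_measure)"
  proof (rule Bochner_Integration.integral_cong[OF refl])
    fix x :: 'a assume "x \<in> space sphere_measure"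
    then have x: "x \<in> sphere 0 1" by simp
    note sq = sqdist_sphere[OF Q x]
    have "(\<Sum>b\<in>Basis. X' x b \<bullet> b) = \<phi>' (sqdist Q x) * 2 * (\<Sum>b\<in>Basis. ((x - Q) \<bullet> b) * ((x - Q) \<bullet> b)) + \<phi> (sqdist Q x) * (\<Sum>b\<in>Basis. ((b::'a) \<bullet> b))"
      unfolding X'_def by (simp add: inner_add_left sum.distrib sum_distrib_left mult.assoc)
    also have "\<dots> = \<phi>' (sqdist Q x) * 2 * sqdist Q x + \<phi> (sqdist Q x) * real DIM('a)"
      unfolding sum_inner_Basis by (simp add: sqdist_inner)
    finally have tr: "(\<Sum>b\<in>Basis. X' x b \<bullet> b) = \<phi>' (sqdist Q x) * 2 * sqdist Q x + \<phi> (sqdist Q x) * real DIM('a)" .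
    have 1: "X' x x \<bullet> x = \<phi>' (sqdist Q x) * (sqdist Q x)\<^sup>2 / 2 + \<phi> (sqdist Q x)"
      unfolding X'_def by (simp add: inner_add_left sq power2_eq_square)
    have 2: "X x \<bullet> x = \<phi> (sqdist Q x) * sqdist Q x / 2"
      unfolding X_def by (simp add: sq)
    show "(\<Sum>b\<in>Basis. X' x b \<bullet> b) - X' x x \<bullet> x - (real DIM('a) - 1) * (X x \<bullet> x)
      = \<phi>' (sqdist Q x) * (2 * sqdist Q x - (sqdist Q x)\<^sup>2 / 2)
      + \<phi> (sqdist Q x) * (real DIM('a) - 1) * (1 - sqdist Q x / 2)"
      unfolding tr 1 2 by (simp add: field_simps)
  qed
  finally show ?thesis .
qed

text \<open>The field \<open>Z\<close> is balanced so as to be tangential: on the sphere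
  \<open>(x - Q) \<bullet> x\<close> is half of \<open>sqdist Q x\<close>, and
  \<open>gradient Y x \<bullet> x\<close> is \<open>l * Y x\<close>. As \<open>Y\<close> is
  harmonic, its Hessian drops out of the trace, and only \<open>Y\<close> and its derivative in
  direction \<open>Q\<close> survive.\<close>

lemma zonal_divergence_harmonic:
  assumes Y: "Y \<in> spherical_harmonics l"
  shows "(\<integral>x. \<phi>' (sqdist Q x) * sqdist Q x * (real l * Y x + frechet_derivative Y (at x) Q)
      + \<phi> (sqdist Q x) * (real l * (real l + real DIM('a) - 2) * Y x - (real l - 1) * frechet_derivative Y (at x) Q) \<partial>sphere_measure) = 0"
proof -
  note pY = spherical_harmonics_poly[OF Y]
  note tY = twice_differentiable_poly[OF pY]
  note hY = spherical_harmonics_homogeneous[OF Y]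
  define D where "D x = frechet_derivative Y (at x) Q" for x
  define Z where "Z x = (real l * Y x) *\<^sub>R (x - Q) - (sqdist Q x / 2) *\<^sub>R gradient Y x" for x
  define Z' where "Z' x v = (real l * (gradient Y x \<bullet> v)) *\<^sub>R (x - Q) + (real l * Y x) *\<^sub>R v
     - ((x - Q) \<bullet> v) *\<^sub>R gradient Y x - (sqdist Q x / 2) *\<^sub>R gradient_derivative Y x v" for x v
  define X where "X x = \<phi> (sqdist Q x) *\<^sub>R Z x" for x
  define X' where "X' x v = (\<phi>' (sqdist Q x) * (2 * ((x - Q) \<bullet> v))) *\<^sub>R Z x + \<phi> (sqdist Q x) *\<^sub>R Z' x v" for x v
  have dZ: "(Z has_derivative Z' x) (at x)" if "x \<in> sphere 0 1" for x
  proof -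
    have x0: "x \<noteq> 0" using that by auto
    show ?thesis
      unfolding Z_def[abs_def] Z'_def[abs_def]
      by (auto intro!: derivative_eq_intros twice_differentiable_has_derivative[OF tY x0] sqdist_has_derivative
          gradient_has_derivative[OF tY x0] simp: algebra_simps diff_divide_distrib)
  qed
  have d: "(X has_derivative X' x) (at x)" if "x \<in> sphere 0 1" for x
    unfolding X_def[abs_def] X'_def[abs_def]
    by (auto intro!: derivative_eq_intros zonal_has_derivative dZ that simp: algebra_simps)
  have c: "continuous_on (sphere 0 1) (\<lambda>x. X' x v)" for v
    unfolding X'_def Z_def Z'_def
    by (intro continuous_intros zonal_continuous_on zonal_deriv_continuous_on spherical_harmonics_continuous[OF Y]
       continuous_on_gradient[OF tY] continuous_on_gradient_derivative[OF tY]) auto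
  have "(\<integral>x. (\<Sum>b\<in>Basis. X' x b \<bullet> b) - X' x x \<bullet> x - (real DIM('a) - 1) * (X x \<bullet> x) \<partial>sphere_measure) = 0"
    by (rule sphere_divergence_theorem[OF d c])
  also have "(\<integral>x. (\<Sum>b\<in>Basis. X' x b \<bullet> b) - X' x x \<bullet> x - (real DIM('a) - 1) * (X x \<bullet> x) \<partial>sphere_measure)
    = (\<integral>x. \<phi>' (sqdist Q x) * sqdist Q x * (real l * Y x + D x)
      + \<phi> (sqdist Q x) * (real l * (real l + real DIM('a) - 2) * Y x - (real l - 1) * D x) \<partial>sphere_measure)"
  proof (rule Bochner_Integration.integral_cong[OF refl])
    fix x :: 'a assume "x \<in> space sphere_measure"
    then have x: "x \<in> sphere 0 1" by simp
    then have x0: "x \<noteq> 0" by auto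
    note sq = sqdist_sphere[OF Q x]
    have gx: "gradient Y x \<bullet> x = real l * Y x" by (rule gradient_euler[OF tY hY x0])
    have gQ: "gradient Y x \<bullet> Q = D x"
      using gradient_inner[OF twice_differentiable_differentiable[OF tY x0]] by (simp add: D_def)
    have gxQ: "gradient Y x \<bullet> (x - Q) = real l * Y x - D x"
      by (simp add: inner_diff_right gx gQ)
    have Zx: "Z x \<bullet> x = 0"
      by (simp add: Z_def inner_diff_left[of "_ *\<^sub>R _"] sq gx)
    have ZxQ: "(x - Q) \<bullet> Z x = sqdist Q x * (real l * Y x + D x) / 2"
      unfolding Z_def inner_diff_right[of "x - Q" "(real l * Y x) *\<^sub>R (x - Q)"] inner_scaleR_right
        sqdist_inner[symmetric] inner_commute[of "x - Q" "gradient Y x"] gxQ by (simp add: field_simps)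
    have "(\<Sum>b\<in>Basis. X' x b \<bullet> b) = \<phi>' (sqdist Q x) * 2 * (\<Sum>b\<in>Basis. ((x - Q) \<bullet> b) * (Z x \<bullet> b)) + \<phi> (sqdist Q x) * (\<Sum>b\<in>Basis. (Z' x b \<bullet> b))"
      unfolding X'_def by (simp add: inner_add_left sum.distrib sum_distrib_left mult.assoc)
    also have "(\<Sum>b\<in>Basis. (Z' x b \<bullet> b)) = real l * (\<Sum>b\<in>Basis. (gradient Y x \<bullet> b) * ((x - Q) \<bullet> b)) + real l * Y x * (\<Sum>b\<in>Basis. (b::'a) \<bullet> b)
        - (\<Sum>b\<in>Basis. ((x - Q) \<bullet> b) * (gradient Y x \<bullet> b)) - sqdist Q x / 2 * (\<Sum>b\<in>Basis. gradient_derivative Y x b \<bullet> b)"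
      unfolding Z'_def by (simp add: inner_add_left inner_diff_left[of _ "_ *\<^sub>R _"] sum.distrib sum_subtractf sum_distrib_left mult.assoc)
    also have "\<dots> = real l * (real l * Y x - D x) + real l * Y x * real DIM('a) - (real l * Y x - D x)"
      unfolding sum_inner_Basis trace_gradient_derivative[OF tY] spherical_harmonics_laplacian[OF Y]
      by (simp add: gxQ inner_commute[of "x - Q" "gradient Y x"])
    finally have tr: "(\<Sum>b\<in>Basis. X' x b \<bullet> b) = \<phi>' (sqdist Q x) * sqdist Q x * (real l * Y x + D x)
        + \<phi> (sqdist Q x) * (real l * (real l * Y x - D x) + real l * Y x * real DIM('a) - (real l * Y x - D x))"
      unfolding sum_inner_Basis ZxQ by simp
    have "Z' x x \<bullet> x = real l * Y x"
      unfolding Z'_def by (simp add: inner_add_left inner_diff_left[of _ "_ *\<^sub>R _"] sq gx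
         gradient_derivative_euler[OF tY hY x0] algebra_simps)
    then have 1: "X' x x \<bullet> x = \<phi> (sqdist Q x) * (real l * Y x)"
      unfolding X'_def by (simp add: inner_add_left Zx)
    have 2: "X x \<bullet> x = 0"
      unfolding X_def by (simp add: Zx)
    show "(\<Sum>b\<in>Basis. X' x b \<bullet> b) - X' x x \<bullet> x - (real DIM('a) - 1) * (X x \<bullet> x)
      = \<phi>' (sqdist Q x) * sqdist Q x * (real l * Y x + D x)
      + \<phi> (sqdist Q x) * (real l * (real l + real DIM('a) - 2) * Y x - (real l - 1) * D x)"
      unfolding tr 1 2 by (simp add: algebra_simps)
  qed
  finally show ?thesis by (simp add: D_def)
qed

end

text \<open>The cone over a point lies in a line, which is negligible from dimension 2 on. Hence the
  conventional values of \<open>0 powr s\<close> and \<open>ln 0\<close> at the pole do not affect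
  any integral.\<close>

lemma sphere_measure_singleton:
  fixes Q :: "'a::euclidean_space"
  assumes "DIM('a) \<ge> 2"
  shows "AE x in sphere_measure. x \<noteq> Q"
proof (cases "Q \<in> sphere 0 1")
  case True
  have sets: "{Q} \<in> sets sphere_measure"
    using True by (simp add: sets_restrict_space_iff)
  let ?A = "{x \<in> ball 0 1 - {0}. sgn x \<in> {Q}}"
  have "?A \<subseteq> span {Q}"
  proof
    fix x assume "x \<in> ?A"
    then have "x = norm x *\<^sub>R Q" by (auto simp: sgn_div_norm)
    then show "x \<in> span {Q}" by (metis span_base span_mul singletonI)
  qed
  moreover have "negligible (span {Q})"
    by (rule negligible_lowdim) (use assms in \<open>auto simp: dim_span dim_insert\<close>)
  ultimately have "negligible ?A" by (rule negligible_subset[rotated])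
  moreover have "?A \<in> sets borel"
  proof -
    have [measurable]: "(sgn :: 'a \<Rightarrow> 'a) \<in> borel_measurable borel"
      unfolding sgn_div_norm[abs_def] by measurable
    show ?thesis by measurable
  qed
  ultimately have "emeasure lborel ?A = 0"
    using null_sets_completion_iff[of ?A lborel] by (simp add: negligible_iff_null_sets null_sets_def)
  then have "emeasure sphere_measure {Q} = 0"
    by (simp only: emeasure_sphere_measure[OF sets]) simp
  then show ?thesis
    using sets by (intro AE_I[of _ _ "{Q}"]) auto
qed (auto intro: AE_I2)

section \<open>Singular powers as limits of shifted powers\<close>

lemma shifted_powr_has_derivative:
  fixes s e t :: real
  assumes "e > 0" "t \<ge> 0"
  shows "((\<lambda>t. (t + e) powr s) has_real_derivative s * (t + e) powr (s - 1)) (at t)"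
  using assms by (auto intro!: derivative_eq_intros)

lemma shifted_powr_continuous:
  fixes s e :: real
  assumes "e > 0"
  shows "continuous_on {0..} (\<lambda>t. s * (t + e) powr (s - 1))"
  using assms by (auto intro!: continuous_intros)

lemma continuous_on_sqdist_shift:
  assumes "e > 0"
  shows "continuous_on A (\<lambda>x. (sqdist Q x + e) powr s)"
proof -
  have "sqdist Q x + e \<noteq> 0" for x using sqdist_nonneg[of Q x] assms by linarith
  then show ?thesis by (intro continuous_intros) auto
qed

text \<open>A majorant independent of \<open>e\<close> for both signs of \<open>s\<close>:
  increasing powers are bounded by their value at 5, an upper bound of \<open>w + e\<close>, and
  decreasing ones by their value at \<open>w\<close>.\<close>

lemma powr_bound_shift:
  fixes w e s :: real
  assumes "0 < e" "e \<le> 1" "0 \<le> w" "w \<le> 4" "w \<noteq> 0"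
  shows "(w + e) powr s \<le> w powr s + 5 powr s"
proof (cases "s \<ge> 0")
  case True
  then have "(w + e) powr s \<le> 5 powr s" using assms by (intro powr_mono2) auto
  then show ?thesis by (simp add: add_increasing)
next
  case False
  then have "(w + e) powr s \<le> w powr s" using assms by (intro powr_mono2') auto
  then show ?thesis by (simp add: add_increasing2)
qed

text \<open>The divergence identity bounds the integral at \<open>s\<close> by the one at
  \<open>s + 1\<close>, uniformly in \<open>e\<close>, as long as
  \<open>2 * s + (DIM('a) - 1)\<close> is positive, which is the assumption on \<open>s\<close>. The
  number \<open>m\<close> counts the steps after which the exponent is nonnegative and the integrand
  bounded.\<close>

lemma sqdist_powr_integral_bound:
  fixes Q :: "'a::euclidean_space"
  assumes Q: "Q \<in> sphere 0 1" and "- real m \<le> s" and s: "s > - (real DIM('a) - 1) / 2"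
  shows "\<exists>C. \<forall>e. 0 < e \<longrightarrow> e \<le> 1 \<longrightarrow> (\<integral>x. (sqdist Q x + e) powr s \<partial>sphere_measure) \<le> C"
  using assms(2,3)
proof (induction m arbitrary: s)
  case 0
  have "(\<integral>x. (sqdist Q x + e) powr s \<partial>sphere_measure) \<le> 5 powr s * sphere_volume TYPE('a)" if e: "0 < e" "e \<le> 1" for e
  proof -
    have "(\<integral>x. (sqdist Q x + e) powr s \<partial>sphere_measure) \<le> (\<integral>x. 5 powr s \<partial>(sphere_measure :: 'a measure))"
    proof (rule integral_mono_AE)
      show "AE x in sphere_measure. (sqdist Q x + e) powr s \<le> 5 powr s"
      proof (rule AE_I2)
        fix x :: 'a assume "x \<in> space sphere_measure"
        then have "sqdist Q x \<le> 4" using sqdist_le_4[OF Q] by simp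
        then show "(sqdist Q x + e) powr s \<le> 5 powr s"
          using 0 e sqdist_nonneg[of Q x] by (intro powr_mono2) auto
      qed
    qed (auto intro!: integrable_continuous_on_sphere continuous_on_sqdist_shift e)
    then show ?thesis by (simp only: integral_sphere_const)
  qed
  then show ?case by blast
next
  case (Suc m)
  let ?n = "real DIM('a) - 1"
  show ?case
  proof (cases "s \<ge> 0")
    case True
    then have "- real m \<le> s" by simp
    then show ?thesis using Suc by blast
  next
    case False
    obtain C where C: "\<And>e. 0 < e \<Longrightarrow> e \<le> 1 \<Longrightarrow> (\<integral>x. (sqdist Q x + e) powr (s + 1) \<partial>sphere_measure) \<le> C"
      using Suc.IH[of "s + 1"] Suc.prems by auto
    have pos: "2 * s + ?n > 0" using Suc.prems by simp
    have n0: "?n \<ge> 0" using DIM_positive[where 'a='a] by linarith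
    have "(\<integral>x. (sqdist Q x + e) powr s \<partial>sphere_measure) \<le> ?n / 2 * C / (2 * s + ?n)" if e: "0 < e" "e \<le> 1" for e
    proof -
      let ?v = "\<lambda>x. sqdist Q x + e"
      have i: "integrable sphere_measure (\<lambda>x. ?v x powr r)" for r
        by (intro integrable_continuous_on_sphere continuous_on_sqdist_shift e)
      have ci: "continuous_on (sphere 0 1) (\<lambda>x. ?v x powr r)" for r
        by (intro continuous_on_sqdist_shift e)
      have "(\<integral>x. (2 * s + ?n) * ?v x powr s - ?n / 2 * ?v x powr (s + 1) \<partial>sphere_measure)
         \<le> (\<integral>x. s * ?v x powr (s - 1) * (2 * sqdist Q x - (sqdist Q x)\<^sup>2 / 2) + ?v x powr s * ?n * (1 - sqdist Q x / 2) \<partial>sphere_measure)"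
      proof (rule integral_mono_AE)
        show "AE x in sphere_measure. (2 * s + ?n) * ?v x powr s - ?n / 2 * ?v x powr (s + 1)
          \<le> s * ?v x powr (s - 1) * (2 * sqdist Q x - (sqdist Q x)\<^sup>2 / 2) + ?v x powr s * ?n * (1 - sqdist Q x / 2)"
        proof (rule AE_I2)
          fix x :: 'a
          define w where "w = sqdist Q x"
          define p where "p = (w + e) powr (s - 1)"
          have w: "w \<ge> 0" by (simp add: w_def)
          have p: "p \<ge> 0" by (simp add: p_def)
          have ps: "(w + e) powr s = p * (w + e)"
            using w e by (simp add: p_def powr_diff)
          have ps1: "(w + e) powr (s + 1) = p * (w + e) * (w + e)"
            using w e by (simp add: powr_add ps)
          \<comment> \<open>This term and the next make up the difference of the two integrands that
            are compared; this one is nonnegative because \<open>s < 0\<close>.\<close>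
          have "p * (- s) * (2 * e + w\<^sup>2 / 2) \<ge> 0"
            using p False e w by (intro mult_nonneg_nonneg) auto
          moreover have "p * ?n * (w + e) * e / 2 \<ge> 0"
            using p n0 e w by (intro mult_nonneg_nonneg divide_nonneg_nonneg) auto
          ultimately have "0 \<le> p * (- s) * (2 * e + w\<^sup>2 / 2) + p * ?n * (w + e) * e / 2" by simp
          also have "\<dots> = (s * p * (2 * w - w\<^sup>2 / 2) + p * (w + e) * ?n * (1 - w / 2))
             - ((2 * s + ?n) * (p * (w + e)) - ?n / 2 * (p * (w + e) * (w + e)))"
            by (simp add: field_simps power2_eq_square)
          finally show "(2 * s + ?n) * ?v x powr s - ?n / 2 * ?v x powr (s + 1)
            \<le> s * ?v x powr (s - 1) * (2 * sqdist Q x - (sqdist Q x)\<^sup>2 / 2) + ?v x powr s * ?n * (1 - sqdist Q x / 2)"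
            unfolding w_def[symmetric] ps ps1 unfolding p_def[symmetric] by simp
        qed
      qed (intro integrable_continuous_on_sphere continuous_on_add continuous_on_diff continuous_on_mult
          continuous_on_const continuous_on_power continuous_on_sqdist continuous_on_divide ci; simp)+
      also have "\<dots> = 0"
        by (rule zonal_divergence_const[OF Q shifted_powr_has_derivative shifted_powr_continuous]) (use e in auto)
      also have "(\<integral>x. (2 * s + ?n) * ?v x powr s - ?n / 2 * ?v x powr (s + 1) \<partial>sphere_measure)
        = (2 * s + ?n) * (\<integral>x. ?v x powr s \<partial>sphere_measure) - ?n / 2 * (\<integral>x. ?v x powr (s + 1) \<partial>sphere_measure)"
        unfolding Bochner_Integration.integral_diff[OF integrable_mult_right[OF i] integrable_mult_right[OF i]] integral_mult_right_zero ..
      finally have "(2 * s + ?n) * (\<integral>x. ?v x powr s \<partial>sphere_measure) \<le> ?n / 2 * (\<integral>x. ?v x powr (s + 1) \<partial>sphere_measure)"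
        by simp
      also have "\<dots> \<le> ?n / 2 * C"
        using C[OF e] n0 by (intro mult_left_mono) auto
      finally show ?thesis using pos by (simp add: field_simps)
    qed
    then show ?thesis by blast
  qed
qed

lemma sqdist_powr_measurable [measurable]:
  "(\<lambda>x. sqdist Q x powr s) \<in> borel_measurable sphere_measure"
  unfolding measurable_cong_sets[OF sets_sphere_measure refl]
  by (rule measurable_restrict_space1) (simp add: sqdist_def[abs_def])

text \<open>Fatou's lemma for the shifts \<open>1 / (k + 1)\<close>, whose integrals are uniformly
  bounded.\<close>

lemma sqdist_powr_integrable:
  fixes Q :: "'a::euclidean_space"
  assumes Q: "Q \<in> sphere 0 1" and s: "s > - (real DIM('a) - 1) / 2"
  shows "integrable sphere_measure (\<lambda>x. sqdist Q x powr s)"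
proof -
  obtain m :: nat where "- s \<le> real m" using real_arch_simple by blast
  then obtain C where C: "\<And>e. 0 < e \<Longrightarrow> e \<le> 1 \<Longrightarrow> (\<integral>x. (sqdist Q x + e) powr s \<partial>sphere_measure) \<le> C"
    using sqdist_powr_integral_bound[OF Q _ s, of m] by auto
  define e where "e k = inverse (real (Suc k))" for k
  have e: "0 < e k" "e k \<le> 1" for k by (simp_all add: e_def field_simps)
  have e0: "e \<longlonglongrightarrow> 0" unfolding e_def[abs_def] by (rule LIMSEQ_inverse_real_of_nat)
  let ?f = "\<lambda>k x. ennreal ((sqdist Q x + e k) powr s)"
  have m: "?f k \<in> borel_measurable sphere_measure" for k
    using measurable_continuous_on_sphere[OF continuous_on_sqdist_shift[OF e(1)]] by measurable
  have le: "ennreal (sqdist Q x powr s) \<le> liminf (\<lambda>k. ?f k x)" for x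
  proof (cases "x = Q")
    \<comment> \<open>At the pole \<open>0 powr s\<close> is 0, so the inequality is trivial even
      for negative \<open>s\<close>.\<close>
    case True
    then show ?thesis by (simp add: sqdist_def)
  next
    case False
    then have "sqdist Q x + 0 \<noteq> 0" by simp
    then have "(\<lambda>k. (sqdist Q x + e k) powr s) \<longlonglongrightarrow> (sqdist Q x + 0) powr s"
      by (intro tendsto_intros e0) auto
    then have "(\<lambda>k. ?f k x) \<longlonglongrightarrow> ennreal (sqdist Q x powr s)"
      by (intro tendsto_ennrealI) simp
    from lim_imp_Liminf[OF sequentially_bot this] show ?thesis by simp
  qed
  have "(\<integral>\<^sup>+x. ennreal (sqdist Q x powr s) \<partial>sphere_measure) \<le> (\<integral>\<^sup>+x. liminf (\<lambda>k. ?f k x) \<partial>sphere_measure)"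
    by (intro nn_integral_mono le)
  also have "\<dots> \<le> liminf (\<lambda>k. \<integral>\<^sup>+x. ?f k x \<partial>sphere_measure)"
    by (rule nn_integral_liminf[OF m])
  also have "\<dots> \<le> liminf (\<lambda>k. ennreal C)"
  proof (intro Liminf_mono always_eventually allI)
    fix k
    have "(\<integral>\<^sup>+x. ?f k x \<partial>sphere_measure) = ennreal (\<integral>x. (sqdist Q x + e k) powr s \<partial>sphere_measure)"
      by (intro nn_integral_eq_integral integrable_continuous_on_sphere continuous_on_sqdist_shift[OF e(1)]) auto
    also have "\<dots> \<le> ennreal C" using C[OF e] by (rule ennreal_leI)
    finally show "(\<integral>\<^sup>+x. ?f k x \<partial>sphere_measure) \<le> ennreal C" .
  qed
  also have "\<dots> = ennreal C" by (simp add: Liminf_const)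
  also have "\<dots> < \<infinity>" by simp
  finally show ?thesis
    by (intro integrableI_nonneg sqdist_powr_measurable) auto
qed

text \<open>The singular kernel is the limit of smooth kernels: \<open>\<phi> t = (t + e) powr s\<close> satisfies
  \<open>t * \<phi>' t = s * (t / (t + e)) * \<phi> t\<close>.\<close>
lemma zonal_limit:
  fixes Q :: "'a::euclidean_space"
  assumes Q: "Q \<in> sphere 0 1" and s: "s > - (real DIM('a) - 1) / 2" and dim: "DIM('a) \<ge> 2"
    and a: "continuous_on (sphere 0 1) a" and b: "continuous_on (sphere 0 1) b"
    and zero: "\<And>e. 0 < e \<Longrightarrow> e \<le> 1 \<Longrightarrow>
      (\<integral>x. s * (sqdist Q x + e) powr (s - 1) * sqdist Q x * a x + (sqdist Q x + e) powr s * b x \<partial>sphere_measure) = 0"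
  shows "(\<integral>x. sqdist Q x powr s * (s * a x + b x) \<partial>sphere_measure) = 0"
proof -
  define e where "e k = inverse (real (Suc k))" for k
  have e: "0 < e k" "e k \<le> 1" for k by (simp_all add: e_def field_simps)
  have e0: "e \<longlonglongrightarrow> 0" unfolding e_def[abs_def] by (rule LIMSEQ_inverse_real_of_nat)
  obtain A where A: "A > 0" "\<And>x. x \<in> sphere 0 1 \<Longrightarrow> \<bar>a x\<bar> \<le> A"
    using bounded_continuous_on_sphere[OF a] by blast
  obtain B where B: "B > 0" "\<And>x. x \<in> sphere 0 1 \<Longrightarrow> \<bar>b x\<bar> \<le> B"
    using bounded_continuous_on_sphere[OF b] by blast
  have am: "a \<in> borel_measurable sphere_measure" "b \<in> borel_measurable sphere_measure"
    using a b by (auto intro: measurable_continuous_on_sphere)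
  let ?f = "\<lambda>k x. s * (sqdist Q x + e k) powr (s - 1) * sqdist Q x * a x + (sqdist Q x + e k) powr s * b x"
  have "(\<lambda>k. \<integral>x. ?f k x \<partial>sphere_measure) \<longlonglongrightarrow> (\<integral>x. sqdist Q x powr s * (s * a x + b x) \<partial>sphere_measure)"
  proof (rule integral_dominated_convergence)
    show "(\<lambda>x. sqdist Q x powr s * (s * a x + b x)) \<in> borel_measurable sphere_measure"
      using am by measurable
    show "?f k \<in> borel_measurable sphere_measure" for k
      by (intro measurable_continuous_on_sphere continuous_intros a b continuous_on_sqdist_shift[OF e(1)])
    show "integrable sphere_measure (\<lambda>x. (sqdist Q x powr s + 5 powr s) * (\<bar>s\<bar> * A + B))"
      by (intro integrable_mult_left Bochner_Integration.integrable_add sqdist_powr_integrable Q s integrable_sphere_const)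
    show "AE x in sphere_measure. (\<lambda>k. ?f k x) \<longlonglongrightarrow> sqdist Q x powr s * (s * a x + b x)"
      using sphere_measure_singleton[OF dim, of Q]
    proof eventually_elim
      case (elim x)
      then have nz: "sqdist Q x + 0 \<noteq> 0" by simp
      have "(\<lambda>k. ?f k x) \<longlonglongrightarrow> s * (sqdist Q x + 0) powr (s - 1) * sqdist Q x * a x + (sqdist Q x + 0) powr s * b x"
        by (intro tendsto_intros e0) (use nz in simp_all)
      also have "s * (sqdist Q x + 0) powr (s - 1) * sqdist Q x * a x + (sqdist Q x + 0) powr s * b x = sqdist Q x powr s * (s * a x + b x)"
        using nz by (simp add: powr_diff field_simps)
      finally show ?case .
    qed
    show "AE x in sphere_measure. norm (?f k x) \<le> (sqdist Q x powr s + 5 powr s) * (\<bar>s\<bar> * A + B)" for k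
      using sphere_measure_singleton[OF dim, of Q] AE_space
    proof eventually_elim
      case (elim x)
      define w where "w = sqdist Q x"
      have x: "x \<in> sphere 0 1" using elim by simp
      have w: "0 < w" "w \<le> 4"
        using elim sqdist_le_4[OF Q x] sqdist_nonneg[of Q x] by (auto simp: w_def less_le simp del: sqdist_nonneg)
      have v: "0 < w + e k" using w e[of k] by linarith
      have "?f k x = (w + e k) powr s * (s * (w / (w + e k)) * a x + b x)"
        unfolding w_def[symmetric] using v by (simp add: powr_diff field_simps)
      also have "norm \<dots> \<le> (w powr s + 5 powr s) * (\<bar>s\<bar> * A + B)"
        unfolding norm_mult
      proof (rule mult_mono)
        show "norm ((w + e k) powr s) \<le> w powr s + 5 powr s"
          using powr_bound_shift[OF e(1,2), of w k s] w by simp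
        have "\<bar>s * (w / (w + e k)) * a x\<bar> = \<bar>s\<bar> * (w / (w + e k)) * \<bar>a x\<bar>"
          using w v by (simp add: abs_mult)
        also have "\<dots> \<le> \<bar>s\<bar> * 1 * A"
          using w v e[of k] A(1) A(2)[OF x] by (intro mult_mono) auto
        finally have "\<bar>s * (w / (w + e k)) * a x\<bar> \<le> \<bar>s\<bar> * A" by (simp only: mult_1_right)
        from add_mono[OF this B(2)[OF x]]
        show "norm (s * (w / (w + e k)) * a x + b x) \<le> \<bar>s\<bar> * A + B"
          unfolding real_norm_def by (rule order_trans[OF abs_triangle_ineq])
      qed auto
      finally show ?case by (simp add: w_def)
    qed
  qed
  moreover have "(\<integral>x. ?f k x \<partial>sphere_measure) = 0" for k
    by (rule zero[OF e])
  ultimately show ?thesis by (simp add: LIMSEQ_const_iff)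
qed

section \<open>The volume of the sphere in terms of the Gamma function\<close>

lemma sphere_volume_Gamma:
  assumes n: "n = real DIM('a::euclidean_space) - 1" and dim: "DIM('a) \<ge> 2"
  shows "sphere_volume TYPE('a) = 2 * pi powr ((n + 1) / 2) / Gamma ((n + 1) / 2)"
proof -
  have pos: "n + 1 > 0" using dim by (simp add: n)
  then have "Gamma ((n + 1) / 2 + 1) = (n + 1) / 2 * Gamma ((n + 1) / 2)"
    by (intro Gamma_plus1) (auto elim!: nonpos_Ints_cases)
  moreover have "sphere_volume TYPE('a) = (n + 1) * (pi powr ((n + 1) / 2) / Gamma ((n + 1) / 2 + 1))"
    by (simp add: sphere_volume_eq unit_ball_vol_def n)
  moreover have "Gamma ((n + 1) / 2) > 0" using pos by (intro Gamma_real_pos) simp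
  ultimately show ?thesis using pos by (simp only:) (simp add: divide_simps)
qed

text \<open>Legendre's duplication formula at \<open>n / 2\<close> brings the volume into the shape
  that the integral of \<open>sqdist Q x powr s\<close> takes at \<open>s = 0\<close>. It fixes the
  constant in the Bohr-Mollerup argument and reconciles the two forms of the critical
  constant.\<close>

lemma sphere_volume_duplication:
  assumes n: "n = real DIM('a::euclidean_space) - 1" and dim: "DIM('a) \<ge> 2"
  shows "sphere_volume TYPE('a) * Gamma n = Gamma (n / 2) * (pi powr (n / 2) * 4 powr (n / 2))"
proof -
  have n0: "n > 0" using dim by (simp add: n)
  have "complex_of_real (Gamma (n / 2) * Gamma (n / 2 + 1 / 2))
      = complex_of_real (exp ((1 - 2 * (n / 2)) * ln 2) * sqrt pi * Gamma (2 * (n / 2)))"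
  proof -
    have npos: "complex_of_real x \<notin> \<int>\<^sub>\<le>\<^sub>0" if "x > 0" for x
    proof
      assume "complex_of_real x \<in> \<int>\<^sub>\<le>\<^sub>0"
      then obtain i where "complex_of_real x = of_int i" "i \<le> 0" by (auto elim!: nonpos_Ints_cases)
      then have "x = of_int i" by (metis of_real_eq_iff of_real_of_int_eq)
      with that \<open>i \<le> 0\<close> show False by simp
    qed
    show ?thesis
      using Gamma_legendre_duplication[OF npos[of "n / 2"]] npos[of "n / 2 + 1 / 2"] n0
      by (simp add: Gamma_complex_of_real[symmetric] exp_of_real[symmetric])
  qed
  then have "Gamma (n / 2) * Gamma (n / 2 + 1 / 2) = exp ((1 - 2 * (n / 2)) * ln 2) * sqrt pi * Gamma (2 * (n / 2))"
    by (simp only: of_real_eq_iff)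
  also have "exp ((1 - 2 * (n / 2)) * ln 2) = 2 * 2 powr (- n)"
    by (simp add: powr_def exp_diff exp_minus left_diff_distrib field_simps)
  also have "sqrt pi = pi powr (1 / 2)" by (simp add: powr_half_sqrt)
  finally have dup: "Gamma (n / 2) * Gamma ((n + 1) / 2) = 2 * 2 powr (- n) * pi powr (1 / 2) * Gamma n"
    by (simp add: add_divide_distrib)
  have "Gamma ((n + 1) / 2) > 0" using n0 by (intro Gamma_real_pos) simp
  have "4 powr (n / 2) = 2 powr n"
    using powr_powr[of 2 2 "n / 2"] by (simp add: powr_numeral)
  moreover have "2 powr n * 2 powr (- n) = (1::real)" by (simp add: powr_minus)
  moreover have "pi powr ((n + 1) / 2) = pi powr (n / 2) * pi powr (1 / 2)"
    by (simp add: powr_add[symmetric] add_divide_distrib)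
  ultimately have "2 * pi powr ((n + 1) / 2) * Gamma n = pi powr (n / 2) * 4 powr (n / 2) * (2 * 2 powr (- n) * pi powr (1 / 2) * Gamma n)"
    by (simp add: field_simps)
  then show ?thesis
    unfolding dup[symmetric] sphere_volume_Gamma[OF n dim] using \<open>Gamma ((n + 1) / 2) > 0\<close> by (simp add: field_simps)
qed

text \<open>Apply \<open>ln y \<le> y\<close> to \<open>w\<close> and to
  \<open>w powr (-1/2)\<close>. The exponent -1/2 lies above the integrability threshold
  \<open>- n / 2\<close> exactly for \<open>n > 1\<close>, so the logarithm is integrable on every
  sphere under consideration.\<close>

lemma abs_ln_bound:
  fixes w :: real
  assumes "w > 0"
  shows "\<bar>ln w\<bar> \<le> 2 * w powr (-1/2) + w"
proof -
  have "ln w \<le> w" using ln_le_minus_one[OF assms] by simp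
  moreover have "ln (w powr (-1/2)) \<le> w powr (-1/2)"
    using ln_le_minus_one[of "w powr (-1/2)"] assms by simp
  then have "- ln w \<le> 2 * w powr (-1/2)" using assms by (simp add: ln_powr)
  moreover have "w powr (-1/2) \<ge> 0" by simp
  ultimately show ?thesis using assms by linarith
qed

text \<open>The majorant for differentiating the power kernel at \<open>s = 0\<close>. With
  \<open>y = s * ln w\<close> one has \<open>y \<le> exp y - 1 \<le> y * exp y\<close>, and 4 bounds
  \<open>exp y = w powr s\<close> for \<open>w \<le> 4\<close> and \<open>s \<le> 1\<close>.\<close>

lemma powr_difference_quotient_bound:
  fixes w s :: real
  assumes w: "0 < w" "w \<le> 4" and s: "0 < s" "s \<le> 1"
  shows "\<bar>(w powr s - 1) / s\<bar> \<le> 4 * \<bar>ln w\<bar>"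
proof -
  define y where "y = s * ln w"
  have ey: "w powr s = exp y" using w by (simp add: powr_def y_def)
  have "w powr s \<le> 4 powr s" using w s by (intro powr_mono2) auto
  also have "\<dots> \<le> 4 powr 1" using s by (intro powr_mono) auto
  finally have e4: "exp y \<le> 4" by (simp add: ey)
  have "exp (- y) * exp y \<ge> (1 + - y) * exp y"
    using exp_ge_add_one_self[of "- y"] by (intro mult_right_mono) auto
  then have 1: "exp y - 1 \<le> y * exp y" by (simp add: exp_minus field_simps)
  have "y * exp y \<le> \<bar>y\<bar> * 4" using e4 by (intro mult_mono) auto
  moreover have "exp y - 1 \<ge> y" using exp_ge_add_one_self[of y] by linarith
  ultimately have "\<bar>exp y - 1\<bar> \<le> 4 * \<bar>y\<bar>" using 1 by linarith
  then show ?thesis using s by (simp add: ey y_def abs_mult field_simps)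
qed

section \<open>The total integral of a power kernel\<close>

definition zonal_mass :: "'a::euclidean_space \<Rightarrow> real \<Rightarrow> real" where
  "zonal_mass Q s = (\<integral>x. sqdist Q x powr s \<partial>sphere_measure)"

context
  fixes Q :: "'a::euclidean_space" and n :: real
  assumes Q: "Q \<in> sphere 0 1" and n: "n = real DIM('a) - 1" and dim: "DIM('a) \<ge> 2"
begin

lemma sqdist_integrable: "s > - n / 2 \<Longrightarrow> integrable sphere_measure (\<lambda>x. sqdist Q x powr s)"
  using sqdist_powr_integrable[OF Q] by (simp add: n)

lemma sqdist_mult_integrable:
  "s > - n / 2 \<Longrightarrow> continuous_on (sphere 0 1) f \<Longrightarrow> integrable sphere_measure (\<lambda>x. sqdist Q x powr s * f x)"
  by (intro integrable_mult_continuous_sphere sqdist_integrable)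

text \<open>The divergence identity of \<open>x - Q\<close> for shifted powers, with the shift sent
  to 0; a factor \<open>sqdist Q x\<close> left in the integrand raises the exponent by one.\<close>

lemma zonal_mass_recursion:
  assumes s: "s > - n / 2"
  shows "(s + n) * zonal_mass Q (s + 1) = 2 * (2 * s + n) * zonal_mass Q s"
proof -
  have "(\<integral>x. sqdist Q x powr s * (s * (2 - sqdist Q x / 2) + n * (1 - sqdist Q x / 2)) \<partial>sphere_measure) = 0"
  proof (rule zonal_limit[OF Q _ dim])
    show "s > - (real DIM('a) - 1) / 2" using s by (simp add: n)
    show "continuous_on (sphere 0 1) (\<lambda>x. 2 - sqdist Q x / 2)" "continuous_on (sphere 0 1) (\<lambda>x. n * (1 - sqdist Q x / 2))"
      by (intro continuous_intros; simp)+
    fix e :: real assume e: "0 < e"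
    have "(\<integral>x. s * (sqdist Q x + e) powr (s - 1) * (2 * sqdist Q x - (sqdist Q x)\<^sup>2 / 2)
      + (sqdist Q x + e) powr s * (real DIM('a) - 1) * (1 - sqdist Q x / 2) \<partial>sphere_measure) = 0"
      by (rule zonal_divergence_const[OF Q shifted_powr_has_derivative shifted_powr_continuous]) (use e in auto)
    also have "(\<lambda>x. s * (sqdist Q x + e) powr (s - 1) * (2 * sqdist Q x - (sqdist Q x)\<^sup>2 / 2)
      + (sqdist Q x + e) powr s * (real DIM('a) - 1) * (1 - sqdist Q x / 2))
      = (\<lambda>x. s * (sqdist Q x + e) powr (s - 1) * sqdist Q x * (2 - sqdist Q x / 2)
      + (sqdist Q x + e) powr s * (n * (1 - sqdist Q x / 2)))"
      by (rule ext) (simp add: n power2_eq_square field_simps)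
    finally show "(\<integral>x. s * (sqdist Q x + e) powr (s - 1) * sqdist Q x * (2 - sqdist Q x / 2)
      + (sqdist Q x + e) powr s * (n * (1 - sqdist Q x / 2)) \<partial>sphere_measure) = 0" .
  qed
  also have "(\<lambda>x. sqdist Q x powr s * (s * (2 - sqdist Q x / 2) + n * (1 - sqdist Q x / 2)))
    = (\<lambda>x. (2 * s + n) * sqdist Q x powr s - (s + n) / 2 * sqdist Q x powr (s + 1))"
  proof
    fix x
    have "sqdist Q x powr (s + 1) = sqdist Q x powr s * sqdist Q x"
      by (cases "sqdist Q x = 0") (auto simp: powr_add powr_one)
    then show "sqdist Q x powr s * (s * (2 - sqdist Q x / 2) + n * (1 - sqdist Q x / 2))
      = (2 * s + n) * sqdist Q x powr s - (s + n) / 2 * sqdist Q x powr (s + 1)"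
      by (simp add: field_simps)
  qed
  also have "(\<integral>x. (2 * s + n) * sqdist Q x powr s - (s + n) / 2 * sqdist Q x powr (s + 1) \<partial>sphere_measure)
     = (2 * s + n) * zonal_mass Q s - (s + n) / 2 * zonal_mass Q (s + 1)"
  proof -
    have "integrable sphere_measure (\<lambda>x. sqdist Q x powr s)" "integrable sphere_measure (\<lambda>x. sqdist Q x powr (s + 1))"
      using s by (auto intro: sqdist_integrable)
    note i = this
    show ?thesis
      unfolding zonal_mass_def Bochner_Integration.integral_diff[OF integrable_mult_right[OF i(1)] integrable_mult_right[OF i(2)]] integral_mult_right_zero ..
  qed
  finally show ?thesis by (simp add: field_simps)
qed

lemma zonal_mass_0: "zonal_mass Q 0 = sphere_volume TYPE('a)"
proof -
  have "zonal_mass Q 0 = (\<integral>x. 1 \<partial>(sphere_measure :: 'a measure))"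
    unfolding zonal_mass_def
  proof (rule integral_cong_AE[OF sqdist_powr_measurable])
    show "AE x in sphere_measure. sqdist Q x powr 0 = 1"
      using sphere_measure_singleton[OF dim, of Q] by eventually_elim simp
  qed simp
  then show ?thesis by (simp only: integral_sphere_const)
qed

lemma zonal_mass_pos:
  assumes s: "s > - n / 2"
  shows "zonal_mass Q s > 0"
proof -
  have "zonal_mass Q s \<noteq> 0"
  proof
    assume "zonal_mass Q s = 0"
    then have "AE x in sphere_measure. sqdist Q x powr s = 0"
      using integral_nonneg_eq_0_iff_AE[OF sqdist_integrable[OF s]] by (simp add: zonal_mass_def)
    with sphere_measure_singleton[OF dim, of Q] have "AE x in (sphere_measure :: 'a measure). False"
      by eventually_elim simp
    then have "(\<integral>x. 1 \<partial>(sphere_measure :: 'a measure)) = (0 :: real)"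
      by (intro integral_eq_zero_AE) simp
    then show False
      unfolding integral_sphere_const using sphere_volume_pos[where 'a = 'a] by simp
  qed
  moreover have "zonal_mass Q s \<ge> 0" by (simp add: zonal_mass_def)
  ultimately show ?thesis by simp
qed

text \<open>Hoelder's inequality in logarithmic form: convexity of \<open>exp\<close> bounds the
  interpolated power by the weighted mean of the normalised functions
  \<open>sqdist Q x powr a / A\<close> and \<open>sqdist Q x powr b / B\<close>, both of integral
  1.\<close>

lemma zonal_mass_log_convex:
  assumes a: "a > - n / 2" and b: "b > - n / 2" and t: "0 < t" "t < 1"
  shows "ln (zonal_mass Q ((1 - t) * a + t * b)) \<le> (1 - t) * ln (zonal_mass Q a) + t * ln (zonal_mass Q b)"
proof -
  define A where "A = zonal_mass Q a"
  define B where "B = zonal_mass Q b"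
  define c where "c = (1 - t) * a + t * b"
  define d where "d = (1 - t) * ln A + t * ln B"
  have AB: "A > 0" "B > 0" using zonal_mass_pos a b by (auto simp: A_def B_def)
  have "(1 - t) * (a + n / 2) > 0" "t * (b + n / 2) > 0"
    using a b t by (auto intro!: mult_pos_pos simp del: zero_less_mult_iff)
  then have "(1 - t) * (a + n / 2) + t * (b + n / 2) > 0" by (rule add_pos_pos)
  then have c: "c > - n / 2" by (simp add: c_def field_simps)
  have le: "sqdist Q x powr c * exp (- d) \<le> (1 - t) * (sqdist Q x powr a / A) + t * (sqdist Q x powr b / B)" for x
  proof (cases "sqdist Q x = 0")
    case False
    then have w: "sqdist Q x > 0" by (simp add: less_le)
    have "exp ((1 - t) *\<^sub>R (a * ln (sqdist Q x) - ln A) + t *\<^sub>R (b * ln (sqdist Q x) - ln B))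
       \<le> (1 - t) * exp (a * ln (sqdist Q x) - ln A) + t * exp (b * ln (sqdist Q x) - ln B)"
      using t by (intro convex_onD[OF exp_convex]) auto
    also have "exp (a * ln (sqdist Q x) - ln A) = sqdist Q x powr a / A"
      using False AB by (simp add: powr_def exp_diff)
    also have "exp (b * ln (sqdist Q x) - ln B) = sqdist Q x powr b / B"
      using False AB by (simp add: powr_def exp_diff)
    also have "(1 - t) *\<^sub>R (a * ln (sqdist Q x) - ln A) + t *\<^sub>R (b * ln (sqdist Q x) - ln B) = c * ln (sqdist Q x) - d"
      by (simp add: c_def d_def algebra_simps)
    also have "exp (c * ln (sqdist Q x) - d) = sqdist Q x powr c * exp (- d)"
      using False by (simp add: powr_def exp_diff exp_minus field_simps)
    finally show ?thesis .
  qed (simp add: sqdist_def)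
  have ia: "integrable sphere_measure (\<lambda>x. (1 - t) * (sqdist Q x powr a / A))"
    and ib: "integrable sphere_measure (\<lambda>x. t * (sqdist Q x powr b / B))"
    by (intro integrable_mult_right integrable_divide sqdist_integrable a b)+
  have "zonal_mass Q c * exp (- d) = (\<integral>x. sqdist Q x powr c * exp (- d) \<partial>sphere_measure)"
    by (simp add: zonal_mass_def)
  also have "\<dots> \<le> (\<integral>x. (1 - t) * (sqdist Q x powr a / A) + t * (sqdist Q x powr b / B) \<partial>sphere_measure)"
    by (intro integral_mono integrable_mult_left Bochner_Integration.integrable_add sqdist_integrable c ia ib le)
  also have "\<dots> = (1 - t) * (A / A) + t * (B / B)"
    unfolding Bochner_Integration.integral_add[OF ia ib] by (simp add: A_def B_def zonal_mass_def)
  also have "\<dots> = 1" using AB by simp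
  finally have "zonal_mass Q c \<le> exp d"
    by (simp add: exp_minus field_simps)
  then have "ln (zonal_mass Q c) \<le> d"
    using zonal_mass_pos[OF c] by (simp add: ln_le_cancel_iff[symmetric, of _ "exp d"])
  then show ?thesis by (simp add: c_def d_def A_def B_def)
qed

text \<open>By the Bohr-Mollerup theorem: the Gamma quotient is the only log-convex solution of the recursion.\<close>
theorem zonal_mass_eq:
  assumes s: "s > - n / 2"
  shows "zonal_mass Q s = pi powr (n / 2) * 4 powr (s + n / 2) * Gamma (s + n / 2) / Gamma (s + n)"
proof -
  have n0: "n > 0" using dim by (simp add: n)
  \<comment> \<open>The shift moves the threshold to 0, and the two further factors turn the
    recursion into \<open>g (x + 1) = x * g x\<close>. They preserve log-convexity, since Gamma is
    log-convex and \<open>4 powr (- x)\<close> is log-affine.\<close>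
  define g where "g x = zonal_mass Q (x - n / 2) * Gamma (x + n / 2) * 4 powr (- x)" for x
  have gpos: "g x > 0" if "x > 0" for x
    using that n0 by (auto simp: g_def intro!: mult_pos_pos zonal_mass_pos Gamma_real_pos)
  have g1: "g (x + 1) = x * g x" if x: "x > 0" for x
  proof -
    have rec: "(x + n / 2) * zonal_mass Q (x - n / 2 + 1) = 4 * x * zonal_mass Q (x - n / 2)"
      using zonal_mass_recursion[of "x - n / 2"] x by (simp add: algebra_simps)
    have "Gamma (x + n / 2 + 1) = (x + n / 2) * Gamma (x + n / 2)"
      using x n0 by (intro Gamma_plus1) (auto elim!: nonpos_Ints_cases)
    moreover have "4 powr (- (x + 1)) = 4 powr (- x) / (4 :: real)"
      using powr_add[of "4 :: real" "- x" "- 1"] by (simp add: powr_minus)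
    moreover have "x + 1 - n / 2 = x - n / 2 + 1" "x + 1 + n / 2 = x + n / 2 + 1" by simp_all
    ultimately have "g (x + 1) = ((x + n / 2) * zonal_mass Q (x - n / 2 + 1)) * Gamma (x + n / 2) * (4 powr (- x) / 4)"
      unfolding g_def by (simp only: mult_ac)
    also have "\<dots> = x * g x" unfolding rec g_def by simp
    finally show ?thesis .
  qed
  have "convex_on {0<..} (ln \<circ> (\<lambda>x. g x / g 1))"
  proof (rule convex_onI)
    fix t x y :: real assume t: "0 < t" "t < 1" and "x \<in> {0<..}" "y \<in> {0<..}"
    then have xy: "x > 0" "y > 0" by auto
    define z where "z = (1 - t) * x + t * y"
    have z: "z > 0" using xy t by (auto simp: z_def intro!: add_pos_pos)
    have lng: "ln (g u / g 1) = ln (zonal_mass Q (u - n / 2)) + ln (Gamma (u + n / 2)) - u * ln 4 - ln (g 1)" if u: "u > 0" for u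
    proof -
      have "zonal_mass Q (u - n / 2) > 0" "Gamma (u + n / 2) > 0"
        using u n0 by (auto intro!: zonal_mass_pos Gamma_real_pos)
      then have "ln (g u) = ln (zonal_mass Q (u - n / 2)) + ln (Gamma (u + n / 2)) - u * ln 4"
        unfolding g_def by (simp add: ln_mult ln_powr)
      moreover have "ln (g u / g 1) = ln (g u) - ln (g 1)"
        using gpos[OF u] gpos[of 1] by (simp add: ln_div)
      ultimately show ?thesis by simp
    qed
    have 1: "ln (zonal_mass Q (z - n / 2)) \<le> (1 - t) * ln (zonal_mass Q (x - n / 2)) + t * ln (zonal_mass Q (y - n / 2))"
    proof -
      have "z - n / 2 = (1 - t) * (x - n / 2) + t * (y - n / 2)" by (simp add: z_def field_simps)
      then show ?thesis using zonal_mass_log_convex[of "x - n / 2" "y - n / 2" t] xy t by simp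
    qed
    have z': "z + n / 2 = (1 - t) * (x + n / 2) + t * (y + n / 2)" by (simp add: z_def field_simps)
    have "(ln \<circ> Gamma) ((1 - t) *\<^sub>R (x + n / 2) + t *\<^sub>R (y + n / 2)) \<le> (1 - t) * (ln \<circ> Gamma) (x + n / 2) + t * (ln \<circ> Gamma) (y + n / 2)"
      using xy n0 t by (intro convex_onD[OF log_convex_Gamma_real]) auto
    then have 2: "ln (Gamma (z + n / 2)) \<le> (1 - t) * ln (Gamma (x + n / 2)) + t * ln (Gamma (y + n / 2))"
      by (simp add: z')
    have "(ln \<circ> (\<lambda>x. g x / g 1)) ((1 - t) *\<^sub>R x + t *\<^sub>R y) = ln (g z / g 1)" by (simp add: z_def)
    also have "\<dots> = ln (zonal_mass Q (z - n / 2)) + ln (Gamma (z + n / 2)) - z * ln 4 - ln (g 1)"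
      by (rule lng[OF z])
    also have "\<dots> \<le> ((1 - t) * ln (zonal_mass Q (x - n / 2)) + t * ln (zonal_mass Q (y - n / 2)))
      + ((1 - t) * ln (Gamma (x + n / 2)) + t * ln (Gamma (y + n / 2))) - z * ln 4 - ln (g 1)"
      using 1 2 by linarith
    also have "\<dots> = (1 - t) * ln (g x / g 1) + t * ln (g y / g 1)"
      unfolding lng[OF xy(1)] lng[OF xy(2)] by (simp add: z_def algebra_simps)
    finally show "(ln \<circ> (\<lambda>x. g x / g 1)) ((1 - t) *\<^sub>R x + t *\<^sub>R y)
      \<le> (1 - t) * (ln \<circ> (\<lambda>x. g x / g 1)) x + t * (ln \<circ> (\<lambda>x. g x / g 1)) y" by simp
  qed simp
  note conv = this
  have g1nz: "g 1 \<noteq> 0" using gpos[of 1] by simp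
  have G: "g x / g 1 = Gamma x" if "x > 0" for x
    using g1nz g1 gpos[of 1] gpos that conv by (intro Gamma_pos_real_unique[of "\<lambda>x. g x / g 1"]) auto
  have g1': "g x = g 1 * Gamma x" if "x > 0" for x
    using G[OF that] gpos[of 1] by (simp add: field_simps)
  \<comment> \<open>The remaining constant is read off at \<open>x = n / 2\<close>, that is at
    exponent 0, where the mass is the volume.\<close>
  have "g (n / 2) = sphere_volume TYPE('a) * Gamma n * 4 powr (- (n / 2))"
    by (simp add: g_def zonal_mass_0)
  also have "\<dots> = Gamma (n / 2) * pi powr (n / 2)"
    unfolding sphere_volume_duplication[OF n dim] by (simp add: powr_minus field_simps)
  finally have "g 1 = pi powr (n / 2)"
    using g1'[of "n / 2"] order_less_imp_not_eq2[OF Gamma_real_pos[of "n / 2"]] n0 by simp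
  then have "g (s + n / 2) = pi powr (n / 2) * Gamma (s + n / 2)"
    using g1'[of "s + n / 2"] s by simp
  moreover have "g (s + n / 2) = zonal_mass Q s * Gamma (s + n) * 4 powr (- (s + n / 2))"
    by (simp add: g_def add.assoc)
  ultimately have "zonal_mass Q s * Gamma (s + n) = pi powr (n / 2) * Gamma (s + n / 2) * 4 powr (s + n / 2)"
    by (simp add: powr_minus field_simps)
  moreover have "Gamma (s + n) > 0" using s n0 by (intro Gamma_real_pos) linarith
  ultimately show ?thesis by (simp add: field_simps)
qed

section \<open>The Funk-Hecke formula for power kernels\<close>

lemma funk_hecke_recursion:
  assumes s: "s > - n / 2" and Y: "Y \<in> spherical_harmonics l"
  shows "real l * (real l + n - 1 + s) * (\<integral>x. sqdist Q x powr s * Y x \<partial>sphere_measure)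
     = (real l - 1 - s) * (\<integral>x. sqdist Q x powr s * frechet_derivative Y (at x) Q \<partial>sphere_measure)"
proof -
  let ?D = "\<lambda>x. frechet_derivative Y (at x) Q"
  have cD: "continuous_on (sphere 0 1) ?D"
    by (rule spherical_harmonics_continuous[OF spherical_harmonics_dir_deriv[OF Y]])
  have cY: "continuous_on (sphere 0 1) Y" by (rule spherical_harmonics_continuous[OF Y])
  have "(\<integral>x. sqdist Q x powr s * (s * (real l * Y x + ?D x) + (real l * (real l + real DIM('a) - 2) * Y x - (real l - 1) * ?D x)) \<partial>sphere_measure) = 0"
  proof (rule zonal_limit[OF Q _ dim])
    show "s > - (real DIM('a) - 1) / 2" using s by (simp add: n)
    show "continuous_on (sphere 0 1) (\<lambda>x. real l * Y x + ?D x)"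
      "continuous_on (sphere 0 1) (\<lambda>x. real l * (real l + real DIM('a) - 2) * Y x - (real l - 1) * ?D x)"
      by (intro continuous_intros cD cY)+
    fix e :: real assume e: "0 < e"
    show "(\<integral>x. s * (sqdist Q x + e) powr (s - 1) * sqdist Q x * (real l * Y x + ?D x)
      + (sqdist Q x + e) powr s * (real l * (real l + real DIM('a) - 2) * Y x - (real l - 1) * ?D x) \<partial>sphere_measure) = 0"
      by (rule zonal_divergence_harmonic[OF Q shifted_powr_has_derivative shifted_powr_continuous Y]) (use e in auto)
  qed
  also have "(\<lambda>x. sqdist Q x powr s * (s * (real l * Y x + ?D x) + (real l * (real l + real DIM('a) - 2) * Y x - (real l - 1) * ?D x)))
    = (\<lambda>x. real l * (real l + n - 1 + s) * (sqdist Q x powr s * Y x) - (real l - 1 - s) * (sqdist Q x powr s * ?D x))"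
    by (rule ext) (simp add: n algebra_simps)
  also have "(\<integral>x. real l * (real l + n - 1 + s) * (sqdist Q x powr s * Y x) - (real l - 1 - s) * (sqdist Q x powr s * ?D x) \<partial>sphere_measure)
    = real l * (real l + n - 1 + s) * (\<integral>x. sqdist Q x powr s * Y x \<partial>sphere_measure)
     - (real l - 1 - s) * (\<integral>x. sqdist Q x powr s * ?D x \<partial>sphere_measure)"
    unfolding Bochner_Integration.integral_diff[OF integrable_mult_right[OF sqdist_mult_integrable[OF s cY]]
      integrable_mult_right[OF sqdist_mult_integrable[OF s cD]]] integral_mult_right_zero ..
  finally show ?thesis by simp
qed

text \<open>At degree \<open>Suc l\<close> the recursion replaces \<open>Y\<close> by its derivative
  in direction \<open>Q\<close>, of degree \<open>l\<close>. By Euler's identity that derivative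
  takes the value \<open>Suc l * Y Q\<close> at \<open>Q\<close>, and the factor
  \<open>Suc l\<close> cancels. What is divided by is \<open>n + s + l\<close>, positive for all
  admissible \<open>s\<close>.\<close>

theorem funk_hecke:
  assumes s: "s > - n / 2" and Y: "Y \<in> spherical_harmonics l"
  shows "(\<integral>x. sqdist Q x powr s * Y x \<partial>sphere_measure)
     = zonal_mass Q s * (pochhammer (- s) l / pochhammer (n + s) l) * Y Q"
  using Y
proof (induction l arbitrary: Y)
  case 0
  have "Y x = Y Q" for x
    using spherical_harmonics_0_const[OF 0] by metis
  then have "Y = (\<lambda>x. Y Q)" by auto
  then have "(\<integral>x. sqdist Q x powr s * Y x \<partial>sphere_measure) = (\<integral>x. sqdist Q x powr s * Y Q \<partial>sphere_measure)"
    by metis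
  then show ?case by (simp add: zonal_mass_def)
next
  case (Suc l)
  let ?D = "\<lambda>x. frechet_derivative Y (at x) Q"
  have n0: "n > 0" using dim by (simp add: n)
  have pos: "n + s + real l > 0" using s n0 by linarith
  have Q0: "Q \<noteq> 0" using Q by auto
  have "?D \<in> spherical_harmonics l"
    using spherical_harmonics_dir_deriv[OF Suc.prems, of Q] by simp
  note IH = Suc.IH[OF this]
  have DQ: "?D Q = real (Suc l) * Y Q"
    by (rule homogeneous_euler[OF spherical_harmonics_homogeneous[OF Suc.prems]
        differentiable_at_real_polynomial_function[OF spherical_harmonics_poly[OF Suc.prems]] Q0])
  have "real (Suc l) * (real (Suc l) + n - 1 + s) * (\<integral>x. sqdist Q x powr s * Y x \<partial>sphere_measure)
    = (real (Suc l) - 1 - s) * (zonal_mass Q s * (pochhammer (- s) l / pochhammer (n + s) l) * (real (Suc l) * Y Q))"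
    using funk_hecke_recursion[OF s Suc.prems] unfolding IH DQ .
  then have "real (Suc l) * ((n + s + real l) * (\<integral>x. sqdist Q x powr s * Y x \<partial>sphere_measure))
    = real (Suc l) * ((- s + real l) * (zonal_mass Q s * (pochhammer (- s) l / pochhammer (n + s) l) * Y Q))"
    by (simp only: of_nat_Suc) (simp add: algebra_simps)
  then have "(n + s + real l) * (\<integral>x. sqdist Q x powr s * Y x \<partial>sphere_measure)
    = (- s + real l) * (zonal_mass Q s * (pochhammer (- s) l / pochhammer (n + s) l) * Y Q)"
    by (rule mult_left_cancel[THEN iffD1, rotated]) simp
  then have "(\<integral>x. sqdist Q x powr s * Y x \<partial>sphere_measure)
    = (- s + real l) * (zonal_mass Q s * (pochhammer (- s) l / pochhammer (n + s) l) * Y Q) / (n + s + real l)"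
    using pos by (metis less_irrefl nonzero_mult_div_cancel_left)
  then show ?case
    by (simp add: pochhammer_Suc mult_ac)
qed

section \<open>The logarithmic kernel\<close>

lemma ln_sqdist_measurable: "(\<lambda>x. ln (sqdist Q x)) \<in> borel_measurable sphere_measure"
  unfolding measurable_cong_sets[OF sets_sphere_measure refl]
  by (rule measurable_restrict_space1) (simp add: sqdist_def[abs_def])

lemma ln_sqdist_integrable:
  assumes "n > 1"
  shows "integrable sphere_measure (\<lambda>x. ln (sqdist Q x))"
proof (rule Bochner_Integration.integrable_bound)
  show "integrable sphere_measure (\<lambda>x. 2 * sqdist Q x powr (-1/2) + sqdist Q x)"
    using assms by (intro Bochner_Integration.integrable_add integrable_mult_right sqdist_integrable
        integrable_continuous_on_sphere continuous_on_sqdist) simp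
  show "AE x in sphere_measure. norm (ln (sqdist Q x)) \<le> norm (2 * sqdist Q x powr (-1/2) + sqdist Q x)"
    using sphere_measure_singleton[OF dim, of Q]
  proof eventually_elim
    case (elim x)
    then have "sqdist Q x > 0" by (simp add: less_le)
    from abs_ln_bound[OF this] show ?case by simp
  qed
qed (rule ln_sqdist_measurable)

text \<open>The limit of \<open>(sqdist Q x powr s - 1) / s\<close> for
  \<open>s = 1 / (k + 1)\<close>. Subtracting 1 is harmless because harmonics of positive degree
  have mean zero, and the factor \<open>- s\<close> of \<open>pochhammer (- s) (Suc m)\<close>
  cancels the denominator; everything else is continuous at \<open>s = 0\<close>.\<close>

theorem funk_hecke_ln:
  assumes n1: "n > 1" and Y: "Y \<in> spherical_harmonics (Suc m)"
  shows "(\<integral>x. ln (sqdist Q x) * Y x \<partial>sphere_measure)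
     = - sphere_volume TYPE('a) * (fact m / pochhammer n (Suc m)) * Y Q"
proof -
  define s where "s k = inverse (real (Suc k))" for k
  have s: "0 < s k" "s k \<le> 1" for k by (simp_all add: s_def field_simps)
  have s0: "s \<longlonglongrightarrow> 0" unfolding s_def[abs_def] by (rule LIMSEQ_inverse_real_of_nat)
  have sn: "s k > - n / 2" for k using s[of k] n1 by simp
  have cY: "continuous_on (sphere 0 1) Y" by (rule spherical_harmonics_continuous[OF Y])
  obtain B where B: "B > 0" "\<And>x. x \<in> sphere 0 1 \<Longrightarrow> \<bar>Y x\<bar> \<le> B"
    using bounded_continuous_on_sphere[OF cY] by blast
  have Ym: "Y \<in> borel_measurable sphere_measure" using cY by (rule measurable_continuous_on_sphere)
  let ?f = "\<lambda>k x. (sqdist Q x powr s k - 1) / s k * Y x"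
  have lim1: "(\<lambda>k. \<integral>x. ?f k x \<partial>sphere_measure) \<longlonglongrightarrow> (\<integral>x. ln (sqdist Q x) * Y x \<partial>sphere_measure)"
  proof (rule integral_dominated_convergence)
    show "(\<lambda>x. ln (sqdist Q x) * Y x) \<in> borel_measurable sphere_measure"
      using ln_sqdist_measurable Ym by measurable
    show "?f k \<in> borel_measurable sphere_measure" for k
      using Ym by measurable
    show "integrable sphere_measure (\<lambda>x. 4 * \<bar>ln (sqdist Q x)\<bar> * B)"
      using ln_sqdist_integrable[OF n1] by simp
    show "AE x in sphere_measure. (\<lambda>k. ?f k x) \<longlonglongrightarrow> ln (sqdist Q x) * Y x"
      using sphere_measure_singleton[OF dim, of Q]
    proof eventually_elim
      case (elim x)
      then have w: "sqdist Q x > 0" by (simp add: less_le)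
      have "((\<lambda>r. sqdist Q x powr r) has_real_derivative ln (sqdist Q x)) (at 0)"
        using w elim by (auto intro!: derivative_eq_intros)
      then have "((\<lambda>r. (sqdist Q x powr r - 1) / r) \<longlongrightarrow> ln (sqdist Q x)) (at 0)"
        using elim by (simp add: has_field_derivative_iff)
      moreover have "filterlim s (at 0) sequentially"
        using s0 s(1) by (auto simp: filterlim_at less_imp_neq[symmetric])
      ultimately have "(\<lambda>k. (sqdist Q x powr s k - 1) / s k) \<longlonglongrightarrow> ln (sqdist Q x)"
        by (rule filterlim_compose)
      then show ?case by (intro tendsto_mult tendsto_const)
    qed
    show "AE x in sphere_measure. norm (?f k x) \<le> 4 * \<bar>ln (sqdist Q x)\<bar> * B" for k
      using sphere_measure_singleton[OF dim, of Q] AE_space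
    proof eventually_elim
      case (elim x)
      then have x: "x \<in> sphere 0 1" and w: "sqdist Q x > 0" by (auto simp: less_le)
      show ?case
        unfolding norm_mult using powr_difference_quotient_bound[OF w sqdist_le_4[OF Q x] s] B(2)[OF x]
        by (intro mult_mono) auto
    qed
  qed
  have const: "(\<integral>x. Y x \<partial>sphere_measure) = 0"
    using spherical_harmonics_orthogonal[OF Y spherical_harmonics_const[of 1] _ dim] by simp
  have val: "(\<integral>x. ?f k x \<partial>sphere_measure)
     = - (zonal_mass Q (s k) * (pochhammer (1 - s k) m / pochhammer (n + s k) (Suc m)) * Y Q)" for k
  proof -
    have "(\<integral>x. ?f k x \<partial>sphere_measure) = (\<integral>x. (1 / s k) * (sqdist Q x powr s k * Y x) - (1 / s k) * Y x \<partial>sphere_measure)"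
      by (rule Bochner_Integration.integral_cong) (auto simp: diff_divide_distrib left_diff_distrib)
    also have "\<dots> = (1 / s k) * (\<integral>x. sqdist Q x powr s k * Y x \<partial>sphere_measure) - (1 / s k) * (\<integral>x. Y x \<partial>sphere_measure)"
      unfolding Bochner_Integration.integral_diff[OF integrable_mult_right[OF sqdist_mult_integrable[OF sn cY]]
         integrable_mult_right[OF integrable_continuous_on_sphere[OF cY]]] integral_mult_right_zero ..
    also have "\<dots> = (1 / s k) * (zonal_mass Q (s k) * (pochhammer (- s k) (Suc m) / pochhammer (n + s k) (Suc m)) * Y Q)"
      unfolding const funk_hecke[OF sn Y] by simp
    also have "pochhammer (- s k) (Suc m) = - s k * pochhammer (1 - s k) m"
      by (simp only: pochhammer_rec) simp
    finally show ?thesis using s(1)[of k] by simp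
  qed
  have lim2: "(\<lambda>k. \<integral>x. ?f k x \<partial>sphere_measure) \<longlonglongrightarrow> - (zonal_mass Q 0 * (pochhammer (1 - 0) m / pochhammer (n + 0) (Suc m)) * Y Q)"
    unfolding val
  proof (intro tendsto_minus tendsto_mult tendsto_divide tendsto_const)
    have npos: "0 + n / 2 \<notin> \<int>\<^sub>\<le>\<^sub>0" "0 + n \<notin> \<int>\<^sub>\<le>\<^sub>0" using n1 by (auto elim!: nonpos_Ints_cases)
    have "0 > - n / 2" using n1 by simp
    show "(\<lambda>k. zonal_mass Q (s k)) \<longlonglongrightarrow> zonal_mass Q 0"
      unfolding zonal_mass_eq[OF sn] zonal_mass_eq[OF \<open>0 > - n / 2\<close>]
      using npos by (intro tendsto_intros s0) (auto simp: Gamma_eq_zero_iff)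
    show "(\<lambda>k. pochhammer (1 - s k) m) \<longlonglongrightarrow> pochhammer (1 - 0) m"
      "(\<lambda>k. pochhammer (n + s k) (Suc m)) \<longlonglongrightarrow> pochhammer (n + 0) (Suc m)"
      unfolding pochhammer_prod by (intro tendsto_prod tendsto_intros s0)+
    show "pochhammer (n + 0) (Suc m) \<noteq> 0"
      using pochhammer_pos[of n "Suc m"] n1 by simp
  qed
  from LIMSEQ_unique[OF lim1 lim2] show ?thesis
    by (simp add: zonal_mass_0 pochhammer_fact)
qed

end

section \<open>Expansion in spherical harmonics\<close>

text \<open>Each quotient of factors is in absolute value at most \<open>1 + p / (j + 1)\<close>, by
  Bernoulli's inequality at most \<open>((j + 2) / (j + 1)) ^ p\<close>, and these bounds telescope.
  As \<open>M\<close> bounds \<open>(j + 1) / (b + j)\<close> in absolute value for all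
  \<open>j\<close>, negative \<open>b\<close> are covered.\<close>

lemma pochhammer_ratio_growth:
  fixes a b :: real
  assumes b: "\<And>j. b + real j \<noteq> 0"
  shows "\<exists>p. \<forall>l. \<bar>pochhammer a l / pochhammer b l\<bar> \<le> real (Suc l) ^ p"
proof -
  have "filterlim (\<lambda>j. b + real j) at_infinity sequentially"
    by (intro filterlim_at_top_imp_at_infinity filterlim_tendsto_add_at_top[OF tendsto_const] filterlim_real_sequentially)
  then have "(\<lambda>j. 1 + (1 - b) / (b + real j)) \<longlonglongrightarrow> 1 + 0"
    by (intro tendsto_add tendsto_const tendsto_divide_0[OF tendsto_const])
  also have "(\<lambda>j. 1 + (1 - b) / (b + real j)) = (\<lambda>j. real (Suc j) / (b + real j))"
    using b by (auto simp: field_simps)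
  finally have "(\<lambda>j. real (Suc j) / (b + real j)) \<longlonglongrightarrow> 1" by simp
  then have "Bseq (\<lambda>j. real (Suc j) / (b + real j))"
    using convergentI convergent_imp_Bseq by blast
  then obtain M where M: "M > 0" "\<And>j. \<bar>real (Suc j) / (b + real j)\<bar> \<le> M"
    by (auto simp: Bseq_def)
  define p where "p = nat \<lceil>\<bar>a - b\<bar> * M\<rceil>"
  have p: "\<bar>a - b\<bar> * M \<le> real p" unfolding p_def by (rule real_nat_ceiling_ge)
  have step: "\<bar>(a + real j) / (b + real j)\<bar> \<le> (real (Suc (Suc j)) / real (Suc j)) ^ p" for j
  proof -
    have "(a + real j) / (b + real j) = 1 + (a - b) / (b + real j)"
      using b[of j] by (simp add: field_simps)
    then have "\<bar>(a + real j) / (b + real j)\<bar> \<le> 1 + \<bar>a - b\<bar> / \<bar>b + real j\<bar>"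
      using abs_triangle_ineq[of 1 "(a - b) / (b + real j)"] by (simp add: abs_divide)
    also have "\<bar>a - b\<bar> / \<bar>b + real j\<bar> = \<bar>a - b\<bar> * \<bar>real (Suc j) / (b + real j)\<bar> / real (Suc j)"
      by (simp add: abs_divide)
    also have "\<dots> \<le> \<bar>a - b\<bar> * M / real (Suc j)"
      using M(2)[of j] by (intro divide_right_mono mult_left_mono) auto
    also have "\<dots> \<le> real p / real (Suc j)"
      using p by (intro divide_right_mono) auto
    also have "1 + real p / real (Suc j) \<le> (1 + 1 / real (Suc j)) ^ p"
      using Bernoulli_inequality[of "1 / real (Suc j)" p] by (simp add: order_trans[of "- 1" 0])
    also have "1 + 1 / real (Suc j) = real (Suc (Suc j)) / real (Suc j)"
      by (simp add: field_simps)
    finally show ?thesis by simp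
  qed
  have "\<bar>pochhammer a l / pochhammer b l\<bar> \<le> real (Suc l) ^ p" for l
  proof (induction l)
    case (Suc l)
    have "pochhammer a (Suc l) / pochhammer b (Suc l) = pochhammer a l / pochhammer b l * ((a + real l) / (b + real l))"
      by (simp add: pochhammer_Suc)
    then have "\<bar>pochhammer a (Suc l) / pochhammer b (Suc l)\<bar> = \<bar>pochhammer a l / pochhammer b l\<bar> * \<bar>(a + real l) / (b + real l)\<bar>"
      by (simp only: abs_mult)
    also have "\<dots> \<le> real (Suc l) ^ p * (real (Suc (Suc l)) / real (Suc l)) ^ p"
      by (intro mult_mono Suc step) auto
    also have "\<dots> = real (Suc (Suc l)) ^ p" by (simp add: power_divide)
    finally show ?case .
  qed simp
  then show ?thesis by blast
qed

text \<open>Expands the nonnegative integral of \<open>(\<bar>f x\<bar> - r)\<^sup>2\<close>, where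
  \<open>r\<close> is the mean of \<open>\<bar>f\<bar>\<close>.\<close>

lemma sphere_cauchy_schwarz:
  fixes f :: "'a::euclidean_space \<Rightarrow> real"
  assumes f: "continuous_on (sphere 0 1) f"
  shows "(\<integral>x. \<bar>f x\<bar> \<partial>sphere_measure)\<^sup>2 \<le> sphere_volume TYPE('a) * (\<integral>x. f x * f x \<partial>sphere_measure)"
proof -
  define V where "V = sphere_volume TYPE('a)"
  define I where "I = (\<integral>x. \<bar>f x\<bar> \<partial>sphere_measure)"
  have V: "V > 0" using sphere_volume_pos by (simp add: V_def)
  have i1: "integrable sphere_measure (\<lambda>x. f x * f x)" and i2: "integrable sphere_measure (\<lambda>x. \<bar>f x\<bar>)"
    by (intro integrable_continuous_on_sphere continuous_intros f)+
  define r where "r = I / V"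
  have rV: "I = r * V" using V by (simp add: r_def)
  have "0 \<le> (\<integral>x. (\<bar>f x\<bar> - r)\<^sup>2 \<partial>sphere_measure)" by simp
  also have "\<dots> = (\<integral>x. (f x * f x + (- 2 * r) * \<bar>f x\<bar>) + r\<^sup>2 \<partial>sphere_measure)"
    by (rule Bochner_Integration.integral_cong) (auto simp: power2_eq_square algebra_simps)
  also have "\<dots> = (\<integral>x. f x * f x \<partial>sphere_measure) + (- 2 * r) * I + r\<^sup>2 * V"
    unfolding Bochner_Integration.integral_add[OF Bochner_Integration.integrable_add[OF i1 integrable_mult_right[OF i2]] integrable_sphere_const]
      Bochner_Integration.integral_add[OF i1 integrable_mult_right[OF i2]] integral_mult_right_zero integral_sphere_const I_def V_def ..
  also have "\<dots> = (\<integral>x. f x * f x \<partial>sphere_measure) - r * r * V"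
    unfolding rV by (simp add: power2_eq_square)
  finally have "V * (r * r * V) \<le> V * (\<integral>x. f x * f x \<partial>sphere_measure)" using V by (intro mult_left_mono) auto
  then show ?thesis
    unfolding I_def[symmetric] V_def[symmetric] unfolding rV by (simp add: power2_eq_square mult_ac)
qed

text \<open>Vanishing on the sphere spreads to the whole space by homogeneity, which is what
  uniqueness of harmonic components as functions on the whole space requires.\<close>

lemma spherical_harmonics_eq_0:
  fixes Y :: "'a::euclidean_space \<Rightarrow> real"
  assumes Y: "Y \<in> spherical_harmonics l" and zero: "(\<integral>x. Y x * Y x \<partial>sphere_measure) = 0"
  shows "Y x = 0"
proof -
  have cY: "continuous_on (sphere 0 1) Y" by (rule spherical_harmonics_continuous[OF Y])
  have "integrable sphere_measure (\<lambda>x. Y x * Y x)"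
    by (intro integrable_continuous_on_sphere continuous_intros cY)
  then have "AE x in sphere_measure. Y x * Y x = 0"
    using zero by (subst (asm) integral_nonneg_eq_0_iff_AE) auto
  then have "AE x in sphere_measure. Y x = 0" by simp
  from continuous_AE_sphere_zero[OF cY this] have sph: "Y x = 0" if "x \<in> sphere 0 1" for x
    using that by blast
  have nz: "Y x = 0" if "x \<noteq> 0" for x
  proof -
    have "Y x = Y (norm x *\<^sub>R sgn x)" using that by (simp add: sgn_div_norm)
    also have "\<dots> = norm x ^ l * Y (sgn x)" by (rule spherical_harmonics_hom[OF Y])
    also have "Y (sgn x) = 0" using that by (intro sph) (simp add: norm_sgn)
    finally show ?thesis by simp
  qed
  obtain b :: 'a where "b \<in> Basis" using nonempty_Basis by blast
  then have "b \<noteq> 0" by auto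
  then have "Y (0 *\<^sub>R b) = 0" using nz[of b] by (simp only: spherical_harmonics_hom[OF Y]) simp
  then show ?thesis using nz[of x] by (cases "x = 0") auto
qed

context
  assumes dim: "DIM('a::euclidean_space) \<ge> 3"
begin

text \<open>The exponent 1/2 is positive, so the kernel is bounded, and it is not an integer, so
  \<open>pochhammer (- (1/2)) l\<close> vanishes in no degree. Hence \<open>Y Q\<close> is recovered
  from its integral against a bounded kernel, at the cost of the inverse Pochhammer
  quotient.\<close>

lemma spherical_harmonics_sup_bound:
  obtains K p where "K > 0"
    "\<And>l (Y :: 'a \<Rightarrow> real) Q. Y \<in> spherical_harmonics l \<Longrightarrow> Q \<in> sphere 0 1 \<Longrightarrow>
       \<bar>Y Q\<bar> \<le> K * real (Suc l) ^ p * (\<integral>x. \<bar>Y x\<bar> \<partial>sphere_measure)"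
proof -
  define n where "n = real DIM('a) - 1"
  have dim2: "DIM('a) \<ge> 2" using dim by simp
  have n: "n > 1" using dim by (simp add: n_def)
  define Z where "Z = pi powr (n / 2) * 4 powr (1/2 + n / 2) * Gamma (1/2 + n / 2) / Gamma (1/2 + n)"
  have Zeq: "zonal_mass Q (1/2) = Z" if "Q \<in> sphere 0 1" for Q :: 'a
    using zonal_mass_eq[OF that n_def dim2, of "1/2"] n by (simp add: Z_def)
  have Zpos: "Z > 0"
    using n unfolding Z_def by (intro divide_pos_pos mult_pos_pos Gamma_real_pos) auto
  have nz: "- (1/2) + real j \<noteq> 0" for j
  proof
    assume "- (1/2) + real j = 0"
    then have "real (2 * j) = real 1" by simp
    then have "2 * j = 1" by (simp only: of_nat_eq_iff)
    then show False by presburger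
  qed
  obtain p where p: "\<And>l. \<bar>pochhammer (n + 1/2) l / pochhammer (- (1/2)) l\<bar> \<le> real (Suc l) ^ p"
    using pochhammer_ratio_growth[OF nz] by blast
  show ?thesis
  proof (rule that[of "2 / Z" p])
    show "2 / Z > 0" using Zpos by simp
    fix l and Y :: "'a \<Rightarrow> real" and Q :: 'a
    assume Y: "Y \<in> spherical_harmonics l" and Q: "Q \<in> sphere 0 1"
    let ?T = "\<integral>x. sqdist Q x powr (1/2) * Y x \<partial>sphere_measure"
    have cY: "continuous_on (sphere 0 1) Y" by (rule spherical_harmonics_continuous[OF Y])
    have iY: "integrable sphere_measure (\<lambda>x. \<bar>Y x\<bar>)" by (intro integrable_continuous_on_sphere continuous_intros cY)
    have "?T = Z * (pochhammer (- (1/2)) l / pochhammer (n + 1/2) l) * Y Q"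
      using funk_hecke[OF Q n_def dim2, of "1/2" Y l] n Y Zeq[OF Q] by simp
    moreover have "pochhammer (n + 1/2) l > 0" using n by (intro pochhammer_pos) simp
    moreover have "pochhammer (- (1/2) :: real) l \<noteq> 0"
      unfolding pochhammer_prod using nz by (simp add: prod_zero_iff)
    ultimately have YQ: "Y Q = 1 / Z * (pochhammer (n + 1/2) l / pochhammer (- (1/2)) l) * ?T"
      using Zpos by (simp add: field_simps)
    have "\<bar>?T\<bar> \<le> (\<integral>x. 2 * \<bar>Y x\<bar> \<partial>sphere_measure)"
    proof (rule integral_abs_bound[THEN order_trans], rule integral_mono_AE)
      show "integrable sphere_measure (\<lambda>x. \<bar>sqdist Q x powr (1/2) * Y x\<bar>)"
        using sqdist_mult_integrable[OF Q n_def dim2, of "1/2" Y] n cY by simp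
      show "integrable sphere_measure (\<lambda>x. 2 * \<bar>Y x\<bar>)" using iY by simp
      show "AE x in sphere_measure. \<bar>sqdist Q x powr (1/2) * Y x\<bar> \<le> 2 * \<bar>Y x\<bar>"
      proof (rule AE_I2)
        fix x :: 'a assume "x \<in> space sphere_measure"
        then have "sqdist Q x \<le> 4" using sqdist_le_4[OF Q] by simp
        then have "sqrt (sqdist Q x) \<le> sqrt (2\<^sup>2)" by (intro real_sqrt_le_mono) simp
        then have "sqdist Q x powr (1/2) \<le> 2" by (simp add: powr_half_sqrt)
        then show "\<bar>sqdist Q x powr (1/2) * Y x\<bar> \<le> 2 * \<bar>Y x\<bar>"
          by (simp add: abs_mult mult_right_mono)
      qed
    qed
    then have T: "\<bar>?T\<bar> \<le> 2 * (\<integral>x. \<bar>Y x\<bar> \<partial>sphere_measure)" by simp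
    have "\<bar>Y Q\<bar> = 1 / Z * \<bar>pochhammer (n + 1/2) l / pochhammer (- (1/2)) l\<bar> * \<bar>?T\<bar>"
      using Zpos by (subst YQ) (simp add: abs_mult)
    also have "\<dots> \<le> 1 / Z * real (Suc l) ^ p * (2 * (\<integral>x. \<bar>Y x\<bar> \<partial>sphere_measure))"
      using Zpos by (intro mult_mono p T) auto
    finally show "\<bar>Y Q\<bar> \<le> 2 / Z * real (Suc l) ^ p * (\<integral>x. \<bar>Y x\<bar> \<partial>sphere_measure)" by (simp add: mult_ac)
  qed
qed

section \<open>Finite dimension and orthogonal projection\<close>

definition orthonormal_harmonics :: "nat \<Rightarrow> ('a \<Rightarrow> real) set \<Rightarrow> bool" where
  "orthonormal_harmonics l B \<longleftrightarrow> finite B \<and> B \<subseteq> spherical_harmonics l \<and>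
     (\<forall>e\<in>B. \<forall>f\<in>B. (\<integral>x. e x * f x \<partial>sphere_measure) = (if e = f then 1 else 0))"

lemma integrable_harmonics:
  fixes Y Z :: "'a \<Rightarrow> real"
  assumes "Y \<in> spherical_harmonics l" "Z \<in> spherical_harmonics k"
  shows "integrable sphere_measure (\<lambda>x. Y x * Z x)"
  by (intro integrable_continuous_on_sphere continuous_on_mult spherical_harmonics_continuous[OF assms(1)]
      spherical_harmonics_continuous[OF assms(2)])

lemma integral_harmonics_sum_left:
  fixes Z :: "'a \<Rightarrow> real"
  assumes Y: "\<And>e. e \<in> B \<Longrightarrow> Y e \<in> spherical_harmonics l" and Z: "Z \<in> spherical_harmonics k"
  shows "(\<integral>x. (\<Sum>e\<in>B. c e * Y e x) * Z x \<partial>sphere_measure) = (\<Sum>e\<in>B. c e * (\<integral>x. Y e x * Z x \<partial>sphere_measure))"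
proof -
  have "(\<integral>x. (\<Sum>e\<in>B. c e * Y e x) * Z x \<partial>sphere_measure) = (\<integral>x. (\<Sum>e\<in>B. c e * (Y e x * Z x)) \<partial>sphere_measure)"
    by (simp add: sum_distrib_right mult.assoc)
  also have "\<dots> = (\<Sum>e\<in>B. \<integral>x. c e * (Y e x * Z x) \<partial>sphere_measure)"
    by (rule Bochner_Integration.integral_sum) (intro integrable_mult_right integrable_harmonics[OF Y Z])
  finally show ?thesis by (simp only: integral_mult_right_zero)
qed

text \<open>The pointwise bound for the element \<open>\<Sum>e. e(Q) e\<close> controls \<open>\<Sum>e. e(Q)\<^sup>2\<close>, whose integral
  is the number of basis elements: this is what makes the spaces finite-dimensional.\<close>
lemma orthonormal_harmonics_card_bound:
  "\<exists>C. \<forall>B. orthonormal_harmonics l B \<longrightarrow> real (card B) \<le> C"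
proof -
  obtain K p where K: "K > 0" and bound: "\<And>l (Y :: 'a \<Rightarrow> real) Q. Y \<in> spherical_harmonics l \<Longrightarrow> Q \<in> sphere 0 1 \<Longrightarrow>
       \<bar>Y Q\<bar> \<le> K * real (Suc l) ^ p * (\<integral>x. \<bar>Y x\<bar> \<partial>sphere_measure)"
    by (rule spherical_harmonics_sup_bound) (rule that; assumption)
  define A where "A = K * real (Suc l) ^ p"
  define V where "V = sphere_volume TYPE('a)"
  have A: "A > 0" using K by (simp add: A_def)
  have V: "V > 0" using sphere_volume_pos by (simp add: V_def)
  have "real (card B) \<le> A\<^sup>2 * V * V" if B: "orthonormal_harmonics l B" for B
  proof -
    have fin: "finite B" and sub: "\<And>e. e \<in> B \<Longrightarrow> e \<in> spherical_harmonics l"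
      and on: "\<And>e f. e \<in> B \<Longrightarrow> f \<in> B \<Longrightarrow> (\<integral>x. e x * f x \<partial>sphere_measure) = (if e = f then 1 else 0)"
      using B by (auto simp: orthonormal_harmonics_def)
    have S: "(\<Sum>e\<in>B. e Q * e Q) \<le> A\<^sup>2 * V" if Q: "Q \<in> sphere 0 1" for Q
    proof -
      define Y where "Y x = (\<Sum>e\<in>B. e Q * e x)" for x
      define I where "I = (\<integral>x. \<bar>Y x\<bar> \<partial>sphere_measure)"
      have Y: "Y \<in> spherical_harmonics l"
        unfolding Y_def[abs_def] by (intro spherical_harmonics_sum spherical_harmonics_cmult sub)
      have Ye: "(\<integral>x. Y x * e x \<partial>sphere_measure) = e Q" if "e \<in> B" for e
        unfolding Y_def using fin that
        by (subst integral_harmonics_sum_left[OF sub sub]) (auto simp: on if_distrib[where f="\<lambda>y. _ * y"] sum.delta cong: if_cong)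
      have YY: "(\<integral>x. Y x * Y x \<partial>sphere_measure) = Y Q"
      proof -
        have "(\<integral>x. Y x * Y x \<partial>sphere_measure) = (\<integral>x. (\<Sum>e\<in>B. e Q * e x) * Y x \<partial>sphere_measure)"
          by (subst (1) Y_def) simp
        also have "\<dots> = (\<Sum>e\<in>B. e Q * (\<integral>x. e x * Y x \<partial>sphere_measure))"
          by (rule integral_harmonics_sum_left[OF sub Y])
        also have "\<dots> = (\<Sum>e\<in>B. e Q * e Q)"
          using Ye by (intro sum.cong refl) (simp add: mult.commute)
        finally show ?thesis by (simp add: Y_def)
      qed
      have YQ0: "Y Q \<ge> 0" by (simp add: Y_def sum_nonneg)
      \<comment> \<open>\<open>Y Q\<close> is at once a value of \<open>Y\<close> and its squared
        norm, so the pointwise bound reproduces itself: \<open>Y Q * Y Q\<close> is at most a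
        constant times \<open>Y Q\<close>.\<close>
      have "Y Q \<le> A * I" using bound[OF Y Q] by (simp add: A_def I_def)
      then have "Y Q * Y Q \<le> (A * I) * (A * I)" using YQ0 by (intro mult_mono) auto
      also have "\<dots> = A\<^sup>2 * I\<^sup>2" by (simp add: power2_eq_square)
      also have "\<dots> \<le> A\<^sup>2 * (V * Y Q)"
        using sphere_cauchy_schwarz[OF spherical_harmonics_continuous[OF Y]] A
        by (intro mult_left_mono) (auto simp: I_def V_def YY)
      finally have "Y Q * Y Q \<le> (A\<^sup>2 * V) * Y Q" by simp
      moreover have "A\<^sup>2 * V > 0" using A V by simp
      ultimately have "Y Q \<le> A\<^sup>2 * V" using YQ0
        by (cases "Y Q = 0") (auto simp: mult_le_cancel_right)
      then show ?thesis by (simp add: Y_def)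
    qed
    have "real (card B) = (\<Sum>e\<in>B. \<integral>x. e x * e x \<partial>sphere_measure)" by (simp add: on)
    also have "\<dots> = (\<integral>x. (\<Sum>e\<in>B. e x * e x) \<partial>sphere_measure)"
      by (rule Bochner_Integration.integral_sum[symmetric]) (intro integrable_harmonics[OF sub sub])
    also have "\<dots> \<le> (\<integral>x. A\<^sup>2 * V \<partial>(sphere_measure :: 'a measure))"
    proof (rule integral_mono_AE)
      show "AE x in sphere_measure. (\<Sum>e\<in>B. e x * e x) \<le> A\<^sup>2 * V"
        using S by (intro AE_I2) simp
    qed (auto intro!: Bochner_Integration.integrable_sum integrable_harmonics[OF sub sub])
    also have "\<dots> = A\<^sup>2 * V * V" by (simp only: integral_sphere_const V_def)
    finally show ?thesis .
  qed
  then show ?thesis by blast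
qed

text \<open>By the cardinality bound there is an orthonormal set with the largest number of
  elements. It spans, since the remainder of a harmonic outside its span could be normalised and
  added. The projection of \<open>u\<close> is then a finite sum with the coefficients of
  \<open>u\<close>.\<close>

lemma harmonic_projection_exists:
  fixes u :: "'a \<Rightarrow> real"
  assumes u: "continuous_on (sphere 0 1) u"
  shows "\<exists>Y\<in>spherical_harmonics l. \<forall>Z\<in>spherical_harmonics l.
     (\<integral>x. Y x * Z x \<partial>sphere_measure) = (\<integral>x. u x * Z x \<partial>sphere_measure)"
proof -
  obtain C where C: "\<And>B. orthonormal_harmonics l B \<Longrightarrow> real (card B) \<le> C"
    using orthonormal_harmonics_card_bound by blast
  \<comment> \<open>\<open>Suc\<close> because the choice of a maximum asks for a strict
    bound.\<close>
  have card: "\<forall>B. orthonormal_harmonics l B \<longrightarrow> card B < Suc (nat \<lceil>C\<rceil>)"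
  proof (intro allI impI)
    fix B assume "orthonormal_harmonics l B"
    from C[OF this] show "card B < Suc (nat \<lceil>C\<rceil>)" by linarith
  qed
  have "orthonormal_harmonics l {}" by (simp add: orthonormal_harmonics_def)
  from ex_has_greatest_nat[of "orthonormal_harmonics l", OF this card]
  obtain B where B: "orthonormal_harmonics l B"
    and max: "\<And>B'. orthonormal_harmonics l B' \<Longrightarrow> card B' \<le> card B" by blast
  have fin: "finite B" and sub: "\<And>e. e \<in> B \<Longrightarrow> e \<in> spherical_harmonics l"
    and on: "\<And>e f. e \<in> B \<Longrightarrow> f \<in> B \<Longrightarrow> (\<integral>x. e x * f x \<partial>sphere_measure) = (if e = f then 1 else 0)"
    using B by (auto simp: orthonormal_harmonics_def)
  have expand: "Z x = (\<Sum>e\<in>B. (\<integral>x. Z x * e x \<partial>sphere_measure) * e x)" if Z: "Z \<in> spherical_harmonics l" for Z x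
  proof (rule ccontr)
    assume neq: "Z x \<noteq> (\<Sum>e\<in>B. (\<integral>x. Z x * e x \<partial>sphere_measure) * e x)"
    define P where "P x = (\<Sum>e\<in>B. (\<integral>x. Z x * e x \<partial>sphere_measure) * e x)" for x
    define W where "W x = Z x - P x" for x
    have P: "P \<in> spherical_harmonics l"
      unfolding P_def[abs_def] by (intro spherical_harmonics_sum spherical_harmonics_cmult sub)
    have W: "W \<in> spherical_harmonics l"
      unfolding W_def[abs_def] by (intro spherical_harmonics_diff Z P)
    have Pe: "(\<integral>x. P x * e x \<partial>sphere_measure) = (\<integral>x. Z x * e x \<partial>sphere_measure)" if "e \<in> B" for e
      unfolding P_def using fin that
      by (subst integral_harmonics_sum_left[OF sub sub]) (auto simp: on if_distrib[where f="\<lambda>y. _ * y"] sum.delta cong: if_cong)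
    have We: "(\<integral>x. W x * e x \<partial>sphere_measure) = 0" if "e \<in> B" for e
    proof -
      have "(\<integral>x. W x * e x \<partial>sphere_measure) = (\<integral>x. Z x * e x - P x * e x \<partial>sphere_measure)"
        by (simp add: W_def left_diff_distrib)
      also have "\<dots> = 0"
        using Bochner_Integration.integral_diff[OF integrable_harmonics[OF Z sub[OF that]] integrable_harmonics[OF P sub[OF that]]]
        by (simp add: Pe[OF that])
      finally show ?thesis .
    qed
    have "W x \<noteq> 0" using neq by (simp add: W_def P_def)
    then have "(\<integral>x. W x * W x \<partial>sphere_measure) \<noteq> 0"
      using spherical_harmonics_eq_0[OF W] by blast
    moreover have "(\<integral>x. W x * W x \<partial>sphere_measure) \<ge> 0" by (rule integral_nonneg_AE) simp
    ultimately have WW: "(\<integral>x. W x * W x \<partial>sphere_measure) > 0" by linarith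
    define r where "r = 1 / sqrt (\<integral>x. W x * W x \<partial>sphere_measure)"
    define w where "w x = r * W x" for x
    have w: "w \<in> spherical_harmonics l"
      unfolding w_def[abs_def] by (intro spherical_harmonics_cmult W)
    have "(\<integral>x. w x * w x \<partial>sphere_measure) = (\<integral>x. (r * r) * (W x * W x) \<partial>sphere_measure)"
      by (simp add: w_def mult_ac)
    also have "\<dots> = (r * r) * (\<integral>x. W x * W x \<partial>sphere_measure)" by (rule integral_mult_right_zero)
    also have "\<dots> = 1" using WW by (simp add: r_def)
    finally have ww: "(\<integral>x. w x * w x \<partial>sphere_measure) = 1" .
    have we: "(\<integral>x. w x * e x \<partial>sphere_measure) = 0" if "e \<in> B" for e
    proof -
      have "(\<integral>x. w x * e x \<partial>sphere_measure) = (\<integral>x. r * (W x * e x) \<partial>sphere_measure)"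
        by (simp add: w_def mult_ac)
      then show ?thesis using We[OF that] by (simp only: integral_mult_right_zero mult_zero_right)
    qed
    then have ew: "(\<integral>x. e x * w x \<partial>sphere_measure) = 0" if "e \<in> B" for e
      using that by (simp add: mult.commute)
    have "w \<notin> B" using we[of w] ww by auto
    moreover have "orthonormal_harmonics l (insert w B)"
      unfolding orthonormal_harmonics_def
      using fin sub on w ww we ew \<open>w \<notin> B\<close> by auto
    ultimately show False
      using max[of "insert w B"] fin by simp
  qed
  define Y where "Y x = (\<Sum>e\<in>B. (\<integral>x. u x * e x \<partial>sphere_measure) * e x)" for x
  have Y: "Y \<in> spherical_harmonics l"
    unfolding Y_def[abs_def] by (intro spherical_harmonics_sum spherical_harmonics_cmult sub)
  have "(\<integral>x. Y x * Z x \<partial>sphere_measure) = (\<integral>x. u x * Z x \<partial>sphere_measure)" if Z: "Z \<in> spherical_harmonics l" for Z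
  proof -
    have "(\<integral>x. Y x * Z x \<partial>sphere_measure) = (\<Sum>e\<in>B. (\<integral>x. u x * e x \<partial>sphere_measure) * (\<integral>x. e x * Z x \<partial>sphere_measure))"
      unfolding Y_def by (rule integral_harmonics_sum_left[OF sub Z])
    also have "\<dots> = (\<Sum>e\<in>B. \<integral>x. (\<integral>x. Z x * e x \<partial>sphere_measure) * (u x * e x) \<partial>sphere_measure)"
      by (intro sum.cong refl, subst integral_mult_right_zero) (simp only: mult.commute)
    also have "\<dots> = (\<integral>x. (\<Sum>e\<in>B. (\<integral>x. Z x * e x \<partial>sphere_measure) * (u x * e x)) \<partial>sphere_measure)"
      by (rule Bochner_Integration.integral_sum[symmetric])
        (intro integrable_mult_right integrable_continuous_on_sphere continuous_on_mult u spherical_harmonics_continuous[OF sub])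
    also have "\<dots> = (\<integral>x. u x * Z x \<partial>sphere_measure)"
    proof (rule Bochner_Integration.integral_cong[OF refl])
      fix x
      have "u x * Z x = u x * (\<Sum>e\<in>B. (\<integral>x. Z x * e x \<partial>sphere_measure) * e x)"
        using expand[OF Z, of x] by (rule arg_cong)
      then show "(\<Sum>e\<in>B. (\<integral>x. Z x * e x \<partial>sphere_measure) * (u x * e x)) = u x * Z x"
        by (simp only: sum_distrib_left mult.left_commute)
    qed
    finally show ?thesis .
  qed
  with Y show ?thesis by blast
qed

lemma harmonic_projection_unique:
  fixes Y Y' u :: "'a \<Rightarrow> real"
  assumes Y: "Y \<in> spherical_harmonics l" and Y': "Y' \<in> spherical_harmonics l"
    and eq: "\<And>Z. Z \<in> spherical_harmonics l \<Longrightarrow> (\<integral>x. Y x * Z x \<partial>sphere_measure) = (\<integral>x. u x * Z x \<partial>sphere_measure)"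
    and eq': "\<And>Z. Z \<in> spherical_harmonics l \<Longrightarrow> (\<integral>x. Y' x * Z x \<partial>sphere_measure) = (\<integral>x. u x * Z x \<partial>sphere_measure)"
  shows "Y = Y'"
proof
  fix x
  let ?D = "\<lambda>x. Y x - Y' x"
  have D: "?D \<in> spherical_harmonics l" by (rule spherical_harmonics_diff[OF Y Y'])
  have "(\<integral>x. ?D x * ?D x \<partial>sphere_measure) = (\<integral>x. Y x * ?D x - Y' x * ?D x \<partial>sphere_measure)"
    by (simp add: left_diff_distrib)
  also have "\<dots> = 0"
    unfolding Bochner_Integration.integral_diff[OF integrable_harmonics[OF Y D] integrable_harmonics[OF Y' D]] eq[OF D] eq'[OF D] by simp
  finally show "Y x = Y' x" using spherical_harmonics_eq_0[OF D, of x] by simp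
qed

lemma harmonic_component_eqI:
  fixes Y u :: "'a \<Rightarrow> real"
  assumes "Y \<in> spherical_harmonics l"
    and "\<And>Z. Z \<in> spherical_harmonics l \<Longrightarrow> (\<integral>x. Y x * Z x \<partial>sphere_measure) = (\<integral>x. u x * Z x \<partial>sphere_measure)"
  shows "harmonic_component l u = Y"
  unfolding harmonic_component_def
proof (rule the_equality)
  show "Y \<in> spherical_harmonics l \<and> (\<forall>Z\<in>spherical_harmonics l.
    (\<integral>x. Y x * Z x \<partial>sphere_measure) = (\<integral>x. u x * Z x \<partial>sphere_measure))" using assms by blast
  fix Y' assume "Y' \<in> spherical_harmonics l \<and> (\<forall>Z\<in>spherical_harmonics l.
    (\<integral>x. Y' x * Z x \<partial>sphere_measure) = (\<integral>x. u x * Z x \<partial>sphere_measure))"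
  then show "Y' = Y" using assms by (intro harmonic_projection_unique[of Y' l Y u]) auto
qed

lemma
  fixes u :: "'a \<Rightarrow> real"
  assumes u: "continuous_on (sphere 0 1) u"
  shows harmonic_component_in: "harmonic_component l u \<in> spherical_harmonics l"
    and harmonic_component_integral: "Z \<in> spherical_harmonics l \<Longrightarrow>
      (\<integral>x. harmonic_component l u x * Z x \<partial>sphere_measure) = (\<integral>x. u x * Z x \<partial>sphere_measure)"
proof -
  obtain Y where Y: "Y \<in> spherical_harmonics l" "\<And>Z. Z \<in> spherical_harmonics l \<Longrightarrow>
     (\<integral>x. Y x * Z x \<partial>sphere_measure) = (\<integral>x. u x * Z x \<partial>sphere_measure)"
    using harmonic_projection_exists[OF u] by blast
  have "harmonic_component l u = Y" by (rule harmonic_component_eqI[OF Y])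
  with Y show "harmonic_component l u \<in> spherical_harmonics l"
    "Z \<in> spherical_harmonics l \<Longrightarrow> (\<integral>x. harmonic_component l u x * Z x \<partial>sphere_measure) = (\<integral>x. u x * Z x \<partial>sphere_measure)"
    by auto
qed

section \<open>Decay of harmonic components and series with multipliers\<close>

lemma harmonic_component_shifted_laplacian:
  fixes u :: "'a \<Rightarrow> real"
  assumes u: "smooth_on_sphere u"
  shows "harmonic_component l (shifted_laplacian c u)
    = (\<lambda>x. (real l * (real l + real DIM('a) - 2) + c) * harmonic_component l u x)"
proof (rule harmonic_component_eqI)
  note cu = smooth_on_sphere_continuous[OF u]
  show "(\<lambda>x. (real l * (real l + real DIM('a) - 2) + c) * harmonic_component l u x) \<in> spherical_harmonics l"
    by (intro spherical_harmonics_cmult harmonic_component_in cu)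
  fix Z :: "'a \<Rightarrow> real" assume Z: "Z \<in> spherical_harmonics l"
  show "(\<integral>x. (real l * (real l + real DIM('a) - 2) + c) * harmonic_component l u x * Z x \<partial>sphere_measure)
    = (\<integral>x. shifted_laplacian c u x * Z x \<partial>sphere_measure)"
    unfolding shifted_laplacian_self_adjoint[OF u Z] mult.assoc integral_mult_right_zero harmonic_component_integral[OF cu Z] ..
qed

text \<open>The square of the component has the same integral as its product with \<open>u\<close>,
  so by the Cauchy-Schwarz inequality its absolute integral \<open>I\<close> satisfies
  \<open>I * I \<le> V * M * I\<close>; the pointwise bound for harmonics does the rest.\<close>

lemma harmonic_component_bound:
  obtains K p where "K > 0"
    "\<And>l (u :: 'a \<Rightarrow> real) M Q. continuous_on (sphere 0 1) u \<Longrightarrow> (\<And>x. x \<in> sphere 0 1 \<Longrightarrow> \<bar>u x\<bar> \<le> M) \<Longrightarrow>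
       Q \<in> sphere 0 1 \<Longrightarrow> \<bar>harmonic_component l u Q\<bar> \<le> K * real (Suc l) ^ p * M"
proof -
  obtain K p where K: "K > 0" and bound: "\<And>l (Y :: 'a \<Rightarrow> real) Q. Y \<in> spherical_harmonics l \<Longrightarrow> Q \<in> sphere 0 1 \<Longrightarrow>
       \<bar>Y Q\<bar> \<le> K * real (Suc l) ^ p * (\<integral>x. \<bar>Y x\<bar> \<partial>sphere_measure)"
    by (rule spherical_harmonics_sup_bound) (rule that; assumption)
  define V where "V = sphere_volume TYPE('a)"
  have V: "V > 0" using sphere_volume_pos by (simp add: V_def)
  show ?thesis
  proof (rule that[of "K * V" p])
    show "K * V > 0" using K V by simp
    fix l and u :: "'a \<Rightarrow> real" and M and Q :: 'a
    assume u: "continuous_on (sphere 0 1) u" and M: "\<And>x. x \<in> sphere 0 1 \<Longrightarrow> \<bar>u x\<bar> \<le> M" and Q: "Q \<in> sphere 0 1"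
    let ?Y = "harmonic_component l u"
    define I where "I = (\<integral>x. \<bar>?Y x\<bar> \<partial>sphere_measure)"
    have M0: "M \<ge> 0" using M[OF Q] by linarith
    have Y: "?Y \<in> spherical_harmonics l" by (rule harmonic_component_in[OF u])
    have cY: "continuous_on (sphere 0 1) ?Y" by (rule spherical_harmonics_continuous[OF Y])
    have iY: "integrable sphere_measure (\<lambda>x. \<bar>?Y x\<bar>)" by (intro integrable_continuous_on_sphere continuous_intros cY)
    have I0: "I \<ge> 0" by (simp add: I_def)
    have "I\<^sup>2 \<le> V * (\<integral>x. ?Y x * ?Y x \<partial>sphere_measure)"
      using sphere_cauchy_schwarz[OF cY] by (simp add: I_def V_def)
    also have "(\<integral>x. ?Y x * ?Y x \<partial>sphere_measure) = (\<integral>x. u x * ?Y x \<partial>sphere_measure)"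
      by (rule harmonic_component_integral[OF u Y])
    also have "\<dots> \<le> (\<integral>x. M * \<bar>?Y x\<bar> \<partial>sphere_measure)"
    proof (rule integral_mono_AE)
      show "integrable sphere_measure (\<lambda>x. u x * ?Y x)"
        by (intro integrable_continuous_on_sphere continuous_on_mult u cY)
      show "integrable sphere_measure (\<lambda>x. M * \<bar>?Y x\<bar>)" using iY by simp
      show "AE x in sphere_measure. u x * ?Y x \<le> M * \<bar>?Y x\<bar>"
      proof (rule AE_I2)
        fix x :: 'a assume "x \<in> space sphere_measure"
        then have "\<bar>u x\<bar> * \<bar>?Y x\<bar> \<le> M * \<bar>?Y x\<bar>" using M[of x] by (intro mult_right_mono) auto
        then show "u x * ?Y x \<le> M * \<bar>?Y x\<bar>" using abs_ge_self[of "u x * ?Y x"] by (simp add: abs_mult)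
      qed
    qed
    also have "\<dots> = M * I" by (simp add: I_def)
    finally have "I * I \<le> V * M * I" using V by (simp add: power2_eq_square mult_left_mono)
    then have "I \<le> V * M" using I0 V M0 by (cases "I = 0") (auto simp: mult_le_cancel_right)
    then have "K * real (Suc l) ^ p * I \<le> K * real (Suc l) ^ p * (V * M)"
      using K by (intro mult_left_mono) auto
    then show "\<bar>?Y Q\<bar> \<le> K * V * real (Suc l) ^ p * M"
      using bound[OF Y Q] by (simp add: I_def mult_ac)
  qed
qed

text \<open>Applying \<open>shifted_laplacian 1\<close> to \<open>u\<close> exactly
  \<open>p + q\<close> times multiplies the component by the same power of
  \<open>l * (l + DIM('a) - 2) + 1\<close>, which is at least \<open>l + 1\<close>. Of these powers
  \<open>p\<close> absorb the growth in the pointwise bound and \<open>q\<close> remain as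
  decay.\<close>

theorem harmonic_component_decay:
  fixes u :: "'a \<Rightarrow> real"
  assumes u: "smooth_on_sphere u"
  shows "\<exists>C. \<forall>l. \<forall>x\<in>sphere 0 1. \<bar>harmonic_component l u x\<bar> * real (Suc l) ^ q \<le> C"
proof -
  obtain K p where K: "K > 0" and bound: "\<And>l (u :: 'a \<Rightarrow> real) M Q. continuous_on (sphere 0 1) u \<Longrightarrow> (\<And>x. x \<in> sphere 0 1 \<Longrightarrow> \<bar>u x\<bar> \<le> M) \<Longrightarrow>
       Q \<in> sphere 0 1 \<Longrightarrow> \<bar>harmonic_component l u Q\<bar> \<le> K * real (Suc l) ^ p * M"
    using harmonic_component_bound by metis
  define v where "v k = (shifted_laplacian 1 ^^ k) u" for k
  have v: "smooth_on_sphere (v k) \<and> harmonic_component l (v k)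
     = (\<lambda>x. (real l * (real l + real DIM('a) - 2) + 1) ^ k * harmonic_component l u x)" for k l
  proof (induction k)
    case 0
    then show ?case using u by (simp add: v_def)
  next
    case (Suc k)
    have "v (Suc k) = shifted_laplacian 1 (v k)" by (simp add: v_def)
    then show ?case
      using Suc smooth_on_sphere_shifted_laplacian[of "v k" 1] harmonic_component_shifted_laplacian[of "v k" l 1]
      by (simp add: mult.assoc)
  qed
  let ?k = "p + q"
  have cv: "continuous_on (sphere 0 1) (v ?k)" using v smooth_on_sphere_continuous by blast
  obtain M where M: "\<And>x. x \<in> sphere 0 1 \<Longrightarrow> \<bar>v ?k x\<bar> \<le> M"
    using bounded_continuous_on_sphere[OF cv] by blast
  have "\<bar>harmonic_component l u x\<bar> * real (Suc l) ^ q \<le> K * M" if x: "x \<in> sphere 0 1" for l x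
  proof -
    define L where "L = real l * (real l + real DIM('a) - 2) + 1"
    have L: "L \<ge> real (Suc l)"
    proof -
      have "real l \<le> real l * real l" by (cases l) auto
      moreover have "real l * 0 \<le> real l * (real DIM('a) - 2)" using dim by (intro mult_left_mono) auto
      ultimately show ?thesis by (simp add: L_def algebra_simps)
    qed
    have "real (Suc l) ^ p * (\<bar>harmonic_component l u x\<bar> * real (Suc l) ^ q) = real (Suc l) ^ ?k * \<bar>harmonic_component l u x\<bar>"
      by (simp add: power_add)
    also have "\<dots> \<le> L ^ ?k * \<bar>harmonic_component l u x\<bar>"
      using L by (intro mult_right_mono power_mono) auto
    also have "\<dots> = \<bar>harmonic_component l (v ?k) x\<bar>"
    proof -
      have "harmonic_component l (v ?k) x = L ^ ?k * harmonic_component l u x" using v[of ?k l] by (simp add: L_def)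
      moreover have "L \<ge> 0" using L by linarith
      ultimately show ?thesis by (simp add: abs_mult)
    qed
    also have "\<dots> \<le> K * real (Suc l) ^ p * M" by (rule bound[OF cv M x])
    finally have "real (Suc l) ^ p * (\<bar>harmonic_component l u x\<bar> * real (Suc l) ^ q) \<le> real (Suc l) ^ p * (K * M)"
      by (simp add: mult_ac)
    then show ?thesis by (simp add: mult_le_cancel_left_pos)
  qed
  then show ?thesis by blast
qed

lemma harmonic_multiplier_summable_bound:
  fixes u :: "'a \<Rightarrow> real"
  assumes u: "smooth_on_sphere u" and m: "\<And>l. \<bar>m l\<bar> \<le> A * real (Suc l) ^ p"
  shows "\<exists>C. \<forall>l. \<forall>x\<in>sphere 0 1. \<bar>m l * harmonic_component l u x\<bar> \<le> C / real (Suc l) ^ 2"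
proof -
  \<comment> \<open>Two powers beyond the growth of the multiplier leave a summable bound.\<close>
  obtain C where C: "\<And>l x. x \<in> sphere 0 1 \<Longrightarrow> \<bar>harmonic_component l u x\<bar> * real (Suc l) ^ (p + 2) \<le> C"
    using harmonic_component_decay[OF u, of "p + 2"] by blast
  have A: "A \<ge> 0" using m[of 0] by simp
  have "\<bar>m l * harmonic_component l u x\<bar> \<le> A * C / real (Suc l) ^ 2" if "x \<in> sphere 0 1" for l x
  proof -
    have "\<bar>m l * harmonic_component l u x\<bar> * real (Suc l) ^ 2 \<le> A * real (Suc l) ^ p * \<bar>harmonic_component l u x\<bar> * real (Suc l) ^ 2"
      unfolding abs_mult by (intro mult_right_mono m) auto
    also have "\<dots> = A * (\<bar>harmonic_component l u x\<bar> * real (Suc l) ^ (p + 2))"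
      by (simp add: power_add power2_eq_square)
    also have "\<dots> \<le> A * C" using C[OF that] A by (intro mult_left_mono)
    finally show ?thesis by (simp add: pos_le_divide_eq)
  qed
  then show ?thesis by blast
qed

lemma summable_inverse_Suc_squares: "summable (\<lambda>l. C / real (Suc l) ^ 2)"
proof -
  have "summable (\<lambda>l. inverse (real (Suc l)) ^ 2)"
    using inverse_power_summable[of 2, where 'a = real] by (subst summable_Suc_iff) (simp add: power_inverse)
  from summable_mult[OF this, of C] show ?thesis by (simp add: divide_inverse power_inverse)
qed

lemma harmonic_multiplier_continuous:
  fixes u :: "'a \<Rightarrow> real"
  assumes u: "smooth_on_sphere u" and m: "\<And>l. \<bar>m l\<bar> \<le> A * real (Suc l) ^ p"
  shows "continuous_on (sphere 0 1) (\<lambda>x. \<Sum>l. m l * harmonic_component l u x)"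
proof -
  obtain C where C: "\<And>l x. x \<in> sphere 0 1 \<Longrightarrow> \<bar>m l * harmonic_component l u x\<bar> \<le> C / real (Suc l) ^ 2"
    using harmonic_multiplier_summable_bound[OF u m] by blast
  show ?thesis
  proof (rule uniform_limit_theorem[OF _ Weierstrass_m_test[OF _ summable_inverse_Suc_squares]])
    show "norm (m l * harmonic_component l u x) \<le> C / real (Suc l) ^ 2" if "x \<in> sphere 0 1" for l x
      using C[OF that] by simp
    show "\<forall>\<^sub>F k in sequentially. continuous_on (sphere 0 1) (\<lambda>x. \<Sum>i<k. m i * harmonic_component i u x)"
      by (intro always_eventually allI continuous_on_sum continuous_on_mult continuous_on_const
        spherical_harmonics_continuous[OF harmonic_component_in[OF smooth_on_sphere_continuous[OF u]]])
  qed simp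
qed

text \<open>The terms have a summable bound that is uniform on the sphere, so the interchange works
  for every integrable \<open>K\<close>, in particular for unbounded kernels.\<close>

lemma harmonic_multiplier_integral:
  fixes u K :: "'a \<Rightarrow> real"
  assumes u: "smooth_on_sphere u" and m: "\<And>l. \<bar>m l\<bar> \<le> A * real (Suc l) ^ p"
    and K: "integrable sphere_measure K"
  shows "(\<lambda>l. m l * (\<integral>x. K x * harmonic_component l u x \<partial>sphere_measure)) sums
     (\<integral>x. K x * (\<Sum>l. m l * harmonic_component l u x) \<partial>sphere_measure)"
proof -
  obtain C where C: "\<And>l x. x \<in> sphere 0 1 \<Longrightarrow> \<bar>m l * harmonic_component l u x\<bar> \<le> C / real (Suc l) ^ 2"
    using harmonic_multiplier_summable_bound[OF u m] by blast
  let ?f = "\<lambda>l x. K x * (m l * harmonic_component l u x)"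
  have cont: "continuous_on (sphere 0 1) (\<lambda>x. m l * harmonic_component l u x)" for l
    by (intro continuous_on_mult continuous_on_const
        spherical_harmonics_continuous[OF harmonic_component_in[OF smooth_on_sphere_continuous[OF u]]])
  have int: "integrable sphere_measure (?f l)" for l
    by (rule integrable_mult_continuous_sphere[OF K cont])
  have summ: "summable (\<lambda>l. \<bar>m l * harmonic_component l u x\<bar>)" if "x \<in> sphere 0 1" for x
    by (rule summable_comparison_test[OF _ summable_inverse_Suc_squares[of C]]) (use C[OF that] in auto)
  have bound: "\<bar>?f l x\<bar> \<le> \<bar>K x\<bar> * (C / real (Suc l) ^ 2)" if "x \<in> sphere 0 1" for l x
    unfolding abs_mult[of "K x"] using C[OF that] by (intro mult_left_mono) auto
  have "(\<lambda>l. \<integral>x. ?f l x \<partial>sphere_measure) sums (\<integral>x. (\<Sum>l. ?f l x) \<partial>sphere_measure)"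
  proof (rule sums_integral[OF int])
    show "AE x in sphere_measure. summable (\<lambda>l. norm (?f l x))"
      using summ by (intro AE_I2) (simp add: abs_mult[of "K _"] summable_mult)
    show "summable (\<lambda>l. \<integral>x. norm (?f l x) \<partial>sphere_measure)"
    proof (rule summable_comparison_test)
      show "summable (\<lambda>l. (\<integral>x. \<bar>K x\<bar> \<partial>sphere_measure) * (C / real (Suc l) ^ 2))"
        by (intro summable_mult summable_inverse_Suc_squares)
      have "(\<integral>x. norm (?f l x) \<partial>sphere_measure) \<le> (\<integral>x. \<bar>K x\<bar> \<partial>sphere_measure) * (C / real (Suc l) ^ 2)" for l
      proof -
        have "(\<integral>x. norm (?f l x) \<partial>sphere_measure) \<le> (\<integral>x. \<bar>K x\<bar> * (C / real (Suc l) ^ 2) \<partial>sphere_measure)"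
        proof (rule integral_mono_AE)
          show "integrable sphere_measure (\<lambda>x. norm (?f l x))" using int[of l] by (rule integrable_norm)
          show "integrable sphere_measure (\<lambda>x. \<bar>K x\<bar> * (C / real (Suc l) ^ 2))" using K by simp
          show "AE x in sphere_measure. norm (?f l x) \<le> \<bar>K x\<bar> * (C / real (Suc l) ^ 2)"
            using bound by (intro AE_I2) simp
        qed
        then show ?thesis by (simp only: integral_mult_left_zero)
      qed
      moreover have "norm (\<integral>x. norm (?f l x) \<partial>sphere_measure) = (\<integral>x. norm (?f l x) \<partial>sphere_measure)" for l
        unfolding real_norm_def[of "\<integral>x. norm (?f l x) \<partial>sphere_measure"]
        by (rule abs_of_nonneg, rule Bochner_Integration.integral_nonneg) simp
      ultimately show "\<exists>N. \<forall>l\<ge>N. norm (\<integral>x. norm (?f l x) \<partial>sphere_measure) \<le> (\<integral>x. \<bar>K x\<bar> \<partial>sphere_measure) * (C / real (Suc l) ^ 2)"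
        by metis
    qed
  qed
  also have "(\<integral>x. (\<Sum>l. ?f l x) \<partial>sphere_measure) = (\<integral>x. K x * (\<Sum>l. m l * harmonic_component l u x) \<partial>sphere_measure)"
  proof (rule Bochner_Integration.integral_cong[OF refl])
    fix x :: 'a assume "x \<in> space sphere_measure"
    then have "summable (\<lambda>l. m l * harmonic_component l u x)"
      using summ by (intro summable_rabs_cancel[of "\<lambda>l. m l * harmonic_component l u x"]) simp
    then show "(\<Sum>l. ?f l x) = K x * (\<Sum>l. m l * harmonic_component l u x)" by (rule suminf_mult)
  qed
  also have "(\<lambda>l. \<integral>x. ?f l x \<partial>sphere_measure) = (\<lambda>l. m l * (\<integral>x. K x * harmonic_component l u x \<partial>sphere_measure))"
    by (rule ext) (simp only: mult.left_commute[of "K _"] integral_mult_right_zero)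
  finally show ?thesis .
qed

text \<open>The sum of the components is continuous and pairs with every harmonic as
  \<open>u\<close> does. By completeness the difference vanishes almost everywhere, and by
  continuity everywhere.\<close>

theorem harmonic_expansion:
  fixes u :: "'a \<Rightarrow> real"
  assumes u: "smooth_on_sphere u" and x: "x \<in> sphere 0 1"
  shows "(\<lambda>l. harmonic_component l u x) sums u x"
proof -
  define S where "S x = (\<Sum>l. 1 * harmonic_component l u x)" for x
  have one: "\<bar>1\<bar> \<le> 1 * real (Suc l) ^ 0" for l by simp
  have cu: "continuous_on (sphere 0 1) u" by (rule smooth_on_sphere_continuous[OF u])
  have cS: "continuous_on (sphere 0 1) S"
    unfolding S_def[abs_def] by (rule harmonic_multiplier_continuous[OF u one])
  have "orthogonal_to_harmonics (\<lambda>x. u x - S x)"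
    unfolding orthogonal_to_harmonics_def
  proof (intro conjI allI ballI)
    show "integrable sphere_measure (\<lambda>x. u x - S x)"
      by (intro integrable_continuous_on_sphere continuous_on_diff cu cS)
    fix l and Y :: "'a \<Rightarrow> real" assume Y: "Y \<in> spherical_harmonics l"
    have cY: "continuous_on (sphere 0 1) Y" by (rule spherical_harmonics_continuous[OF Y])
    let ?I = "\<integral>x. u x * Y x \<partial>sphere_measure"
    have "(\<lambda>j. 1 * (\<integral>x. Y x * harmonic_component j u x \<partial>sphere_measure)) sums (\<integral>x. Y x * S x \<partial>sphere_measure)"
      unfolding S_def by (rule harmonic_multiplier_integral[OF u one integrable_continuous_on_sphere[OF cY]])
    moreover have "1 * (\<integral>x. Y x * harmonic_component j u x \<partial>sphere_measure) = (if j = l then ?I else 0)" for j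
    proof (cases "j = l")
      case True
      then show ?thesis using harmonic_component_integral[OF cu Y] by (simp add: mult.commute)
    next
      case False
      then show ?thesis
        using spherical_harmonics_orthogonal[OF Y harmonic_component_in[OF cu, of j]] dim by simp
    qed
    ultimately have "(\<lambda>j. if j = l then ?I else 0) sums (\<integral>x. Y x * S x \<partial>sphere_measure)" by simp
    moreover have "(\<lambda>j. if j = l then ?I else 0) sums ?I" using sums_single[of l "\<lambda>_. ?I"] by (simp add: eq_commute)
    ultimately have "(\<integral>x. Y x * S x \<partial>sphere_measure) = ?I" by (rule sums_unique2)
    then have SY: "(\<integral>x. S x * Y x \<partial>sphere_measure) = ?I" by (simp add: mult.commute)
    have i: "integrable sphere_measure (\<lambda>x. u x * Y x)" "integrable sphere_measure (\<lambda>x. S x * Y x)"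
      by (intro integrable_continuous_on_sphere continuous_on_mult cu cS cY)+
    show "(\<integral>x. (u x - S x) * Y x \<partial>sphere_measure) = 0"
      unfolding left_diff_distrib Bochner_Integration.integral_diff[OF i] SY by simp
  qed
  from continuous_AE_sphere_zero[OF continuous_on_diff[OF cu cS] orthogonal_to_harmonics_AE_zero[OF this dim] x]
  have "u x = S x" by simp
  moreover obtain C where C: "\<And>l x. x \<in> sphere 0 1 \<Longrightarrow> \<bar>1 * harmonic_component l u x\<bar> \<le> C / real (Suc l) ^ 2"
    using harmonic_multiplier_summable_bound[OF u one] by blast
  then have "summable (\<lambda>l. harmonic_component l u x)"
    using x by (intro summable_comparison_test[OF _ summable_inverse_Suc_squares[of C]]) auto
  ultimately show ?thesis unfolding S_def by (simp add: sums_iff)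
qed

end

text \<open>Reversing the order of the second factors separates the product. It evaluates the
  eigenvalues of the integer operators with \<open>a = l + n / 2\<close> and \<open>c = - k\<close>,
  and those of the critical one with \<open>a = l\<close>, \<open>c = n - h\<close> and
  \<open>h = n div 2\<close> in the place of \<open>k\<close>.\<close>

lemma prod_quadratic_pochhammer:
  fixes a :: real
  shows "(\<Prod>j<k. (a + real j) * (a + c + real k - 1 - real j)) = pochhammer a k * pochhammer (a + c) k"
proof -
  have "(\<Prod>j<k. a + c + real k - 1 - real j) = (\<Prod>j<k. a + c + real (k - Suc j))"
    by (intro prod.cong refl) (simp add: of_nat_diff)
  also have "\<dots> = (\<Prod>j<k. a + c + real j)" by (rule prod.nat_diff_reindex)
  finally show ?thesis by (simp add: prod.distrib pochhammer_prod lessThan_atLeast0)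
qed

section \<open>Green functions of spectral multipliers\<close>

context
  assumes dim: "DIM('a::euclidean_space) \<ge> 3"
begin

lemma harmonic_component_harmonic:
  fixes Y :: "'a \<Rightarrow> real"
  assumes Y: "Y \<in> spherical_harmonics l"
  shows "harmonic_component j Y = (if j = l then Y else (\<lambda>x. 0))"
proof (cases "j = l")
  case True
  then show ?thesis using harmonic_component_eqI[OF dim Y] by simp
next
  case False
  have "harmonic_component j Y = (\<lambda>x. 0)"
    using False dim by (intro harmonic_component_eqI[OF dim spherical_harmonics_zero])
      (simp add: spherical_harmonics_orthogonal[OF Y])
  then show ?thesis using False by simp
qed

lemma spectral_sum_harmonic:
  fixes Y :: "'a \<Rightarrow> real"
  assumes Y: "Y \<in> spherical_harmonics l"
  shows "(\<Sum>j. m j * harmonic_component j Y x) = m l * Y x"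
proof -
  have "(\<lambda>j. m j * harmonic_component j Y x) = (\<lambda>j. if l = j then m l * Y x else 0)"
    by (auto simp: harmonic_component_harmonic[OF Y])
  then show ?thesis using sums_unique[OF sums_single[of l "\<lambda>j. m l * Y x"]] by (simp add: eq_commute)
qed

context
  fixes L :: "('a \<Rightarrow> real) \<Rightarrow> 'a \<Rightarrow> real" and m \<kappa> :: "nat \<Rightarrow> real" and A :: real and p :: nat
  assumes L: "\<And>u x. smooth_on_sphere u \<Longrightarrow> x \<in> sphere 0 1 \<Longrightarrow> L u x = (\<Sum>l. m l * harmonic_component l u x)"
    and growth: "\<And>l. \<bar>m l\<bar> \<le> A * real (Suc l) ^ p"
begin

lemma spectral_integrable:
  assumes K: "integrable sphere_measure K" and u: "smooth_on_sphere u"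
  shows "integrable sphere_measure (\<lambda>x. K x * L u x)"
  using integrable_mult_continuous_sphere[OF K harmonic_multiplier_continuous[OF dim u growth]]
  by (subst Bochner_Integration.integrable_cong[OF refl]) (auto simp: L[OF u])

lemma spectral_sums:
  assumes K: "integrable sphere_measure K" and u: "smooth_on_sphere u"
  shows "(\<lambda>l. m l * (\<integral>x. K x * harmonic_component l u x \<partial>sphere_measure)) sums (\<integral>x. K x * L u x \<partial>sphere_measure)"
proof -
  have "(\<integral>x. K x * L u x \<partial>sphere_measure) = (\<integral>x. K x * (\<Sum>l. m l * harmonic_component l u x) \<partial>sphere_measure)"
    by (rule Bochner_Integration.integral_cong) (auto simp: L[OF u])
  then show ?thesis using harmonic_multiplier_integral[OF dim u growth K] by simp
qed

lemma spectral_harmonic: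
  fixes Y :: "'a \<Rightarrow> real"
  assumes Y: "Y \<in> spherical_harmonics l"
  shows "(\<integral>x. K x * L Y x \<partial>sphere_measure) = m l * (\<integral>x. K x * Y x \<partial>sphere_measure)"
proof -
  have "(\<integral>x. K x * L Y x \<partial>sphere_measure) = (\<integral>x. m l * (K x * Y x) \<partial>sphere_measure)"
    by (rule Bochner_Integration.integral_cong)
      (auto simp: L[OF smooth_on_sphere_poly[OF spherical_harmonics_poly[OF Y]]] spectral_sum_harmonic[OF Y])
  then show ?thesis by (simp only: integral_mult_right_zero)
qed

text \<open>Existence is termwise: \<open>m l * \<kappa> l = 1\<close> turns the integrated series
  into the expansion of \<open>u\<close> at \<open>Q\<close>. For uniqueness the equation is tested
  on harmonics only; as \<open>m l\<close> is nonzero, they determine every pairing of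
  \<open>G\<close> with a harmonic, and completeness applies.\<close>

theorem is_the_green_function_multiplier:
  assumes int: "\<And>Q. Q \<in> sphere 0 1 \<Longrightarrow> integrable sphere_measure (\<lambda>P. K P Q)"
    and eigen: "\<And>Q l Y. Q \<in> sphere 0 1 \<Longrightarrow> Y \<in> spherical_harmonics l \<Longrightarrow>
      (\<integral>P. K P Q * Y P \<partial>sphere_measure) = \<kappa> l * Y Q"
    and inv: "\<And>l. m l * \<kappa> l = 1"
  shows "is_the_green_function L K"
  unfolding is_the_green_function_def
proof (intro conjI allI impI ballI)
  show "green_function L K"
    unfolding green_function_def
  proof (intro ballI conjI allI impI)
    fix Q :: 'a assume Q: "Q \<in> sphere 0 1"
    show "integrable sphere_measure (\<lambda>P. K P Q)" by (rule int[OF Q])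
    fix u :: "'a \<Rightarrow> real" assume u: "smooth_on_sphere u"
    show "integrable sphere_measure (\<lambda>P. K P Q * L u P)"
      by (rule spectral_integrable[OF int[OF Q] u])
    have "m l * (\<integral>x. K x Q * harmonic_component l u x \<partial>sphere_measure) = harmonic_component l u Q" for l
      using eigen[OF Q harmonic_component_in[OF dim smooth_on_sphere_continuous[OF u]], of l] inv[of l]
      by (simp add: mult.assoc[symmetric])
    then have "(\<lambda>l. harmonic_component l u Q) sums (\<integral>P. K P Q * L u P \<partial>sphere_measure)"
      using spectral_sums[OF int[OF Q] u] by simp
    with harmonic_expansion[OF dim u Q] show "u Q = (\<integral>P. K P Q * L u P \<partial>sphere_measure)"
      by (rule sums_unique2)
  qed
next
  fix G Q assume G: "green_function L G" and Q: "Q \<in> sphere (0::'a) 1"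
  have iG: "integrable sphere_measure (\<lambda>P. G P Q)" using G Q by (auto simp: green_function_def)
  have "orthogonal_to_harmonics (\<lambda>P. G P Q - K P Q)"
    unfolding orthogonal_to_harmonics_def
  proof (intro conjI allI ballI)
    show "integrable sphere_measure (\<lambda>P. G P Q - K P Q)" using iG int[OF Q] by simp
    fix l and Y :: "'a \<Rightarrow> real" assume Y: "Y \<in> spherical_harmonics l"
    have cY: "continuous_on (sphere 0 1) Y" by (rule spherical_harmonics_continuous[OF Y])
    have "Y Q = m l * (\<integral>P. G P Q * Y P \<partial>sphere_measure)"
      using G Q smooth_on_sphere_poly[OF spherical_harmonics_poly[OF Y]] spectral_harmonic[OF Y, of "\<lambda>P. G P Q"]
      by (auto simp: green_function_def)
    then have "\<kappa> l * Y Q = (m l * \<kappa> l) * (\<integral>P. G P Q * Y P \<partial>sphere_measure)" by simp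
    then have "(\<integral>P. G P Q * Y P \<partial>sphere_measure) = (\<integral>P. K P Q * Y P \<partial>sphere_measure)"
      by (simp add: inv eigen[OF Q Y])
    then show "(\<integral>P. (G P Q - K P Q) * Y P \<partial>sphere_measure) = 0"
      unfolding left_diff_distrib Bochner_Integration.integral_diff[OF integrable_mult_continuous_sphere[OF iG cY]
        integrable_mult_continuous_sphere[OF int[OF Q] cY]] by simp
  qed
  from orthogonal_to_harmonics_AE_zero[OF this dim] show "AE P in sphere_measure. G P Q = K P Q" by simp
qed

text \<open>Because \<open>m 0 = 0\<close>, the series loses the component of degree 0, which is the
  mean that the defining equation adds back. An additive constant in the kernel pairs to zero with
  all other degrees.\<close>

theorem is_the_critical_green_function_multiplier:
  assumes int: "\<And>Q. Q \<in> sphere 0 1 \<Longrightarrow> integrable sphere_measure (\<lambda>P. K P Q)"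
    and eigen: "\<And>Q l Y. Q \<in> sphere 0 1 \<Longrightarrow> l > 0 \<Longrightarrow> Y \<in> spherical_harmonics l \<Longrightarrow>
      (\<integral>P. K P Q * Y P \<partial>sphere_measure) = \<kappa> l * Y Q"
    and inv: "\<And>l. l > 0 \<Longrightarrow> m l * \<kappa> l = 1" and m0: "m 0 = 0"
  shows "is_the_critical_green_function L K"
proof -
  define V where "V = sphere_volume TYPE('a)"
  have V: "V > 0" using sphere_volume_pos by (simp add: V_def)
  have mean: "(\<integral>P. Y P \<partial>sphere_measure) = 0" if "Y \<in> spherical_harmonics l" "l > 0" for Y :: "'a \<Rightarrow> real" and l
    using spherical_harmonics_orthogonal[OF that(1) spherical_harmonics_const[of 1]] that dim by simp
  show ?thesis
    unfolding is_the_critical_green_function_def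
  proof (intro conjI allI impI ballI)
    fix c
    show "critical_green_function L (\<lambda>P Q. K P Q + c)"
      unfolding critical_green_function_def
    proof (intro ballI conjI allI impI)
      fix Q :: 'a assume Q: "Q \<in> sphere 0 1"
      show i: "integrable sphere_measure (\<lambda>P. K P Q + c)" using int[OF Q] by simp
      fix u :: "'a \<Rightarrow> real" assume u: "smooth_on_sphere u"
      show "integrable sphere_measure (\<lambda>P. (K P Q + c) * L u P)"
        by (rule spectral_integrable[OF i u])
      have cu: "continuous_on (sphere 0 1) u" by (rule smooth_on_sphere_continuous[OF u])
      have "m l * (\<integral>x. (K x Q + c) * harmonic_component l u x \<partial>sphere_measure)
        = harmonic_component l u Q - (if 0 = l then harmonic_component 0 u Q else 0)" for l
      proof (cases "l = 0")
        case False
        then have l: "l > 0" by simp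
        note Y = harmonic_component_in[OF dim cu, of l]
        note cY = spherical_harmonics_continuous[OF Y, of "sphere 0 1"]
        have "(\<integral>x. (K x Q + c) * harmonic_component l u x \<partial>sphere_measure)
          = (\<integral>x. K x Q * harmonic_component l u x \<partial>sphere_measure) + c * (\<integral>x. harmonic_component l u x \<partial>sphere_measure)"
          unfolding distrib_right Bochner_Integration.integral_add[OF integrable_mult_continuous_sphere[OF int[OF Q] cY]
            integrable_mult_right[OF integrable_continuous_on_sphere[OF cY]]] integral_mult_right_zero ..
        also have "\<dots> = \<kappa> l * harmonic_component l u Q" by (simp add: eigen[OF Q l Y] mean[OF Y l])
        finally show ?thesis using inv[OF l] l by (simp add: mult.assoc[symmetric])
      qed (simp add: m0)
      then have "(\<lambda>l. harmonic_component l u Q - (if 0 = l then harmonic_component 0 u Q else 0)) sums (\<integral>P. (K P Q + c) * L u P \<partial>sphere_measure)"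
        using spectral_sums[OF i u] by simp
      moreover have "(\<lambda>l. harmonic_component l u Q - (if 0 = l then harmonic_component 0 u Q else 0)) sums (u Q - harmonic_component 0 u Q)"
        using sums_single[of 0 "\<lambda>_. harmonic_component 0 u Q"]
        by (intro sums_diff harmonic_expansion[OF dim u Q]) (simp add: eq_commute)
      ultimately have "(\<integral>P. (K P Q + c) * L u P \<partial>sphere_measure) = u Q - harmonic_component 0 u Q"
        by (rule sums_unique2)
      moreover have "harmonic_component 0 u Q = 1 / V * (\<integral>P. u P \<partial>sphere_measure)"
      proof -
        note Y = harmonic_component_in[OF dim cu, of 0]
        have "(\<integral>x. harmonic_component 0 u x * 1 \<partial>sphere_measure) = (\<integral>P. u P * 1 \<partial>sphere_measure)"
          by (rule harmonic_component_integral[OF dim cu spherical_harmonics_const])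
        moreover have "(\<integral>x. harmonic_component 0 u x * 1 \<partial>sphere_measure) = (\<integral>x. harmonic_component 0 u Q \<partial>(sphere_measure :: 'a measure))"
          by (rule Bochner_Integration.integral_cong) (use spherical_harmonics_0_const[OF Y] in \<open>metis mult_1_right\<close>)+
        ultimately have "harmonic_component 0 u Q * V = (\<integral>P. u P \<partial>sphere_measure)"
          by (simp only: integral_sphere_const V_def mult_1_right)
        then show ?thesis using V by (simp add: field_simps)
      qed
      ultimately show "u Q = 1 / sphere_volume TYPE('a) * (\<integral>P. u P \<partial>sphere_measure) + (\<integral>P. (K P Q + c) * L u P \<partial>sphere_measure)"
        by (simp add: V_def)
    qed
  next
    fix G Q assume G: "critical_green_function L G" and Q: "Q \<in> sphere (0::'a) 1"
    have iG: "integrable sphere_measure (\<lambda>P. G P Q)" using G Q by (auto simp: critical_green_function_def)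
    \<comment> \<open>The mean of the difference, chosen so that after subtracting \<open>c\<close>
      the pairing with constants vanishes too.\<close>
    define c where "c = (\<integral>P. G P Q - K P Q \<partial>sphere_measure) / V"
    have iH: "integrable sphere_measure (\<lambda>P. G P Q - K P Q)" using iG int[OF Q] by simp
    have "orthogonal_to_harmonics (\<lambda>P. G P Q - K P Q - c)"
      unfolding orthogonal_to_harmonics_def
    proof (intro conjI allI ballI)
      show "integrable sphere_measure (\<lambda>P. G P Q - K P Q - c)"
        by (intro Bochner_Integration.integrable_diff iG int[OF Q] integrable_sphere_const)
      fix l and Y :: "'a \<Rightarrow> real" assume Y: "Y \<in> spherical_harmonics l"
      have cY: "continuous_on (sphere 0 1) Y" by (rule spherical_harmonics_continuous[OF Y])
      note i = integrable_mult_continuous_sphere[OF iG cY] integrable_mult_continuous_sphere[OF int[OF Q] cY]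
      have eq: "(\<integral>P. (G P Q - K P Q - c) * Y P \<partial>sphere_measure) =
         (\<integral>P. (G P Q - K P Q) * Y P \<partial>sphere_measure) - c * (\<integral>P. Y P \<partial>sphere_measure)"
        unfolding left_diff_distrib[of "_ - _" c] Bochner_Integration.integral_diff[OF integrable_mult_continuous_sphere[OF iH cY]
            integrable_mult_right[OF integrable_continuous_on_sphere[OF cY]]] integral_mult_right_zero ..
      show "(\<integral>P. (G P Q - K P Q - c) * Y P \<partial>sphere_measure) = 0"
      proof (cases "l = 0")
        case True
        then have const: "Y P = Y 0" for P using Y spherical_harmonics_0_const by blast
        have "(\<integral>P. (G P Q - K P Q) * Y P \<partial>sphere_measure) = (\<integral>P. G P Q - K P Q \<partial>sphere_measure) * Y 0"
          by (subst const) (rule integral_mult_left_zero)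
        moreover have "(\<integral>P. Y P \<partial>(sphere_measure :: 'a measure)) = Y 0 * V"
          by (subst const) (simp only: integral_sphere_const V_def)
        ultimately show ?thesis unfolding eq using V by (simp add: c_def)
      next
        case False
        then have l: "l > 0" by simp
        have "Y Q = 1 / V * (\<integral>P. Y P \<partial>sphere_measure) + m l * (\<integral>P. G P Q * Y P \<partial>sphere_measure)"
          using G Q smooth_on_sphere_poly[OF spherical_harmonics_poly[OF Y]]
          unfolding critical_green_function_def V_def spectral_harmonic[OF Y, symmetric] by blast
        then have "Y Q = m l * (\<integral>P. G P Q * Y P \<partial>sphere_measure)" by (simp add: mean[OF Y l])
        then have "\<kappa> l * Y Q = (m l * \<kappa> l) * (\<integral>P. G P Q * Y P \<partial>sphere_measure)" by simp
        then have "(\<integral>P. G P Q * Y P \<partial>sphere_measure) = (\<integral>P. K P Q * Y P \<partial>sphere_measure)"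
          by (simp add: inv[OF l] eigen[OF Q l Y])
        then have "(\<integral>P. (G P Q - K P Q) * Y P \<partial>sphere_measure) = 0"
          unfolding left_diff_distrib Bochner_Integration.integral_diff[OF i] by simp
        then show ?thesis unfolding eq by (simp add: mean[OF Y l])
      qed
    qed
    from orthogonal_to_harmonics_AE_zero[OF this dim] have "AE P in sphere_measure. G P Q = K P Q + c"
      by (simp add: algebra_simps)
    then show "\<exists>c. AE P in sphere_measure. G P Q = K P Q + c" by blast
  qed
qed

end

section \<open>The GJMS operators as spectral multipliers\<close>

text \<open>Smoothness is part of the induction because the action of each factor on components is
  known for smooth functions.\<close>

lemma foldr_shifted_laplacian:
  fixes u :: "'a \<Rightarrow> real"
  assumes u: "smooth_on_sphere u"
  shows "smooth_on_sphere (foldr (\<lambda>i. shifted_laplacian (f i)) xs u) \<and>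
    harmonic_component l (foldr (\<lambda>i. shifted_laplacian (f i)) xs u)
      = (\<lambda>x. prod_list (map (\<lambda>i. real l * (real l + real DIM('a) - 2) + f i) xs) * harmonic_component l u x)"
proof (induction xs)
  case Nil
  then show ?case using u by simp
next
  case (Cons i xs)
  then show ?case
    by (simp add: smooth_on_sphere_shifted_laplacian harmonic_component_shifted_laplacian[OF dim] mult.assoc)
qed

context
  fixes n :: nat
  assumes n: "DIM('a) = n + 1"
begin

lemma n_ge_2: "n \<ge> 2" using dim n by simp

lemma real_n: "real n = real DIM('a) - 1" by (simp add: n)

text \<open>With \<open>a = l + n / 2\<close> the factor of index \<open>j + 1\<close> has
  eigenvalue \<open>(a + j) * (a - 1 - j)\<close>, so the whole product is
  \<open>pochhammer (a - k) (2 * k)\<close>. The hypothesis keeps \<open>a - k\<close> off the poles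
  of Gamma, which allows it to be written as a Gamma quotient.\<close>

lemma gjms_integer_multiplier:
  fixes u :: "'a \<Rightarrow> real"
  assumes u: "smooth_on_sphere u" and x: "x \<in> sphere 0 1" and k: "\<And>l. real l + real n / 2 - real k \<notin> \<int>\<^sub>\<le>\<^sub>0"
  shows "gjms_integer n k u x
    = (\<Sum>l. Gamma (real l + real n / 2 + real k) / Gamma (real l + real n / 2 - real k) * harmonic_component l u x)"
proof -
  define f where "f i = (real n / 2 + real i - 1) * (real n / 2 - real i)" for i
  define v where "v = foldr (\<lambda>i. shifted_laplacian (f i)) [1..<Suc k] u"
  have v: "smooth_on_sphere v" and comp: "\<And>l. harmonic_component l v
      = (\<lambda>x. prod_list (map (\<lambda>i. real l * (real l + real DIM('a) - 2) + f i) [1..<Suc k]) * harmonic_component l u x)"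
    using foldr_shifted_laplacian[OF u, where f = f and xs = "[1..<Suc k]"] by (auto simp only: v_def)
  have "prod_list (map (\<lambda>i. real l * (real l + real DIM('a) - 2) + f i) [1..<Suc k])
    = Gamma (real l + real n / 2 + real k) / Gamma (real l + real n / 2 - real k)" for l
  proof -
    define a where "a = real l + real n / 2"
    have "prod_list (map (\<lambda>i. real l * (real l + real DIM('a) - 2) + f i) [1..<Suc k])
      = (\<Prod>i=1..<Suc k. real l * (real l + real DIM('a) - 2) + f i)"
      by (subst prod.distinct_set_conv_list[symmetric]) (simp_all del: upt_Suc)
    also have "\<dots> = (\<Prod>j<k. real l * (real l + real DIM('a) - 2) + f (Suc j))"
      unfolding One_nat_def prod.shift_bounds_Suc_ivl lessThan_atLeast0 ..
    also have "\<dots> = (\<Prod>j<k. (a + real j) * (a + (- real k) + real k - 1 - real j))"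
      by (intro prod.cong refl) (simp add: f_def a_def n field_simps)
    also have "\<dots> = pochhammer (a - real k) k * pochhammer (a - real k + real k) k"
      unfolding prod_quadratic_pochhammer by simp
    also have "\<dots> = pochhammer (a - real k) (k + k)"
      by (simp only: pochhammer_product'[of "a - real k" k k])
    also have "\<dots> = Gamma (a - real k + real (k + k)) / Gamma (a - real k)"
      using k[of l] by (intro pochhammer_Gamma) (simp add: a_def)
    also have "a - real k + real (k + k) = a + real k" by simp
    finally show ?thesis unfolding a_def .
  qed
  then have "(\<lambda>l. harmonic_component l v x) = (\<lambda>l. Gamma (real l + real n / 2 + real k) / Gamma (real l + real n / 2 - real k) * harmonic_component l u x)"
    unfolding comp by simp
  moreover have "gjms_integer n k u x = v x"
    by (simp add: gjms_integer_def v_def f_def)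
  moreover have "v x = (\<Sum>l. harmonic_component l v x)"
    using harmonic_expansion[OF dim v x] by (rule sums_unique)
  ultimately show ?thesis by simp
qed

text \<open>\<open>pochhammer (real l) n\<close> is \<open>Gamma (l + n) / Gamma l\<close> for
  \<open>l > 0\<close> and has the required value 0 at \<open>l = 0\<close>. For even
  \<open>n\<close> the Laplacian factors supply all of its factors; for odd \<open>n\<close> they
  leave out the middle one, \<open>l + (n - 1) / 2\<close>, which is the eigenvalue of the square
  root.\<close>

lemma gjms_critical_multiplier:
  fixes u :: "'a \<Rightarrow> real"
  assumes u: "smooth_on_sphere u" and x: "x \<in> sphere 0 1"
  shows "gjms_critical n u x = (\<Sum>l. pochhammer (real l) n * harmonic_component l u x)"
proof -
  define h where "h = n div 2"
  define v where "v = foldr (\<lambda>j. shifted_laplacian (real j * (real n - 1 - real j))) [0..<n div 2] u"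
  have v: "smooth_on_sphere v" and comp: "\<And>l. harmonic_component l v
      = (\<lambda>x. prod_list (map (\<lambda>j. real l * (real l + real DIM('a) - 2) + real j * (real n - 1 - real j)) [0..<n div 2]) * harmonic_component l u x)"
    using foldr_shifted_laplacian[OF u, where f = "\<lambda>j. real j * (real n - 1 - real j)" and xs = "[0..<n div 2]"]
    by (auto simp only: v_def)
  have pl: "prod_list (map (\<lambda>j. real l * (real l + real DIM('a) - 2) + real j * (real n - 1 - real j)) [0..<n div 2])
     = pochhammer (real l) h * pochhammer (real l + (real n - real h)) h" for l
  proof -
    have "prod_list (map (\<lambda>j. real l * (real l + real DIM('a) - 2) + real j * (real n - 1 - real j)) [0..<n div 2])
      = (\<Prod>j<h. real l * (real l + real DIM('a) - 2) + real j * (real n - 1 - real j))"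
      unfolding h_def lessThan_atLeast0 by (subst prod.distinct_set_conv_list[symmetric]) simp_all
    also have "\<dots> = (\<Prod>j<h. (real l + real j) * (real l + (real n - real h) + real h - 1 - real j))"
      by (intro prod.cong refl) (simp add: n algebra_simps)
    finally show ?thesis unfolding prod_quadratic_pochhammer .
  qed
  show ?thesis
  proof (cases "even n")
    case True
    then have nh: "n = h + h" by (auto simp: h_def)
    have "gjms_critical n u x = v x" using True by (simp add: gjms_critical_def v_def)
    also have "\<dots> = (\<Sum>l. harmonic_component l v x)"
      using harmonic_expansion[OF dim v x] by (rule sums_unique)
    also have "\<dots> = (\<Sum>l. pochhammer (real l) n * harmonic_component l u x)"
      unfolding comp pl by (simp only: nh pochhammer_product' of_nat_add add_diff_cancel_right')
    finally show ?thesis .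
  next
    case False
    then have nh: "n = h + Suc h" by (auto simp: h_def elim!: oddE)
    have "gjms_critical n u x = sqrt_shifted_laplacian n v x" using False by (simp add: gjms_critical_def v_def)
    also have "\<dots> = (\<Sum>l. sqrt (real l * (real l + real n - 1) + ((real n - 1) / 2)\<^sup>2) * harmonic_component l v x)"
      by (simp add: sqrt_shifted_laplacian_def harmonic_multiplier_def)
    also have "(\<lambda>l. sqrt (real l * (real l + real n - 1) + ((real n - 1) / 2)\<^sup>2) * harmonic_component l v x)
      = (\<lambda>l. pochhammer (real l) n * harmonic_component l u x)"
    proof
      fix l
      have "real l * (real l + real n - 1) + ((real n - 1) / 2)\<^sup>2 = (real l + real h)\<^sup>2"
        by (simp add: nh power2_eq_square field_simps)
      then have sq: "sqrt (real l * (real l + real n - 1) + ((real n - 1) / 2)\<^sup>2) = real l + real h"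
        by simp
      have "pochhammer (real l) n = pochhammer (real l) h * pochhammer (real l + real h) (Suc h)"
        unfolding nh by (rule pochhammer_product')
      also have "pochhammer (real l + real h) (Suc h) = (real l + real h) * pochhammer (real l + (real n - real h)) h"
        unfolding pochhammer_rec by (simp add: nh add.assoc)
      finally have poch: "pochhammer (real l) n = pochhammer (real l) h * ((real l + real h) * pochhammer (real l + (real n - real h)) h)" .
      show "sqrt (real l * (real l + real n - 1) + ((real n - 1) / 2)\<^sup>2) * harmonic_component l v x
        = pochhammer (real l) n * harmonic_component l u x"
        unfolding sq comp pl poch by (simp add: mult_ac)
    qed
    finally show ?thesis .
  qed
qed

section \<open>Evaluation of the constants and the Green functions on the sphere\<close>

lemma sphere_volume_fact: "sphere_volume TYPE('a) * fact (n - 1) = 2 ^ n * pi powr (real n / 2) * Gamma (real n / 2)"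
proof -
  have "Gamma (real n) = fact (n - 1)"
    using Gamma_fact[of "n - 1", where 'a = real] n_ge_2 by (simp add: of_nat_diff)
  moreover have "4 powr (real n / 2) = 2 ^ n"
    using powr_powr[of 2 2 "real n / 2"] by (simp add: powr_numeral powr_realpow)
  ultimately show ?thesis
    using sphere_volume_duplication[OF real_n] dim by simp
qed

lemma critical_green_constant:
  "2 / (fact (n - 1) * sphere_volume TYPE('a)) = 1 / (2 ^ (n - 1) * pi powr (real n / 2) * Gamma (real n / 2))"
proof -
  have "(2 :: real) ^ n = 2 * 2 ^ (n - 1)" using n_ge_2 by (cases n) auto
  then have "fact (n - 1) * sphere_volume TYPE('a) = 2 * (2 ^ (n - 1) * pi powr (real n / 2) * Gamma (real n / 2))"
    using sphere_volume_fact by (simp add: mult_ac)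
  then show ?thesis by simp
qed

text \<open>On degree \<open>l > 0\<close> the kernel \<open>ln (sqdist Q P)\<close> acts as
  \<open>- V * fact (l - 1) / pochhammer n l\<close>, where \<open>V\<close> is the volume.
  Multiplication by \<open>- 1 / (fact (n - 1) * V)\<close> makes this
  \<open>Gamma l / Gamma (l + n)\<close>, the inverse of the multiplier.\<close>

theorem critical_green_function_sphere:
  "is_the_critical_green_function (gjms_critical n)
     (\<lambda>P Q :: 'a. - (2 / (fact (n - 1) * sphere_volume TYPE('a))) * ln (norm (P - Q)))"
proof (rule is_the_critical_green_function_multiplier[where m = "\<lambda>l. pochhammer (real l) n"
      and \<kappa> = "\<lambda>l. fact (l - 1) / (fact (n - 1) * pochhammer (real n) l)" and A = "real n ^ n" and p = n])
  define V where "V = sphere_volume TYPE('a)"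
  have V: "V > 0" using sphere_volume_pos by (simp add: V_def)
  have dim2: "DIM('a) \<ge> 2" and n1: "real n > 1" using dim n_ge_2 by auto
  \<comment> \<open>The logarithm of the norm is half of that of its square, which removes the 2; on
    the diagonal both are \<open>ln 0 = 0\<close>.\<close>
  have ln: "- (2 / (fact (n - 1) * V)) * ln (norm (P - Q)) = - (1 / (fact (n - 1) * V)) * ln (sqdist Q P)" for P Q :: 'a
    by (cases "P = Q") (simp_all add: sqdist_def ln_realpow)
  show "gjms_critical n u x = (\<Sum>l. pochhammer (real l) n * harmonic_component l u x)"
    if "smooth_on_sphere u" "x \<in> sphere 0 1" for u and x :: 'a
    by (rule gjms_critical_multiplier[OF that])
  show "\<bar>pochhammer (real l) n\<bar> \<le> real n ^ n * real (Suc l) ^ n" for l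
  proof -
    have "\<bar>pochhammer (real l) n\<bar> = (\<Prod>i=0..<n. real l + real i)"
      by (simp add: pochhammer_prod abs_prod)
    also have "\<dots> \<le> (\<Prod>i=0..<n. real n * real (Suc l))"
    proof (rule prod_mono)
      fix i assume "i \<in> {0..<n}"
      then have "real i \<le> real n" by simp
      moreover have "real l * 1 \<le> real l * real n" using n_ge_2 by (intro mult_left_mono) auto
      ultimately show "0 \<le> real l + real i \<and> real l + real i \<le> real n * real (Suc l)"
        by (simp add: algebra_simps)
    qed
    finally show ?thesis by (simp add: power_mult_distrib)
  qed
  show "integrable sphere_measure (\<lambda>P. - (2 / (fact (n - 1) * sphere_volume TYPE('a))) * ln (norm (P - Q)))"
    if "Q \<in> sphere 0 1" for Q :: 'a
    unfolding V_def[symmetric] ln by (intro integrable_mult_right ln_sqdist_integrable[OF that real_n dim2 n1])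
  show "(\<integral>P. - (2 / (fact (n - 1) * sphere_volume TYPE('a))) * ln (norm (P - Q)) * Y P \<partial>sphere_measure)
      = fact (l - 1) / (fact (n - 1) * pochhammer (real n) l) * Y Q"
    if Q: "Q \<in> sphere 0 1" and "l > 0" and Y: "Y \<in> spherical_harmonics l" for Q l and Y :: "'a \<Rightarrow> real"
  proof -
    obtain j where j: "l = Suc j" using \<open>l > 0\<close> gr0_conv_Suc by blast
    show ?thesis
      unfolding V_def[symmetric] ln mult.assoc integral_mult_right_zero
        funk_hecke_ln[OF Q real_n dim2 n1 Y[unfolded j]] j
      using V by (simp add: V_def[symmetric] del: pochhammer_Suc)
  qed
  show "pochhammer (real l) n * (fact (l - 1) / (fact (n - 1) * pochhammer (real n) l)) = 1" if "l > 0" for l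
  proof -
    obtain j where j: "l = Suc j" using \<open>l > 0\<close> gr0_conv_Suc by blast
    \<comment> \<open>This product and the next are the factorial of \<open>n + l - 1\<close>, split
      in two ways.\<close>
    have "fact j * pochhammer (1 + real j) n = pochhammer 1 (j + n)"
      by (simp only: pochhammer_product' pochhammer_fact)
    moreover have "fact (n - 1) * pochhammer (1 + real (n - 1)) l = pochhammer 1 (n - 1 + l)"
      by (simp only: pochhammer_product' pochhammer_fact)
    moreover have "n - 1 + l = j + n" "1 + real (n - 1) = real n" "1 + real j = real l"
      using n_ge_2 by (auto simp: j of_nat_diff)
    ultimately have "fact j * pochhammer (real l) n = fact (n - 1) * pochhammer (real n) l" by simp
    moreover have "pochhammer (real n) l > 0" using n1 by (intro pochhammer_pos) simp
    ultimately show ?thesis by (simp add: j field_simps)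
  qed
  show "pochhammer (real 0) n = 0" using n_ge_2 by (cases n) (auto simp: pochhammer_rec)
qed

text \<open>At exponent \<open>s = \<sigma> - n / 2\<close> the Funk-Hecke quotient is
  \<open>pochhammer b l / pochhammer d l\<close> with \<open>b = - s\<close> and
  \<open>d = n + s\<close>. The constant of the kernel times the total mass is
  \<open>Gamma b / Gamma d\<close>, and the product is the inverse of the multiplier.
  \<open>L\<close> is left general so that integer and fractional operators share the proof.\<close>

theorem green_function_sphere:
  fixes \<sigma> :: real
  assumes \<sigma>: "\<sigma> > 0" "\<sigma> - real n / 2 \<notin> \<nat>"
    and L: "\<And>u x. smooth_on_sphere u \<Longrightarrow> x \<in> sphere 0 1 \<Longrightarrow> L u x =
      (\<Sum>l. Gamma (real l + real n / 2 + \<sigma>) / Gamma (real l + real n / 2 - \<sigma>) * harmonic_component l u x)"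
  shows "is_the_green_function L (\<lambda>P Q :: 'a.
     Gamma (real n / 2 - \<sigma>) / (2 powr (2 * \<sigma>) * pi powr (real n / 2) * Gamma \<sigma>) * norm (P - Q) powr (2 * \<sigma> - real n))"
proof -
  define s where "s = \<sigma> - real n / 2"
  define b where "b = real n / 2 - \<sigma>"
  define d where "d = real n / 2 + \<sigma>"
  define c where "c = Gamma b / (2 powr (2 * \<sigma>) * pi powr (real n / 2) * Gamma \<sigma>)"
  have dim2: "DIM('a) \<ge> 2" using dim by simp
  have s: "s > - real n / 2" using \<sigma> by (simp add: s_def)
  have d: "d > 0" using \<sigma> by (simp add: d_def add_nonneg_pos)
  have G\<sigma>: "Gamma \<sigma> > 0" using \<sigma> by (intro Gamma_real_pos)
  have Gd: "Gamma (d + real l) > 0" for l using d by (intro Gamma_real_pos) simp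
  \<comment> \<open>The excluded \<sigma> are those with \<open>b + j = 0\<close>: there
    \<open>Gamma b\<close> would be at a pole, and the Funk-Hecke quotient would vanish in all
    degrees above \<open>j\<close>.\<close>
  have bj: "b + real j \<noteq> 0" for j
  proof
    assume "b + real j = 0"
    then have "\<sigma> - real n / 2 = real j" by (simp add: b_def)
    then show False using \<sigma>(2) by (metis of_nat_in_Nats)
  qed
  have bn: "b + real l \<notin> \<int>\<^sub>\<le>\<^sub>0" for l
  proof
    assume "b + real l \<in> \<int>\<^sub>\<le>\<^sub>0"
    then obtain j where "b + real l = - real j" by (elim nonpos_Ints_cases') auto
    then have "b + real (l + j) = 0" by simp
    with bj show False by blast
  qed
  have Gb: "Gamma (b + real l) \<noteq> 0" for l using bn by (simp add: Gamma_eq_zero_iff)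
  have pb: "pochhammer b l = Gamma (b + real l) / Gamma b" for l
    using bn[of 0] by (intro pochhammer_Gamma) simp
  have pd: "pochhammer d l = Gamma (d + real l) / Gamma d" for l
    using d by (intro pochhammer_Gamma) (auto elim!: nonpos_Ints_cases)
  have kernel: "Gamma (real n / 2 - \<sigma>) / (2 powr (2 * \<sigma>) * pi powr (real n / 2) * Gamma \<sigma>) * norm (P - Q) powr (2 * \<sigma> - real n)
      = c * sqdist Q P powr s" for P Q :: 'a
    using sqdist_powr[of P Q s] by (simp add: c_def b_def s_def right_diff_distrib)
  obtain p where p: "\<And>l. \<bar>pochhammer d l / pochhammer b l\<bar> \<le> real (Suc l) ^ p"
    using pochhammer_ratio_growth[OF bj] by blast
  show ?thesis
    unfolding kernel
  proof (rule is_the_green_function_multiplier[where m = "\<lambda>l. Gamma (d + real l) / Gamma (b + real l)"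
      and \<kappa> = "\<lambda>l. Gamma (b + real l) / Gamma (d + real l)" and A = "\<bar>Gamma d / Gamma b\<bar>" and p = p])
    show "L u x = (\<Sum>l. Gamma (d + real l) / Gamma (b + real l) * harmonic_component l u x)"
      if "smooth_on_sphere u" "x \<in> sphere 0 1" for u and x :: 'a
      using L[OF that] by (simp add: d_def b_def algebra_simps)
    show "\<bar>Gamma (d + real l) / Gamma (b + real l)\<bar> \<le> \<bar>Gamma d / Gamma b\<bar> * real (Suc l) ^ p" for l
    proof -
      have "Gamma (d + real l) / Gamma (b + real l) = Gamma d / Gamma b * (pochhammer d l / pochhammer b l)"
        using Gb[of 0] Gd[of 0] by (simp add: pb pd)
      then show ?thesis using p[of l] by (simp only: abs_mult) (intro mult_left_mono, auto)
    qed
    show "integrable sphere_measure (\<lambda>P. c * sqdist Q P powr s)" if "Q \<in> sphere 0 1" for Q :: 'a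
      by (intro integrable_mult_right sqdist_integrable[OF that real_n dim2] s)
    show "(\<integral>P. c * sqdist Q P powr s * Y P \<partial>sphere_measure) = Gamma (b + real l) / Gamma (d + real l) * Y Q"
      if Q: "Q \<in> sphere 0 1" and Y: "Y \<in> spherical_harmonics l" for Q l and Y :: "'a \<Rightarrow> real"
    proof -
      have "4 powr \<sigma> = 2 powr (2 * \<sigma>)"
        using powr_powr[of 2 2 \<sigma>] by (simp add: powr_numeral)
      then have "zonal_mass Q s = pi powr (real n / 2) * 2 powr (2 * \<sigma>) * Gamma \<sigma> / Gamma d"
        using zonal_mass_eq[OF Q real_n dim2 s] by (simp add: s_def d_def add.commute)
      then have "c * zonal_mass Q s = Gamma b / Gamma d"
        using G\<sigma> by (simp add: c_def)
      moreover have "(\<integral>P. sqdist Q P powr s * Y P \<partial>sphere_measure) = zonal_mass Q s * (pochhammer b l / pochhammer d l) * Y Q"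
        using funk_hecke[OF Q real_n dim2 s Y] by (simp add: s_def b_def d_def add.commute)
      ultimately have "(\<integral>P. c * sqdist Q P powr s * Y P \<partial>sphere_measure) = Gamma b / Gamma d * (pochhammer b l / pochhammer d l) * Y Q"
        by (simp only: mult.assoc integral_mult_right_zero) (simp only: mult.assoc[symmetric])
      then show ?thesis using Gb[of 0] Gd[of 0] by (simp add: pb pd)
    qed
    show "Gamma (d + real l) / Gamma (b + real l) * (Gamma (b + real l) / Gamma (d + real l)) = 1" for l
      using Gb[of l] Gd[of l] by simp
  qed
qed

end

end

section \<open>The three families of operators on the unit sphere of
  \<open>real ^ 'd\<close>\<close>

theorem theorem1:
  fixes n :: nat
  assumes "n \<ge> 2" and "CARD('d::finite) = n + 1"
  shows
    "(let c\<^sub>n = 2 / (fact (n - 1) * sphere_volume TYPE(real ^ 'd)) in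
        c\<^sub>n = 1 / (2 ^ (n - 1) * pi powr (real n / 2) * Gamma (real n / 2)) \<and>
        is_the_critical_green_function (gjms_critical n)
          (\<lambda>P Q :: real ^ 'd. - c\<^sub>n * ln (norm (P - Q)))) \<and>
     (\<forall>k::nat. k \<ge> 1 \<and> (2 * k < n \<or> 2 * k > n \<and> odd n) \<longrightarrow>
        is_the_green_function (gjms_integer n k)
          (\<lambda>P Q :: real ^ 'd.
             Gamma (real n / 2 - real k) / (2 ^ (2 * k) * pi powr (real n / 2) * Gamma (real k))
             * norm (P - Q) powr (2 * real k - real n))) \<and>
     (\<forall>\<sigma>::real. \<sigma> \<in> {0<..<real n / 2} \<union> {real n / 2<..} \<and> \<sigma> - real n / 2 \<notin> \<nat> \<longrightarrow>
        is_the_green_function (gjms_fractional n \<sigma>)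
          (\<lambda>P Q :: real ^ 'd.
             Gamma (real n / 2 - \<sigma>) / (2 powr (2 * \<sigma>) * pi powr (real n / 2) * Gamma \<sigma>)
             * norm (P - Q) powr (2 * \<sigma> - real n)))"
proof -
  have n: "DIM(real ^ 'd) = n + 1" and dim: "DIM(real ^ 'd) \<ge> 3" using assms by auto
  have critical: "is_the_critical_green_function (gjms_critical n)
     (\<lambda>P Q :: real ^ 'd. - (2 / (fact (n - 1) * sphere_volume TYPE(real ^ 'd))) * ln (norm (P - Q)))"
    by (rule critical_green_function_sphere[OF dim n])
  have integer: "is_the_green_function (gjms_integer n k)
          (\<lambda>P Q :: real ^ 'd.
             Gamma (real n / 2 - real k) / (2 ^ (2 * k) * pi powr (real n / 2) * Gamma (real k))
             * norm (P - Q) powr (2 * real k - real n))"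
    if k: "k \<ge> 1" "2 * k < n \<or> 2 * k > n \<and> odd n" for k :: nat
  proof -
    \<comment> \<open>Equality would force \<open>2 * k \<ge> n\<close> with \<open>n\<close> even,
      against either alternative. It keeps both the kernel constant and the multiplier off the poles
      of Gamma.\<close>
    have half: "2 * k \<noteq> n + 2 * j" for j
      using k(2) by presburger
    have nat: "real k - real n / 2 \<notin> \<nat>"
    proof
      assume "real k - real n / 2 \<in> \<nat>"
      then obtain j where "real k - real n / 2 = real j" by (auto elim: Nats_cases)
      then have "real (2 * k) = real (n + 2 * j)" by simp
      then show False using half by (simp only: of_nat_eq_iff)
    qed
    have npos: "real l + real n / 2 - real k \<notin> \<int>\<^sub>\<le>\<^sub>0" for l
    proof
      assume "real l + real n / 2 - real k \<in> \<int>\<^sub>\<le>\<^sub>0"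
      then obtain j where "real l + real n / 2 - real k = - real j" by (elim nonpos_Ints_cases') auto
      then have "real (2 * k) = real (n + 2 * (l + j))" by simp
      then show False using half by (simp only: of_nat_eq_iff)
    qed
    have pow: "(2 :: real) ^ (2 * k) = 2 powr (2 * real k)"
      using powr_realpow[of 2 "2 * k"] by simp
    show ?thesis
      unfolding pow using k(1) nat
      by (intro green_function_sphere[OF dim n] gjms_integer_multiplier[OF dim n] npos) auto
  qed
  have fractional: "is_the_green_function (gjms_fractional n \<sigma>)
          (\<lambda>P Q :: real ^ 'd.
             Gamma (real n / 2 - \<sigma>) / (2 powr (2 * \<sigma>) * pi powr (real n / 2) * Gamma \<sigma>)
             * norm (P - Q) powr (2 * \<sigma> - real n))"
    if "\<sigma> > 0" "\<sigma> - real n / 2 \<notin> \<nat>" for \<sigma> :: real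
    using that by (intro green_function_sphere[OF dim n]) (auto simp: gjms_fractional_def harmonic_multiplier_def)
  have pos: "\<sigma> > 0" if "\<sigma> \<in> {0<..<real n / 2} \<union> {real n / 2<..}" for \<sigma> :: real
    using that by (auto intro: le_less_trans[of 0 "real n / 2"])
  show ?thesis
    unfolding Let_def using critical_green_constant[OF dim n] critical integer fractional pos by blast
qed

end
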